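(* Let $\mathfrak g$ be a finite-dimensional simple complex Lie algebra not isomorphic to $\mathrm{sl}(2)$ or $\mathrm{sl}(3)$, and let $\Sigma(\mathfrak g)\subset\mathfrak h^*$ be the set of weights defined in the context. Then $\Sigma(\mathfrak g)$ is not empty. If in addition $\mathfrak g\not\simeq\mathrm{sp}(4)$, then $\Sigma(\mathfrak g)$ is infinite.
   Context: Let $\mathfrak g$ be a finite-dimensional simple complex Lie algebra and $\mathfrak k\subset\mathfrak g$ a principal $\mathrm{sl}(2)$-subalgebra with standard basis $e,f,h=[e,f]$; $h$ is a regular semisimple element, $\mathfrak h$ is its centralizer (a Cartan subalgebra), and $\mathfrak b$ is the Borel subalgebra spanned by $\mathfrak h$ and the root spaces $\mathfrak g^\alpha$ with $\alpha(h)>0$. Let $\alpha_1,\dots,\alpha_r\in\mathfrak h^*$ be the simple roots of $\mathfrak b$ (so $\alpha_i(h)=2$ for all $i$), $\beta=m_1\alpha_1+\dots+m_r\alpha_r$ the highest root, $h_1,\dots,h_r\in\mathfrak h$ the simple coroots, and $h=n_1h_1+\dots+n_rh_r$ with $n_i$ positive integers. For $\gamma\in\mathfrak h^*$ put $\gamma_i:=\gamma(h_i)$. $\Sigma(\mathfrak g)$ is the set of all $\gamma\in\mathfrak h^*$ (with all $\gamma_i$ real) satisfying $\gamma_i\le1$ for all $i=1,\dots,r$ and $\sum_{i=1}^rn_i\gamma_i\ge1+2\sum_{i=1}^rm_i$. *)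

theory Defs
  imports "HOL-Analysis.Analysis"
begin

locale complex_lie_algebra = vector_space scale
  for scale :: "complex \<Rightarrow> 'g::ab_group_add \<Rightarrow> 'g" +
  fixes bracket :: "'g \<Rightarrow> 'g \<Rightarrow> 'g"
  assumes bracket_add_left: "bracket (x + y) z = bracket x z + bracket y z"
    and bracket_add_right: "bracket x (y + z) = bracket x y + bracket x z"
    and bracket_scale_left: "bracket (scale c x) y = scale c (bracket x y)"
    and bracket_scale_right: "bracket x (scale c y) = scale c (bracket x y)"
    and bracket_self: "bracket x x = 0"
    and jacobi: "bracket x (bracket y z) + bracket y (bracket z x) + bracket z (bracket x y) = 0"
begin

definition lie_ideal :: "'g set \<Rightarrow> bool" where
  "lie_ideal I \<longleftrightarrow> subspace I \<and> (\<forall>x. \<forall>y\<in>I. bracket x y \<in> I)"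

definition centralizer :: "'g \<Rightarrow> 'g set" where
  "centralizer x = {y. bracket x y = 0}"

definition ad_nilpotent :: "'g \<Rightarrow> bool" where
  "ad_nilpotent x \<longleftrightarrow> (\<exists>k. \<forall>y. (bracket x ^^ k) y = 0)"

definition regular :: "'g \<Rightarrow> bool" where
  "regular x \<longleftrightarrow> (\<forall>y. dim (centralizer x) \<le> dim (centralizer y))"

definition sl2_triple :: "'g \<Rightarrow> 'g \<Rightarrow> 'g \<Rightarrow> bool" where
  "sl2_triple e f h \<longleftrightarrow>
     e \<noteq> 0 \<and> bracket e f = h \<and> bracket h e = scale 2 e \<and> bracket h f = scale (- 2) f"

definition principal_sl2_triple :: "'g \<Rightarrow> 'g \<Rightarrow> 'g \<Rightarrow> bool" where
  "principal_sl2_triple e f h \<longleftrightarrow> sl2_triple e f h \<and> ad_nilpotent e \<and> regular e"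

text \<open>A functional on the subspace \<open>H\<close> is represented by its extension by zero to the
  whole type, so that distinct elements of \<open>dual H\<close> are distinct functionals on \<open>H\<close> and
  the vector space operations of the dual are pointwise.\<close>

definition dual :: "'g set \<Rightarrow> ('g \<Rightarrow> complex) set" where
  "dual H = {\<gamma>. (\<forall>x\<in>H. \<forall>y\<in>H. \<gamma> (x + y) = \<gamma> x + \<gamma> y) \<and>
                (\<forall>c. \<forall>x\<in>H. \<gamma> (scale c x) = c * \<gamma> x) \<and>
                (\<forall>x. x \<notin> H \<longrightarrow> \<gamma> x = 0)}"

definition root_space :: "'g set \<Rightarrow> ('g \<Rightarrow> complex) \<Rightarrow> 'g set" where
  "root_space H \<alpha> = {x. \<forall>t\<in>H. bracket t x = scale (\<alpha> t) x}"

definition roots :: "'g set \<Rightarrow> ('g \<Rightarrow> complex) set" where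
  "roots H = {\<alpha> \<in> dual H. \<alpha> \<noteq> (\<lambda>_. 0) \<and> root_space H \<alpha> \<noteq> {0}}"

text \<open>In the next definitions the Cartan subalgebra is the centralizer of \<open>h\<close>. The positive
  roots are those whose root spaces, together with the Cartan subalgebra, span the Borel
  subalgebra determined by \<open>h\<close>.\<close>

definition positive_roots :: "'g \<Rightarrow> ('g \<Rightarrow> complex) set" where
  "positive_roots h = {\<alpha> \<in> roots (centralizer h). \<alpha> h \<in> \<real> \<and> 0 < Re (\<alpha> h)}"

definition simple_roots :: "'g \<Rightarrow> ('g \<Rightarrow> complex) set" where
  "simple_roots h = {\<alpha> \<in> positive_roots h.
     \<not> (\<exists>\<beta>\<in>positive_roots h. \<exists>\<gamma>\<in>positive_roots h. \<alpha> = (\<lambda>t. \<beta> t + \<gamma> t))}"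

definition highest_root :: "'g \<Rightarrow> ('g \<Rightarrow> complex) \<Rightarrow> bool" where
  "highest_root h \<beta> \<longleftrightarrow> \<beta> \<in> roots (centralizer h) \<and>
     (\<forall>\<delta>\<in>roots (centralizer h). \<exists>k :: ('g \<Rightarrow> complex) \<Rightarrow> nat.
        \<forall>t. \<beta> t - \<delta> t = (\<Sum>\<alpha>\<in>simple_roots h. of_nat (k \<alpha>) * \<alpha> t))"

definition is_coroot :: "'g set \<Rightarrow> ('g \<Rightarrow> complex) \<Rightarrow> 'g \<Rightarrow> bool" where
  "is_coroot H \<alpha> c \<longleftrightarrow>
     c \<in> span {bracket x y | x y. x \<in> root_space H \<alpha> \<and> y \<in> root_space H (\<lambda>t. - \<alpha> t)} \<and>
     \<alpha> c = 2"

text \<open>The set \<open>\<Sigma>\<close> of weights, where \<open>c i\<close> are the simple coroots, \<open>m i\<close> the coefficients of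
  the highest root in the simple roots and \<open>n i\<close> those of \<open>h\<close> in the simple coroots.\<close>

definition Sigma_weights ::
    "'g \<Rightarrow> nat \<Rightarrow> (nat \<Rightarrow> 'g) \<Rightarrow> (nat \<Rightarrow> nat) \<Rightarrow> (nat \<Rightarrow> nat) \<Rightarrow> ('g \<Rightarrow> complex) set" where
  "Sigma_weights h r c m n = {\<gamma> \<in> dual (centralizer h).
     (\<forall>i\<in>{1..r}. \<gamma> (c i) \<in> \<real> \<and> Re (\<gamma> (c i)) \<le> 1) \<and>
     (\<Sum>i=1..r. real (n i) * Re (\<gamma> (c i))) \<ge> 1 + 2 * (\<Sum>i=1..r. real (m i))}"

end

locale simple_complex_lie_algebra = complex_lie_algebra +
  assumes finite_dim: "\<exists>B. finite B \<and> span B = UNIV"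
    and nonabelian: "\<exists>x y. bracket x y \<noteq> 0"
    and ideals_trivial: "lie_ideal I \<Longrightarrow> I = {0} \<or> I = UNIV"

text \<open>That \<open>h\<close> is regular semisimple, that its centralizer is a Cartan subalgebra and that
  \<open>\<alpha> i h = 2\<close> are consequences and not assumed. The data \<open>r, \<alpha>, c, m, n\<close> are determined by
  \<open>e, f, h\<close> on \<open>{1..r}\<close> up to renumbering the simple roots.\<close>

locale principal_sl2_data = simple_complex_lie_algebra scale bracket
  for scale :: "complex \<Rightarrow> 'g::ab_group_add \<Rightarrow> 'g" and bracket :: "'g \<Rightarrow> 'g \<Rightarrow> 'g" +
  fixes e f h :: 'g and r :: nat and \<alpha> :: "nat \<Rightarrow> 'g \<Rightarrow> complex" and c :: "nat \<Rightarrow> 'g"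
    and m n :: "nat \<Rightarrow> nat"
  assumes principal: "principal_sl2_triple e f h"
    and simple_roots_enum: "bij_betw \<alpha> {1..r} (simple_roots h)"
    and coroots: "i \<in> {1..r} \<Longrightarrow> is_coroot (centralizer h) (\<alpha> i) (c i)"
    and highest: "highest_root h (\<lambda>t. \<Sum>i=1..r. of_nat (m i) * \<alpha> i t)"
    and n_pos: "i \<in> {1..r} \<Longrightarrow> 0 < n i"
    and h_expansion: "h = (\<Sum>i=1..r. scale (of_nat (n i)) (c i))"

definition sl :: "(complex^'n^'n) set" where
  "sl = {X. trace X = 0}"

definition symplectic_form :: "complex^('n::finite + 'n)^('n + 'n)" where
  "symplectic_form = (\<chi> i j. case (i, j) of
       (Inl a, Inr b) \<Rightarrow> (if a = b then 1 else 0)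
     | (Inr a, Inl b) \<Rightarrow> (if a = b then - 1 else 0)
     | _ \<Rightarrow> 0)"

text \<open>For an index type with \<open>n\<close> elements this is \<open>sp(2n)\<close>.\<close>

definition sp :: "(complex^('n::finite + 'n)^('n + 'n)) set" where
  "sp = {X. transpose X ** symplectic_form + symplectic_form ** X = 0}"

definition (in complex_lie_algebra) lie_isomorphic_matrices :: "(complex^'n^'n) set \<Rightarrow> bool" where
  "lie_isomorphic_matrices S \<longleftrightarrow> (\<exists>\<phi> :: 'g \<Rightarrow> complex^'n^'n. bij_betw \<phi> UNIV S \<and>
     (\<forall>x y. \<phi> (x + y) = \<phi> x + \<phi> y) \<and>
     (\<forall>k x. \<phi> (scale k x) = (\<chi> i j. k * \<phi> x $ i $ j)) \<and>
     (\<forall>x y. \<phi> (bracket x y) = \<phi> x ** \<phi> y - \<phi> y ** \<phi> x))"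

end

theory Submission
  imports Defs "HOL-Computational_Algebra.Fundamental_Theorem_Algebra"
begin

text \<open>No classification is used. Grade the Lie algebra by the eigenvalues of \<open>ad h\<close>; regularity
  of \<open>e\<close> makes all weights even and the zero part \<open>g 0\<close>, the centralizer of \<open>h\<close>, abelian. For
  \<open>t\<close> in \<open>g 0\<close> let \<open>half_trace t\<close> be half the trace of \<open>ad t\<close> on the positive part; this is
  the functional \<open>\<rho>\<close>. It is \<open>1\<close> on every simple coroot, and at \<open>h\<close> it is the sum of
  \<open>k * D (2 * k)\<close> over \<open>k \<ge> 1\<close>, where \<open>D j\<close> is the dimension of the \<open>j\<close>-eigenspace. The height of
  the highest root is at most the largest \<open>K\<close> with \<open>D (2 * K) \<noteq> 0\<close>, so \<open>\<rho>\<close> lies in \<open>\<Sigma>\<close>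
  as soon as that sum is at least \<open>1 + 2 * K\<close>, and if the inequality is strict then so do all
  multiples \<open>s \<rho>\<close> with \<open>s \<le> 1\<close> close to \<open>1\<close>. Connectedness of the Dynkin diagram gives
  \<open>D 4 \<ge> D 2 - 1\<close>, which leaves three dimension patterns without strict inequality; in these
  the brackets can be computed and the algebra is sl(2), sl(3) or sp(4).\<close>

section \<open>Linear operators on finite-dimensional complex vector spaces\<close>

text \<open>Why \<rho>: membership caps every value on a simple coroot at 1 while all coefficients
  of \<open>h\<close> are positive, so the weighted sum is largest when all these values equal 1.
  Thus \<Sigma> can be nonempty only if \<rho> belongs to it. At \<open>h\<close>, \<rho> takes the
  values 1, 4, 7 for the three exceptional patterns, against the thresholds 3, 5, 7; the equality
  for sp(4) is why infinitude fails there. The obstacle is that the hypotheses speak of the triple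
  only: neither semisimplicity of \<open>h\<close> nor a root decomposition is given. Complete
  reducibility is replaced by arguments with the Casimir operator. Cartan's criterion is replaced by
  the remark that the Killing form at (\<open>h\<close>, \<open>h\<close>) is a sum of squares of
  integers, not all 0, which simplicity turns into nondegeneracy. The action of \<open>g 0\<close>
  is diagonalized only in degree 2; the opposite root vectors are then cut out of
  \<open>f\<close>.\<close>

definition poly_act :: "(complex \<Rightarrow> 'a \<Rightarrow> 'a) \<Rightarrow> ('a \<Rightarrow> 'a) \<Rightarrow> complex poly \<Rightarrow> 'a::ab_group_add \<Rightarrow> 'a" where
  "poly_act s T p v = (\<Sum>i\<le>degree p. s (coeff p i) ((T ^^ i) v))"

locale complex_vector_space = finite_dimensional_vector_space scale Basis
  for scale :: "complex \<Rightarrow> 'b::ab_group_add \<Rightarrow> 'b" and Basis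
begin

abbreviation lin :: "('b \<Rightarrow> 'b) \<Rightarrow> bool" where
  "lin T \<equiv> Vector_Spaces.linear scale scale T"

lemma linI:
  assumes "\<And>x y. T (x + y) = T x + T y" "\<And>c x. T (scale c x) = scale c (T x)"
  shows "lin T"
  using assms by (simp add: Vector_Spaces.linear_iff vector_space_axioms)

lemma lin_add: "lin T \<Longrightarrow> T (x + y) = T x + T y"
  by (simp add: Vector_Spaces.linear_iff)

lemma lin_scale: "lin T \<Longrightarrow> T (scale c x) = scale c (T x)"
  by (simp add: Vector_Spaces.linear_iff)

lemma lin_0: "lin T \<Longrightarrow> T 0 = 0"
  using lin_scale[of T 0 0] by simp

lemma lin_minus: "lin T \<Longrightarrow> T (- x) = - T x"
  using lin_scale[of T "-1" x] by simp

lemma lin_diff: "lin T \<Longrightarrow> T (x - y) = T x - T y"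
  using lin_add[of T x "- y"] by (simp add: lin_minus)

lemma lin_sum: "lin T \<Longrightarrow> T (sum g A) = (\<Sum>a\<in>A. T (g a))"
  by (induction A rule: infinite_finite_induct) (simp_all add: lin_0 lin_add)

lemma lin_comp: "lin S \<Longrightarrow> lin T \<Longrightarrow> lin (\<lambda>x. S (T x))"
  by (rule linI) (simp_all add: lin_add lin_scale)

lemma lin_funpow: "lin T \<Longrightarrow> lin (T ^^ k)"
proof (induction k)
  case (Suc k)
  then show ?case using lin_comp[of T "T ^^ k"] by (simp add: o_def)
qed (simp add: linI)

lemma lin_ident: "lin (\<lambda>x. x)"
  by (rule linI) simp_all

lemma lin_plus: "lin S \<Longrightarrow> lin T \<Longrightarrow> lin (\<lambda>x. S x + T x)"
  by (rule linI) (simp_all add: lin_add lin_scale scale_right_distrib)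

lemma lin_minus': "lin S \<Longrightarrow> lin T \<Longrightarrow> lin (\<lambda>x. S x - T x)"
  by (rule linI) (simp_all add: lin_add lin_scale scale_right_diff_distrib)

lemma lin_smult: "lin S \<Longrightarrow> lin (\<lambda>x. scale c (S x))"
  by (rule linI) (simp_all add: lin_add lin_scale scale_right_distrib mult.commute)

text \<open>Applying \<open>T - \<mu> i\<close> removes the summand \<open>v i\<close> and
  multiplies each other one by the nonzero number \<open>\<mu> j - \<mu> i\<close>, so induction
  applies.\<close>

lemma eigenvector_sum_zero:
  assumes T: "lin T" and "finite J" and inj: "inj_on \<mu> J"
    and eig: "\<And>j. j \<in> J \<Longrightarrow> T (v j) = scale (\<mu> j) (v j)" and zero: "(\<Sum>j\<in>J. v j) = 0"
  shows "\<forall>j\<in>J. v j = 0"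
  using assms(2-5)
proof (induction J arbitrary: v rule: finite_induct)
  case (insert i J)
  have sum0: "v i + (\<Sum>j\<in>J. v j) = 0" using insert by simp
  have "(\<Sum>j\<in>J. scale (\<mu> j - \<mu> i) (v j)) = (\<Sum>j\<in>J. T (v j)) - scale (\<mu> i) (\<Sum>j\<in>J. v j)"
    using insert by (simp add: scale_left_diff_distrib sum_subtractf scale_sum_right)
  also have "\<dots> = T (\<Sum>j\<in>J. v j) - scale (\<mu> i) (\<Sum>j\<in>J. v j)"
    by (simp add: lin_sum[OF T])
  also have "(\<Sum>j\<in>J. v j) = - v i" using sum0 by (simp add: eq_neg_iff_add_eq_0 add.commute)
  also have "T (- v i) - scale (\<mu> i) (- v i) = 0"
    using insert by (simp add: lin_minus[OF T])
  finally have "\<forall>j\<in>J. scale (\<mu> j - \<mu> i) (v j) = 0"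
    using insert by (intro insert.IH) (auto simp: lin_scale[OF T] mult.commute)
  then have *: "\<forall>j\<in>J. v j = 0" using insert by (auto simp: inj_on_def)
  then show ?case using sum0 by simp
qed simp

text \<open>Nonzero eigenvectors for infinitely many distinct eigenvalues would form an infinite
  independent set. This is what stops every lowering string.\<close>

lemma eigenvectors_vanish:
  fixes v :: "nat \<Rightarrow> 'b"
  assumes T: "lin T" and inj: "inj \<mu>" and eig: "\<And>j. T (v j) = scale (\<mu> j) (v j)"
  shows "\<exists>j. v j = 0"
proof (rule ccontr)
  assume nz: "\<nexists>j. v j = 0"
  have injv: "inj v"
  proof (rule injI)
    fix i j assume "v i = v j"
    then have "scale (\<mu> i - \<mu> j) (v i) = 0" using eig[of i] eig[of j] by (metis scale_left_diff_distrib right_minus_eq)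
    then show "i = j" using nz inj by (auto simp: inj_def)
  qed
  have "independent (range v)"
    unfolding independent_explicit_finite_subsets
  proof (intro allI impI ballI)
    fix A u w assume A: "A \<subseteq> range v" "finite A" "(\<Sum>w\<in>A. scale (u w) w) = 0" "w \<in> A"
    define J where "J = v -` A"
    have AJ: "A = v ` J" using A by (auto simp: J_def)
    have fJ: "finite J" unfolding J_def using A injv by (simp add: finite_vimageI)
    have "(\<Sum>j\<in>J. scale (u (v j)) (v j)) = 0"
      using A(3) injv unfolding AJ by (simp add: sum.reindex inj_on_subset[OF injv])
    then have "\<forall>j\<in>J. scale (u (v j)) (v j) = 0"
      by (intro eigenvector_sum_zero[OF T fJ, of \<mu>])
        (use inj in \<open>auto simp: inj_def inj_on_def lin_scale[OF T] eig mult.commute\<close>)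
    then show "u w = 0" using A(4) nz AJ by force
  qed
  then have "finite (range v)" by (rule finiteI_independent)
  then show False using injv finite_imageD infinite_UNIV_nat by blast
qed

lemma poly_act_bound:
  assumes "degree p \<le> n"
  shows "poly_act scale T p v = (\<Sum>i\<le>n. scale (coeff p i) ((T ^^ i) v))"
  unfolding poly_act_def using assms
  by (intro sum.mono_neutral_left) (auto simp: coeff_eq_0)

lemma poly_act_root:
  assumes T: "lin T"
  shows "poly_act scale T ([:- \<mu>, 1:] * q) v = T (poly_act scale T q v) - scale \<mu> (poly_act scale T q v)"
proof -
  let ?n = "degree q"
  have d: "degree ([:- \<mu>, 1:] * q) \<le> Suc ?n"
    by (rule order.trans[OF degree_mult_le]) simp
  have c: "coeff ([:- \<mu>, 1:] * q) i = (if i = 0 then 0 else coeff q (i - 1)) - \<mu> * coeff q i" for i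
    by (cases i) (simp_all add: coeff_pCons)
  have "poly_act scale T ([:- \<mu>, 1:] * q) v
      = (\<Sum>i\<le>Suc ?n. scale (if i = 0 then 0 else coeff q (i - 1)) ((T ^^ i) v))
        - (\<Sum>i\<le>Suc ?n. scale (\<mu> * coeff q i) ((T ^^ i) v))"
    unfolding poly_act_bound[OF d] c by (simp only: scale_left_diff_distrib sum_subtractf)
  also have "(\<Sum>i\<le>Suc ?n. scale (\<mu> * coeff q i) ((T ^^ i) v)) = scale \<mu> (poly_act scale T q v)"
    unfolding poly_act_bound[of q "Suc ?n", OF le_SucI[OF order_refl]] by (simp only: scale_sum_right scale_scale)
  also have "(\<Sum>i\<le>Suc ?n. scale (if i = 0 then 0 else coeff q (i - 1)) ((T ^^ i) v)) = T (poly_act scale T q v)"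
    unfolding sum.atMost_Suc_shift poly_act_def by (simp add: lin_sum[OF T] lin_scale[OF T])
  finally show ?thesis .
qed

lemma poly_act_in_subspace:
  assumes "subspace V" "\<And>x. x \<in> V \<Longrightarrow> T x \<in> V" "v \<in> V"
  shows "poly_act scale T p v \<in> V"
proof -
  have "(T ^^ i) v \<in> V" for i by (induction i) (use assms in auto)
  then show ?thesis unfolding poly_act_def using assms by (intro subspace_sum subspace_scale) auto
qed

text \<open>If no power of \<open>T\<close> applied to \<open>v\<close> depended on the lower ones,
  \<open>W (Suc dimension)\<close> would be too large an independent set.\<close>

lemma annihilating_poly: "\<exists>p. p \<noteq> 0 \<and> poly_act scale T p v = 0"
proof -
  define W where "W n = (\<lambda>i. (T ^^ i) v) ` {..<n}" for n :: nat
  have span_poly: "\<exists>q. (degree q < n \<or> q = 0) \<and> poly_act scale T q v = x" if "x \<in> span (W n)" for x n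
    using that
  proof (induction rule: span_induct_alt)
    case base
    show ?case by (intro exI[of _ 0]) (simp add: poly_act_def)
  next
    case (step c x y)
    then obtain i where i: "i < n" "x = (T ^^ i) v" by (auto simp: W_def)
    obtain q where q: "degree q < n \<or> q = 0" "poly_act scale T q v = y" using step by auto
    have "poly_act scale T (monom c i + q) v = (\<Sum>j\<le>n. scale (coeff (monom c i + q) j) ((T ^^ j) v))"
      by (rule poly_act_bound) (metis degree_0 degree_add_le degree_monom_le i(1) le_trans less_imp_le q(1) zero_le)
    also have "\<dots> = (\<Sum>j\<le>n. scale (if i = j then c else 0) ((T ^^ j) v)) + (\<Sum>j\<le>n. scale (coeff q j) ((T ^^ j) v))"
      by (simp add: scale_left_distrib sum.distrib)
    also have "(\<Sum>j\<le>n. scale (coeff q j) ((T ^^ j) v)) = y"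
      using q poly_act_bound[of q n T v] by auto
    also have "(\<Sum>j\<le>n. scale (if i = j then c else 0) ((T ^^ j) v)) = (\<Sum>j\<in>{i}. scale c ((T ^^ j) v))"
      using i by (intro sum.mono_neutral_cong_right) auto
    finally have "poly_act scale T (monom c i + q) v = scale c x + y" using i by simp
    moreover have "degree (monom c i + q) < n"
      using q i by (metis add.right_neutral degree_add_less degree_monom_le le_less_trans)
    ultimately show ?case by blast
  qed
  have "\<exists>n. (T ^^ n) v \<in> span (W n)"
  proof (rule ccontr)
    assume no: "\<nexists>n. (T ^^ n) v \<in> span (W n)"
    have "independent (W n) \<and> card (W n) = n" for n
    proof (induction n)
      case (Suc n)
      have "W (Suc n) = insert ((T ^^ n) v) (W n)" by (auto simp: W_def lessThan_Suc)
      moreover have "(T ^^ n) v \<notin> W n" using no span_base by blast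
      moreover have "finite (W n)" by (simp add: W_def)
      ultimately show ?case using Suc no independent_insertI by auto
    qed (simp_all add: W_def independent_empty)
    then have "independent (W (Suc dimension))" "card (W (Suc dimension)) = Suc dimension" by blast+
    then show False using independent_card_le_dim[of "W (Suc dimension)" UNIV] dim_subset_UNIV[of UNIV] by simp
  qed
  then obtain n q where q: "degree q < n \<or> q = 0" "poly_act scale T q v = (T ^^ n) v"
    using span_poly by blast
  let ?p = "monom 1 n - q"
  have cp: "coeff ?p n = 1" using q coeff_eq_0[of q n] by auto
  have "poly_act scale T ?p v = (\<Sum>j\<le>n. scale (coeff ?p j) ((T ^^ j) v))"
    by (rule poly_act_bound)
      (metis degree_0 degree_diff_le degree_monom_le less_imp_le q(1) zero_le)
  also have "\<dots> = (\<Sum>j\<le>n. scale (if n = j then 1 else 0) ((T ^^ j) v)) - (\<Sum>j\<le>n. scale (coeff q j) ((T ^^ j) v))"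
    by (simp add: scale_left_diff_distrib sum_subtractf)
  also have "(\<Sum>j\<le>n. scale (coeff q j) ((T ^^ j) v)) = (T ^^ n) v"
    using q poly_act_bound[of q n T v] by auto
  also have "(\<Sum>j\<le>n. scale (if n = j then 1 else 0) ((T ^^ j) v)) = (\<Sum>j\<in>{n}. scale 1 ((T ^^ j) v))"
    by (intro sum.mono_neutral_cong_right) auto
  finally have "poly_act scale T ?p v = 0" by simp
  moreover have "?p \<noteq> 0" using cp by auto
  ultimately show ?thesis by blast
qed

text \<open>A nonzero polynomial of least degree annihilating \<open>v\<close> has a root \<mu>; the
  quotient by the linear factor no longer annihilates \<open>v\<close>, and its value is the
  eigenvector. Stability keeps that value in \<open>V\<close>, so \<open>T\<close> never has to be
  restricted.\<close>

lemma eigenvector_exists: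
  assumes T: "lin T" and V: "subspace V" "V \<noteq> {0}" and stable: "\<And>x. x \<in> V \<Longrightarrow> T x \<in> V"
  obtains v \<mu> where "v \<in> V" "v \<noteq> 0" "T v = scale \<mu> v"
proof -
  obtain v where v: "v \<in> V" "v \<noteq> 0" using V subspace_0 by blast
  define P where "P p \<longleftrightarrow> p \<noteq> 0 \<and> poly_act scale T p v = 0" for p
  have "\<exists>p. P p" using annihilating_poly[of T v] unfolding P_def .
  then obtain p where p: "P p" "\<And>q. P q \<Longrightarrow> degree p \<le> degree q"
    using ex_has_least_nat[of P _ degree] by blast
  have "degree p \<noteq> 0"
  proof
    assume "degree p = 0"
    then have "scale (coeff p 0) v = 0" "coeff p 0 \<noteq> 0"
      using p(1) leading_coeff_0_iff[of p] by (simp_all add: P_def poly_act_def)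
    then show False using v by simp
  qed
  then have "\<not> constant (poly p)" by (simp add: constant_degree)
  then obtain \<mu> where "poly p \<mu> = 0" using fundamental_theorem_of_algebra by blast
  then obtain q where q: "p = [:- \<mu>, 1:] * q" using poly_eq_0_iff_dvd dvdE by metis
  have q0: "q \<noteq> 0" using q p by (auto simp: P_def)
  have "degree p = Suc (degree q)" unfolding q using q0 by (subst degree_mult_eq) auto
  then have "poly_act scale T q v \<noteq> 0" using p(2)[of q] q0 by (auto simp: P_def)
  moreover have "T (poly_act scale T q v) = scale \<mu> (poly_act scale T q v)"
    using p(1) poly_act_root[OF T, of \<mu> q v] unfolding P_def q by simp
  moreover have "poly_act scale T q v \<in> V" by (rule poly_act_in_subspace[OF V(1) stable v(1)])
  ultimately show ?thesis using that by blast
qed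

lemma image_subspace:
  assumes T: "lin T" and V: "subspace V"
  shows "subspace (T ` V)"
proof -
  interpret Vector_Spaces.linear scale scale T by (rule T)
  show ?thesis by (rule subspace_image[OF V])
qed

lemma inj_endo_surj:
  assumes T: "lin T" and V: "subspace V" and stable: "\<And>x. x \<in> V \<Longrightarrow> T x \<in> V"
    and inj: "\<And>x. x \<in> V \<Longrightarrow> T x = 0 \<Longrightarrow> x = 0"
  shows "T ` V = V"
proof -
  interpret vp: finite_dimensional_vector_space_pair_1 scale Basis scale ..
  have "inj_on T (span V)"
  proof (rule inj_onI)
    fix x y assume "x \<in> span V" "y \<in> span V" "T x = T y"
    moreover have "span V = V" using V by (simp only: span_eq_iff)
    ultimately show "x = y"
      using inj[of "x - y"] V by (simp add: lin_diff[OF T] subspace_diff)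
  qed
  then have "dim (T ` V) = dim V" by (rule vp.dim_image_eq[OF T])
  then show ?thesis using image_subspace[OF T V] V stable
    by (intro subspace_dim_equal) auto
qed

text \<open>Splitting off a kernel and an image of the same operator keeps both parts stable
  under the commuting family, so the dimension drops until every operator is a scalar.\<close>

lemma common_eigenvectors_span:
  assumes lin: "\<And>T. T \<in> \<F> \<Longrightarrow> lin T"
    and comm: "\<And>S T x. S \<in> \<F> \<Longrightarrow> T \<in> \<F> \<Longrightarrow> x \<in> V \<Longrightarrow> S (T x) = T (S x)"
    and V: "subspace V" and stable: "\<And>T x. T \<in> \<F> \<Longrightarrow> x \<in> V \<Longrightarrow> T x \<in> V"
    and ss: "\<And>T x \<mu>. T \<in> \<F> \<Longrightarrow> x \<in> V \<Longrightarrow> T (T x - scale \<mu> x) = scale \<mu> (T x - scale \<mu> x) \<Longrightarrow> T x = scale \<mu> x"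
  shows "V \<subseteq> span {v \<in> V. \<forall>T\<in>\<F>. \<exists>\<mu>. T v = scale \<mu> v}"
  using comm V stable ss
proof (induction "dim V" arbitrary: V rule: less_induct)
  case less
  note comm = less.prems(1) and V = less.prems(2) and stable = less.prems(3) and ss = less.prems(4)
  show ?case
  proof (cases "\<forall>T\<in>\<F>. \<exists>\<mu>. \<forall>v\<in>V. T v = scale \<mu> v")
    case True
    then have "V \<subseteq> {v \<in> V. \<forall>T\<in>\<F>. \<exists>\<mu>. T v = scale \<mu> v}" by blast
    then show ?thesis using span_superset by blast
  next
    case False
    then obtain T where T: "T \<in> \<F>" and ns: "\<And>\<mu>. \<exists>v\<in>V. T v \<noteq> scale \<mu> v" by blast
    have "V \<noteq> {0}" using ns[of 0] lin_0[OF lin[OF T]] by auto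
    then obtain w \<mu> where w: "w \<in> V" "w \<noteq> 0" "T w = scale \<mu> w"
      using eigenvector_exists[OF lin[OF T] V] stable[OF T] by blast
    let ?S = "\<lambda>x. T x - scale \<mu> x"
    have linS: "lin ?S" by (intro lin_minus' lin[OF T] lin_smult lin_ident)
    have SV: "?S x \<in> V" if "x \<in> V" for x
      using that stable[OF T] V by (simp add: subspace_diff subspace_scale)
    have TS: "R (?S x) = ?S (R x)" if "R \<in> \<F>" "x \<in> V" for R x
      using that comm[OF that(1) T that(2)] lin[OF that(1)] by (simp add: lin_diff lin_scale)
    define V1 where "V1 = {x \<in> V. ?S x = 0}"
    define V2 where "V2 = ?S ` V"
    have V1: "subspace V1" unfolding V1_def using V
      by (auto simp: subspace_def lin_add[OF lin[OF T]] lin_scale[OF lin[OF T]] lin_0[OF lin[OF T]] scale_right_distrib mult.commute)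
    have V2: "subspace V2" unfolding V2_def by (rule image_subspace[OF linS V])
    have sub: "V1 \<subseteq> V" "V2 \<subseteq> V" using SV by (auto simp: V1_def V2_def)
    have "V1 \<noteq> V" using ns[of \<mu>] by (auto simp: V1_def)
    then have d1: "dim V1 < dim V" using sub V V1 by (metis dim_psubset psubsetI span_eq_iff)
    \<comment> \<open>By \<open>ss\<close> the square of \<open>?S\<close> has no larger kernel than
      \<open>?S\<close> itself, which is exactly triviality of this intersection.\<close>
    have inter: "x = 0" if "x \<in> V1" "x \<in> V2" for x
    proof -
      from that(2) obtain y where y: "y \<in> V" "x = ?S y" unfolding V2_def by blast
      have "T y = scale \<mu> y" using ss[OF T y(1)] that y(2) by (simp add: V1_def)
      then show ?thesis using y by simp
    qed
    have "w \<in> V1" using w by (simp add: V1_def)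
    then have "V2 \<noteq> V" using inter[of w] w by blast
    then have d2: "dim V2 < dim V" using sub V V2 by (metis dim_psubset psubsetI span_eq_iff)
    have st1: "R x \<in> V1" if "R \<in> \<F>" "x \<in> V1" for R x
      using that TS[of R x] stable[of R x] lin_0[OF lin[OF that(1)]] by (simp add: V1_def)
    have st2: "R x \<in> V2" if "R \<in> \<F>" "x \<in> V2" for R x
      using that TS[of R] stable[of R] by (auto simp: V2_def)
    let ?E = "\<lambda>W. {v \<in> W. \<forall>T\<in>\<F>. \<exists>\<mu>. T v = scale \<mu> v}"
    have "V1 \<subseteq> span (?E V1)"
    proof (rule less.hyps[OF d1])
      show "S (T x) = T (S x)" if "S \<in> \<F>" "T \<in> \<F>" "x \<in> V1" for S T x
        using comm[of S T x] that sub by blast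
      show "T x = scale \<mu> x" if "T \<in> \<F>" "x \<in> V1" "T (T x - scale \<mu> x) = scale \<mu> (T x - scale \<mu> x)" for T x \<mu>
        using ss[of T x \<mu>] that sub by blast
    qed (use V1 st1 in blast)+
    moreover have "V2 \<subseteq> span (?E V2)"
    proof (rule less.hyps[OF d2])
      show "S (T x) = T (S x)" if "S \<in> \<F>" "T \<in> \<F>" "x \<in> V2" for S T x
        using comm[of S T x] that sub by blast
      show "T x = scale \<mu> x" if "T \<in> \<F>" "x \<in> V2" "T (T x - scale \<mu> x) = scale \<mu> (T x - scale \<mu> x)" for T x \<mu>
        using ss[of T x \<mu>] that sub by blast
    qed (use V2 st2 in blast)+
    moreover have "span (?E V1) \<subseteq> span (?E V)" "span (?E V2) \<subseteq> span (?E V)"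
      using sub by (auto intro!: span_mono)
    ultimately have V12: "V1 \<subseteq> span (?E V)" "V2 \<subseteq> span (?E V)" by blast+
    \<comment> \<open>\<open>?S\<close> is injective on \<open>V2\<close>, hence onto, so each
      \<open>x\<close> can be corrected by an element of \<open>V2\<close> to lie in the kernel
      \<open>V1\<close>: the two parts span \<open>V\<close>.\<close>
    have "?S ` V2 = V2"
      using st2[OF T] V2 sub inter
      by (intro inj_endo_surj[OF linS V2]) (auto simp: subspace_diff subspace_scale V1_def)
    show ?thesis
    proof
      fix x assume x: "x \<in> V"
      then have "?S x \<in> ?S ` V2" using \<open>?S ` V2 = V2\<close> by (auto simp: V2_def)
      then obtain y where y: "y \<in> V2" "?S x = ?S y" by auto
      have "x - y \<in> V1" using x y sub V lin_diff[OF linS, of x y] by (auto simp: V1_def subspace_diff)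
      then have "(x - y) + y \<in> span (?E V)" using V12 y(1) by (intro span_add) auto
      then show "x \<in> span (?E V)" by simp
    qed
  qed
qed

section \<open>Traces\<close>

definition coord :: "'b \<Rightarrow> 'b \<Rightarrow> complex" where
  "coord b x = representation Basis x b"

definition tr :: "('b \<Rightarrow> 'b) \<Rightarrow> complex" where
  "tr T = (\<Sum>b\<in>Basis. coord b (T b))"

lemma coord_add: "coord b (x + y) = coord b x + coord b y"
  unfolding coord_def by (simp add: representation_add independent_Basis span_Basis)

lemma coord_scale: "coord b (scale k x) = k * coord b x"
  unfolding coord_def by (simp add: representation_scale independent_Basis span_Basis)

lemma coord_diff: "coord b (x - y) = coord b x - coord b y"
  unfolding coord_def by (simp add: representation_diff independent_Basis span_Basis)

lemma coord_0: "coord b 0 = 0"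
  unfolding coord_def by (simp add: representation_zero)

lemma coord_sum: "coord b (sum g A) = (\<Sum>a\<in>A. coord b (g a))"
  by (induction A rule: infinite_finite_induct) (simp_all add: coord_0 coord_add)

lemma coord_basis: "b \<in> Basis \<Longrightarrow> coord a b = (if a = b then 1 else 0)"
  unfolding coord_def by (simp add: representation_basis independent_Basis)

lemma coord_expand: "(\<Sum>b\<in>Basis. scale (coord b x) b) = x"
  unfolding coord_def
  by (rule sum_representation_eq) (simp_all add: independent_Basis span_Basis finite_Basis)

lemma tr_add: "tr (\<lambda>x. S x + T x) = tr S + tr T"
  by (simp add: tr_def coord_add sum.distrib)

lemma tr_diff: "tr (\<lambda>x. S x - T x) = tr S - tr T"
  by (simp add: tr_def coord_diff sum_subtractf)

lemma tr_scale: "tr (\<lambda>x. scale k (T x)) = k * tr T"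
  by (simp add: tr_def coord_scale sum_distrib_left)

lemma tr_zero: "tr (\<lambda>x. 0) = 0"
  by (simp add: tr_def coord_0)

lemma tr_comm:
  assumes S: "lin S" and T: "lin T"
  shows "tr (\<lambda>x. S (T x)) = tr (\<lambda>x. T (S x))"
proof -
  have *: "coord b (S (T b)) = (\<Sum>a\<in>Basis. coord a (T b) * coord b (S a))" if "lin S" for S T b
    by (subst coord_expand[symmetric, of "T b"]) (simp add: lin_sum[OF that] lin_scale[OF that] coord_sum coord_scale)
  show ?thesis unfolding tr_def *[OF S] *[OF T]
    by (subst sum.swap) (simp add: mult.commute)
qed

lemma tr_rank_one:
  assumes add: "\<And>x y. \<phi> (x + y) = \<phi> x + \<phi> y" and scale: "\<And>k x. \<phi> (scale k x) = k * \<phi> x"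
  shows "tr (\<lambda>x. scale (\<phi> x) y) = \<phi> y"
proof -
  have sum: "\<phi> (sum g A) = (\<Sum>a\<in>A. \<phi> (g a))" for g and A :: "'b set"
    using scale[of 0 0] by (induction A rule: infinite_finite_induct) (simp_all add: add)
  have "\<phi> y = \<phi> (\<Sum>b\<in>Basis. scale (coord b y) b)" by (simp add: coord_expand)
  also have "\<dots> = (\<Sum>b\<in>Basis. \<phi> b * coord b y)" by (simp add: sum scale mult.commute)
  finally show ?thesis by (simp add: tr_def coord_scale)
qed

lemma linear_projection:
  assumes "subspace V"
  obtains p where "lin p" "\<And>x. p x \<in> V" "\<And>x. x \<in> V \<Longrightarrow> p x = x"
proof -
  interpret vp: vector_space_pair scale scale ..
  obtain C where C: "C \<subseteq> V" "independent C" "V \<subseteq> span C"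
    using maximal_independent_subset[of V] by blast
  have Veq: "span C = V" using C assms span_subspace by blast
  define p where "p = vp.construct C id"
  have p: "lin p" unfolding p_def by (rule vp.linear_construct[OF C(2)])
  have "p x \<in> V" for x
    using vp.construct_in_span[OF C(2), of id x] Veq by (simp add: p_def)
  moreover have "p x = x" if "x \<in> V" for x
    by (rule vp.linear_eq_on[OF p lin_ident, of x C])
      (use that Veq C in \<open>auto simp: p_def vp.construct_basis\<close>)
  ultimately show ?thesis using that p by blast
qed

text \<open>With \<open>p\<close> a projection onto the range of \<open>T\<close>, the operator \<open>T \<circ> p\<close> has the same trace
  and a smaller nilpotency index.\<close>

lemma tr_nilpotent:
  assumes "lin T" "\<And>x. (T ^^ k) x = 0"
  shows "tr T = 0"
  using assms
proof (induction k arbitrary: T)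
  case 0
  then have "T = (\<lambda>x. 0)" by auto
  then show ?case by (simp add: tr_zero)
next
  case (Suc k)
  note T = Suc.prems(1)
  have "subspace (range T)" by (rule image_subspace[OF T]) simp
  then obtain p where p: "lin p" "\<And>x. p x \<in> range T" "\<And>x. x \<in> range T \<Longrightarrow> p x = x"
    using linear_projection by blast
  \<comment> \<open>The first application of \<open>p\<close> puts \<open>y\<close> in the range of
    \<open>T\<close> and the later ones change nothing. The membership supplies the extra factor
    \<open>T\<close> that raises the exponent from \<open>k\<close> to \<open>Suc k\<close>; it
    fails for \<open>j = 0\<close>, hence the proviso and the separate case
    \<open>k = 0\<close>.\<close>
  have "\<exists>y. ((\<lambda>x. T (p x)) ^^ j) x = (T ^^ j) y \<and> (j > 0 \<longrightarrow> y \<in> range T)" for x j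
  proof (induction j)
    case (Suc j)
    then obtain y where y: "((\<lambda>x. T (p x)) ^^ j) x = (T ^^ j) y" "j > 0 \<longrightarrow> y \<in> range T" by blast
    show ?case
    proof (cases j)
      case 0
      then show ?thesis using p(2) by auto
    next
      case (Suc i)
      then have "p ((T ^^ j) y) = (T ^^ j) y" by (intro p(3)) simp
      then show ?thesis using y Suc by auto
    qed
  qed simp
  then have "((\<lambda>x. T (p x)) ^^ k) x = 0" if "k > 0" for x
    using that Suc.prems(2) funpow_swap1[of T k] by (metis comp_apply funpow.simps(2) rangeE)
  moreover have "tr (\<lambda>x. T (p x)) = tr T"
    using tr_comm[OF T p(1)] p(3) by simp
  moreover have "tr T = 0" if "k = 0"
  proof -
    have "T = (\<lambda>x. 0)" using that Suc.prems(2) by auto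
    then show ?thesis by (simp add: tr_zero)
  qed
  ultimately show ?case
    using Suc.IH[OF lin_comp[OF T p(1)]] by (metis gr0I)
qed

end

section \<open>Operators satisfying the relations of sl(2)\<close>

text \<open>Nilpotency is assumed for the raising operator alone, and the weight operator
  \<open>A\<close> is not assumed diagonalizable. \<open>A_semisimple\<close> and
  \<open>Y_nilpotent\<close> are derived, after which \<open>X\<close> and \<open>Y\<close> can
  exchange roles.\<close>

locale sl2_operators = complex_vector_space scale Basis
  for scale :: "complex \<Rightarrow> 'b::ab_group_add \<Rightarrow> 'b" and Basis +
  fixes X Y A :: "'b \<Rightarrow> 'b"
  assumes X: "lin X" and Y: "lin Y" and A: "lin A"
    and AX: "A (X v) = X (A v) + scale 2 (X v)"
    and AY: "A (Y v) = Y (A v) - scale 2 (Y v)"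
    and XY: "X (Y v) = Y (X v) + A v"
    and X_nilpotent: "\<exists>k. (X ^^ k) v = 0"
begin

lemmas op_simps = lin_add[OF X] lin_add[OF Y] lin_add[OF A] lin_scale[OF X] lin_scale[OF Y] lin_scale[OF A]
  lin_diff[OF X] lin_diff[OF Y] lin_diff[OF A] lin_0[OF X] lin_0[OF Y] lin_0[OF A]

lemma A_X_pow: "A ((X ^^ j) v) = (X ^^ j) (A v) + scale (2 * of_nat j) ((X ^^ j) v)"
proof (induction j)
  case (Suc j)
  then show ?case by (simp add: AX op_simps scale_left_distrib ring_distribs flip: add.assoc)
qed simp

lemma A_Y_pow: "A ((Y ^^ j) v) = (Y ^^ j) (A v) - scale (2 * of_nat j) ((Y ^^ j) v)"
proof (induction j)
  case (Suc j)
  then show ?case by (simp add: AY op_simps scale_left_distrib ring_distribs)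
qed simp

text \<open>Stated without an eigenvalue for \<open>v\<close>, since it is also applied to a vector
  on which \<open>A\<close> might have a Jordan block.\<close>

lemma X_Y_pow:
  assumes "X v = 0"
  shows "X ((Y ^^ Suc j) v) = scale (of_nat (Suc j)) ((Y ^^ j) (A v - scale (of_nat j) v))"
proof (induction j)
  case 0
  then show ?case using assms by (simp add: XY op_simps)
next
  case (Suc j)
  let ?w = "(Y ^^ Suc j) v" and ?u = "(Y ^^ Suc j) (A v)"
  have Yl: "lin (Y ^^ i)" for i by (rule lin_funpow[OF Y])
  have "X ((Y ^^ Suc (Suc j)) v) = Y (X ?w) + A ?w" by (simp add: XY)
  also have "Y (X ?w) = scale (of_nat (Suc j)) (?u - scale (of_nat j) ?w)"
    unfolding Suc by (simp add: op_simps lin_diff[OF Yl] lin_scale[OF Yl])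
  also have "A ?w = ?u - scale (2 * of_nat (Suc j)) ?w" by (rule A_Y_pow)
  also have "scale (of_nat (Suc j)) (?u - scale (of_nat j) ?w) + (?u - scale (2 * of_nat (Suc j)) ?w)
      = scale (of_nat (Suc j) + 1) ?u - scale (of_nat (Suc j) * of_nat j + 2 * of_nat (Suc j)) ?w"
    by (simp only: scale_right_diff_distrib scale_left_distrib scale_scale scale_one) (simp add: algebra_simps)
  also have "of_nat (Suc j) * of_nat j + 2 * of_nat (Suc j) = of_nat (Suc (Suc j)) * (of_nat (Suc j) :: complex)"
    by (simp add: algebra_simps)
  also have "of_nat (Suc j) + 1 = (of_nat (Suc (Suc j)) :: complex)" by simp
  finally show ?case by (simp only: scale_right_diff_distrib scale_scale lin_diff[OF Yl] lin_scale[OF Yl])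
qed

text \<open>The equation is required only from \<open>n\<close> on: on a Jordan block it holds only
  after the off-diagonal part has been lowered to 0.\<close>

lemma Y_weight_vanish:
  assumes "\<And>j. j \<ge> n \<Longrightarrow> A ((Y ^^ j) v) = scale (\<mu> - 2 * of_nat j) ((Y ^^ j) v)"
  shows "\<exists>j\<ge>n. (Y ^^ j) v = 0"
proof -
  have "\<exists>j. (Y ^^ (n + j)) v = 0"
    by (rule eigenvectors_vanish[OF A, of "\<lambda>j. \<mu> - 2 * of_nat (n + j)"])
      (auto simp: assms intro!: injI)
  then show ?thesis by (metis le_add1)
qed

text \<open>At the first vanishing power \<open>Suc m\<close>, applying \<open>X\<close> returns
  \<open>(m + 1) * (\<mu> - m)\<close> times the nonzero vector before it.\<close>

lemma highest_weight_nat: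
  assumes "X v = 0" "A v = scale \<mu> v" "v \<noteq> 0"
  obtains m :: nat where "\<mu> = of_nat m" "(Y ^^ m) v \<noteq> 0" "(Y ^^ Suc m) v = 0"
proof -
  have Yl: "lin (Y ^^ i)" for i by (rule lin_funpow[OF Y])
  have "A ((Y ^^ j) v) = scale (\<mu> - 2 * of_nat j) ((Y ^^ j) v)" for j
    unfolding A_Y_pow assms by (simp add: lin_scale[OF Yl] scale_left_diff_distrib)
  then have "\<exists>j\<ge>0. (Y ^^ j) v = 0" by (rule Y_weight_vanish)
  then obtain j where j: "(Y ^^ j) v = 0" "\<And>i. i < j \<Longrightarrow> (Y ^^ i) v \<noteq> 0"
    using exists_least_iff[of "\<lambda>j. (Y ^^ j) v = 0"] by auto
  then obtain m where m: "j = Suc m" using assms by (cases j) auto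
  have "0 = X ((Y ^^ Suc m) v)" using j(1) unfolding m by (simp add: op_simps)
  also have "\<dots> = scale (of_nat (Suc m) * (\<mu> - of_nat m)) ((Y ^^ m) v)"
    unfolding X_Y_pow[OF assms(1)] assms(2)
    by (simp only: lin_scale[OF Yl] scale_scale flip: scale_left_diff_distrib)
  finally have "\<mu> = of_nat m" using j(2)[of m] m by (simp del: of_nat_Suc)
  then show ?thesis using that j m by simp
qed

section \<open>The Casimir operator and semisimplicity of the weight operator\<close>

definition Q :: "'b \<Rightarrow> 'b" where
  "Q v = scale 4 (Y (X v)) + A (A v) + scale 2 (A v)"

lemma Q_lin: "lin Q"
  unfolding Q_def by (intro lin_plus lin_smult lin_comp[OF Y X] lin_comp[OF A A] A)

lemma Q_X: "Q (X v) = X (Q v)"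
  by (simp add: Q_def op_simps AX XY scale_right_distrib scale_right_diff_distrib)
    (simp add: algebra_simps flip: scale_left_distrib)

lemma Q_A: "Q (A v) = A (Q v)"
  by (simp add: Q_def op_simps AX AY scale_right_distrib scale_right_diff_distrib)

text \<open>\<open>Q\<close> is ordered with \<open>X\<close> on the right so that its first term
  dies on highest weight vectors. The value is strictly increasing for \<mu> \<ge> 0, hence
  distinguishes highest weights.\<close>

lemma Q_highest:
  assumes "X v = 0" "A v = scale \<mu> v"
  shows "Q v = scale (\<mu> * \<mu> + 2 * \<mu>) v"
  using assms by (simp add: Q_def op_simps scale_left_distrib)

lemma Q_X_pow: "Q ((X ^^ j) v) = (X ^^ j) (Q v)"
  by (induction j) (simp_all add: Q_X)

text \<open>\<open>R\<close> is the product, over \<open>j < k\<close>, of \<open>Q\<close> minus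
  the Casimir value of the weight \<open>\<mu> + 2 * j\<close>. Each factor kills the last vector of
  the \<open>X\<close>-string of \<open>w\<close> and so shortens the string by one; the final
  clause evaluates \<open>R\<close> on any eigenvector of \<open>Q\<close>.\<close>

lemma Casimir_polynomial:
  assumes "A w = scale \<mu> w" "(X ^^ k) w = 0"
  shows "\<exists>R. lin R \<and> (\<forall>v. R (X v) = X (R v)) \<and> (\<forall>v. R (A v) = A (R v)) \<and> R w = 0 \<and>
    (\<forall>u c. Q u = scale c u \<longrightarrow>
      R u = scale (\<Prod>j<k. c - ((\<mu> + 2 * of_nat j) * (\<mu> + 2 * of_nat j) + 2 * (\<mu> + 2 * of_nat j))) u)"
  using assms
proof (induction k arbitrary: w)
  case 0
  then show ?case by (intro exI[of _ "\<lambda>x. x"]) (simp add: lin_ident)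
next
  case (Suc k)
  define a where "a = (\<mu> + 2 * of_nat k) * (\<mu> + 2 * of_nat k) + 2 * (\<mu> + 2 * of_nat k)"
  define N where "N v = Q v - scale a v" for v
  have N: "lin N" unfolding N_def by (intro lin_minus' Q_lin lin_smult lin_ident)
  have NX: "N (X v) = X (N v)" and NA: "N (A v) = A (N v)" for v
    by (simp_all add: N_def Q_X Q_A op_simps)
  have Xl: "lin (X ^^ i)" for i by (rule lin_funpow[OF X])
  have "A ((X ^^ k) w) = scale (\<mu> + 2 * of_nat k) ((X ^^ k) w)"
    unfolding A_X_pow Suc.prems(1) by (simp add: lin_scale[OF Xl] scale_left_distrib)
  then have "Q ((X ^^ k) w) = scale a ((X ^^ k) w)"
    unfolding a_def using Suc.prems(2) by (intro Q_highest) simp_all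
  then have Nw: "(X ^^ k) (N w) = 0"
    by (simp add: N_def lin_diff[OF Xl] lin_scale[OF Xl] Q_X_pow)
  have "A (N w) = scale \<mu> (N w)"
    using NA[of w] Suc.prems(1) by (simp add: lin_scale[OF N])
  from Suc.IH[OF this Nw] obtain R where R: "lin R" "\<forall>v. R (X v) = X (R v)" "\<forall>v. R (A v) = A (R v)" "R (N w) = 0"
    "\<forall>u c. Q u = scale c u \<longrightarrow>
      R u = scale (\<Prod>j<k. c - ((\<mu> + 2 * of_nat j) * (\<mu> + 2 * of_nat j) + 2 * (\<mu> + 2 * of_nat j))) u"
    by blast
  have "R (N u) = scale (\<Prod>j<Suc k. c - ((\<mu> + 2 * of_nat j) * (\<mu> + 2 * of_nat j) + 2 * (\<mu> + 2 * of_nat j))) u"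
    if "Q u = scale c u" for u c
  proof -
    have "N u = scale (c - a) u" by (simp add: N_def that scale_left_diff_distrib)
    then show ?thesis
      by (simp only: lin_scale[OF R(1)] R(5)[rule_format, OF that] scale_scale prod.lessThan_Suc a_def mult.commute)
  qed
  then show ?case using R NX NA lin_comp[OF R(1) N] by (intro exI[of _ "\<lambda>v. R (N v)"]) auto
qed

text \<open>If \<open>u\<close> were nonzero, \<mu> would be a natural number \<open>m\<close> and
  \<open>Y ^^ j\<close> would kill \<open>u\<close> for \<open>j > m\<close>. Beyond
  \<open>m\<close> the lowered \<open>v\<close> are therefore honest eigenvectors, which die out,
  and applying \<open>X\<close> carries the vanishing back to \<open>Y ^^ Suc m\<close>.\<close>

lemma no_highest_weight_block:
  assumes v: "X v = 0" "A v = scale \<mu> v + u" and u: "X u = 0" "A u = scale \<mu> u"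
  shows "u = 0"
proof (rule ccontr)
  assume "u \<noteq> 0"
  then obtain m where m: "\<mu> = of_nat m" "(Y ^^ m) u \<noteq> 0" "(Y ^^ Suc m) u = 0"
    using highest_weight_nat[OF u] by blast
  have Yl: "lin (Y ^^ i)" for i by (rule lin_funpow[OF Y])
  have Yu: "(Y ^^ j) u = 0" if "j \<ge> Suc m" for j
    using that by (induction j rule: dec_induct) (use m op_simps in auto)
  have "A ((Y ^^ j) v) = scale (\<mu> - 2 * of_nat j) ((Y ^^ j) v)" if "j \<ge> Suc m" for j
    unfolding A_Y_pow v by (simp add: lin_scale[OF Yl] lin_add[OF Yl] Yu[OF that] scale_left_diff_distrib)
  then obtain j where "j \<ge> Suc m" "(Y ^^ j) v = 0" using Y_weight_vanish by blast
  then have "(Y ^^ Suc m) v = 0"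
  proof (induction rule: dec_induct)
    case (step i)
    have "0 = X ((Y ^^ Suc i) v)" using step.prems by (simp add: op_simps)
    also have "\<dots> = scale (of_nat (Suc i) * (of_nat m - of_nat i)) ((Y ^^ i) v)"
      unfolding X_Y_pow[OF v(1)] v(2) m(1)
      by (simp add: lin_diff[OF Yl] lin_add[OF Yl] lin_scale[OF Yl] Yu[OF step.hyps(1)] scale_left_diff_distrib scale_right_diff_distrib right_diff_distrib)
    finally have "(Y ^^ i) v = 0" using step.hyps(1) by (simp del: of_nat_Suc)
    then show ?case by (rule step.IH)
  qed
  then have "0 = X ((Y ^^ Suc m) v)" by (simp add: op_simps)
  \<comment> \<open>At index \<open>m\<close> the two multiples of \<open>v\<close> cancel and only
    a nonzero multiple of the lowered \<open>u\<close> survives.\<close>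
  also have "\<dots> = scale (of_nat (Suc m)) ((Y ^^ m) u)"
    unfolding X_Y_pow[OF v(1)] v(2) m(1) by simp
  finally show False using m(2) by (simp del: of_nat_Suc)
qed

text \<open>A failure \<open>u = (A - \<mu>) v\<close> of semisimplicity is a highest weight vector. A polynomial in
  the Casimir operator \<open>Q\<close> kills \<open>X v\<close> but not \<open>u\<close>, because \<open>X v\<close> only involves highest
  weights above that of \<open>u\<close>; this reduces to the case \<open>X v = 0\<close>.\<close>

lemma A_semisimple:
  assumes "A (A v - scale \<mu> v) = scale \<mu> (A v - scale \<mu> v)"
  shows "A v = scale \<mu> v"
proof -
  obtain k where "(X ^^ k) v = 0" using X_nilpotent by blast
  then show ?thesis using assms
  proof (induction k arbitrary: v \<mu>)
    case 0
    then show ?case by (simp add: op_simps)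
  next
    case (Suc k)
    define u where "u = A v - scale \<mu> v"
    have Au: "A u = scale \<mu> u" using Suc.prems by (simp add: u_def)
    have Xv: "A (X v) - scale (\<mu> + 2) (X v) = X u"
      by (simp add: u_def AX op_simps scale_left_distrib)
    have Xk: "(X ^^ k) (X v) = 0" using Suc.prems(1) by (simp add: funpow_swap1)
    \<comment> \<open>\<open>X v\<close> has a shorter string, so the induction hypothesis makes it
      an eigenvector; this is what forces \<open>X u = 0\<close>.\<close>
    have AXv: "A (X v) = scale (\<mu> + 2) (X v)"
      by (rule Suc.IH[OF Xk], unfold Xv) (simp add: AX Au op_simps scale_left_distrib)
    then have Xu: "X u = 0" using Xv by simp
    have "u = 0"
    proof (rule ccontr)
      assume u0: "u \<noteq> 0"
      then obtain m where m: "\<mu> = of_nat m" using highest_weight_nat[OF Xu Au] by blast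
      obtain R where R: "lin R" "\<forall>v. R (X v) = X (R v)" "\<forall>v. R (A v) = A (R v)" "R (X v) = 0"
        "\<forall>u c. Q u = scale c u \<longrightarrow>
          R u = scale (\<Prod>j<k. c - ((\<mu> + 2 + 2 * of_nat j) * (\<mu> + 2 + 2 * of_nat j) + 2 * (\<mu> + 2 + 2 * of_nat j))) u"
        using Casimir_polynomial[OF AXv Xk] by blast
      have "R u = 0"
      proof (rule no_highest_weight_block)
        show "X (R v) = 0" using R by metis
        have "A v = scale \<mu> v + u" by (simp add: u_def)
        then show "A (R v) = scale \<mu> (R v) + R u" using R by (metis lin_add lin_scale)
        show "X (R u) = 0" using R Xu lin_0 by metis
        show "A (R u) = scale \<mu> (R u)" using R Au lin_scale by metis
      qed
      moreover have "R u = scale (\<Prod>j<k. \<mu> * \<mu> + 2 * \<mu> - ((\<mu> + 2 + 2 * of_nat j) * (\<mu> + 2 + 2 * of_nat j) + 2 * (\<mu> + 2 + 2 * of_nat j))) u"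
        using R(5) Q_highest[OF Xu Au] by blast
      ultimately obtain j where "j < k" "\<mu> * \<mu> + 2 * \<mu> - ((\<mu> + 2 + 2 * of_nat j) * (\<mu> + 2 + 2 * of_nat j) + 2 * (\<mu> + 2 + 2 * of_nat j)) = 0"
        using u0 by auto
      then have "\<mu> * \<mu> + 2 * \<mu> = (\<mu> + 2 + 2 * of_nat j) * (\<mu> + 2 + 2 * of_nat j) + 2 * (\<mu> + 2 + 2 * of_nat j)"
        by (simp only: right_minus_eq)
      then have "of_nat (m * m + 2 * m) = (of_nat ((m + 2 + 2 * j) * (m + 2 + 2 * j) + 2 * (m + 2 + 2 * j)) :: complex)"
        unfolding m by (simp only: of_nat_add of_nat_mult of_nat_numeral)
      then have "m * m + 2 * m = (m + 2 + 2 * j) * (m + 2 + 2 * j) + 2 * (m + 2 + 2 * j)"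
        by (simp only: of_nat_eq_iff)
      then show False by (simp add: algebra_simps)
    qed
    then show ?case by (simp add: u_def)
  qed
qed

lemma weight_top:
  assumes "A v = scale \<mu> v" "v \<noteq> 0"
  obtains i m :: nat where "(X ^^ i) v \<noteq> 0" "X ((X ^^ i) v) = 0" "\<mu> + 2 * of_nat i = of_nat m"
    "A ((X ^^ i) v) = scale (of_nat m) ((X ^^ i) v)"
proof -
  obtain k where k: "(X ^^ k) v = 0" "\<And>i. i < k \<Longrightarrow> (X ^^ i) v \<noteq> 0"
    using X_nilpotent[of v] exists_least_iff[of "\<lambda>j. (X ^^ j) v = 0"] by auto
  then obtain i where i: "k = Suc i" using assms by (cases k) auto
  have Xi: "(X ^^ i) v \<noteq> 0" "X ((X ^^ i) v) = 0" using k i by auto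
  have Xl: "lin (X ^^ i)" by (rule lin_funpow[OF X])
  have AXi: "A ((X ^^ i) v) = scale (\<mu> + 2 * of_nat i) ((X ^^ i) v)"
    unfolding A_X_pow assms(1) by (simp add: lin_scale[OF Xl] scale_left_distrib)
  obtain m where "\<mu> + 2 * of_nat i = of_nat m" using highest_weight_nat[OF Xi(2) AXi Xi(1)] by blast
  then show ?thesis using that Xi AXi by metis
qed

lemma weight_integer:
  assumes "A v = scale \<mu> v" "v \<noteq> 0"
  obtains k :: int where "\<mu> = of_int k"
proof -
  obtain i m :: nat where "\<mu> + 2 * of_nat i = of_nat m" using weight_top[OF assms] by blast
  then have "\<mu> = of_int (int m - 2 * int i)" by (simp add: algebra_simps)
  then show ?thesis using that by blast
qed

lemma X_inj_neg:
  assumes "A v = scale (of_int k) v" "k < 0" "X v = 0"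
  shows "v = 0"
proof (rule ccontr)
  assume "v \<noteq> 0"
  then obtain m :: nat where "of_int k = (of_nat m :: complex)" using highest_weight_nat assms by blast
  then have "k = int m" by (metis of_int_eq_iff of_int_of_nat_eq)
  then show False using assms by simp
qed

text \<open>On such a \<open>v\<close> the Casimir operator is \<open>k * (k - 2)\<close>, whereas
  the top of its \<open>X\<close>-string, of weight \<open>m = k + 2 * i\<close>, gives
  \<open>m * (m + 2)\<close>, which is larger for \<open>k > 0\<close>. The injectivity later yields
  surjectivity of \<open>bracket e\<close> onto the positive parts.\<close>

lemma XY_inj_pos:
  assumes v: "A v = scale (of_int k) v" "k > 0" "X (Y v) = 0"
  shows "v = 0"
proof (rule ccontr)
  assume "v \<noteq> 0"
  then obtain i m :: nat where w: "(X ^^ i) v \<noteq> 0" "X ((X ^^ i) v) = 0" "of_int k + 2 * of_nat i = (of_nat m :: complex)"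
    "A ((X ^^ i) v) = scale (of_nat m) ((X ^^ i) v)"
    using weight_top[OF v(1)] by blast
  have Xl: "lin (X ^^ i)" by (rule lin_funpow[OF X])
  have YX: "Y (X v) = scale (- of_int k) v" using XY[of v] v by (simp add: eq_neg_iff_add_eq_0)
  have "Q v = scale (4 * - of_int k) v + scale (of_int k * of_int k) v + scale (2 * of_int k) v"
    unfolding Q_def YX by (simp only: v(1) lin_scale[OF A] scale_scale)
  also have "\<dots> = scale (4 * - of_int k + of_int k * of_int k + 2 * of_int k) v"
    by (simp only: scale_left_distrib)
  also have "4 * - of_int k + of_int k * of_int k + 2 * of_int k = (of_int (k * k - 2 * k) :: complex)"
    by (simp add: algebra_simps)
  finally have Qv: "Q v = scale (of_int (k * k - 2 * k)) v" .
  have "Q ((X ^^ i) v) = scale (of_int (k * k - 2 * k)) ((X ^^ i) v)"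
    unfolding Q_X_pow Qv by (simp add: lin_scale[OF Xl])
  moreover have "Q ((X ^^ i) v) = scale (of_nat m * of_nat m + 2 * of_nat m) ((X ^^ i) v)"
    by (rule Q_highest[OF w(2,4)])
  ultimately have "of_int (k * k - 2 * k) = (of_nat m * of_nat m + 2 * of_nat m :: complex)"
    using w(1) by simp
  then have "of_int (k * k - 2 * k) = (of_int (int m * int m + 2 * int m) :: complex)" by simp
  then have "k * k - 2 * k = int m * int m + 2 * int m" by (simp only: of_int_eq_iff)
  moreover have "of_int (k + 2 * int i) = (of_int (int m) :: complex)" using w(3) by simp
  then have "int m = k + 2 * int i" by (simp only: of_int_eq_iff)
  ultimately have "4 * k + 4 * int i + 4 * (int i * int i) + 4 * (k * int i) = 0" by (simp add: algebra_simps)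
  moreover have "k * int i \<ge> 0" "int i * int i \<ge> 0" using v(2) by simp_all
  ultimately show False using v(2) by linarith
qed

lemma weight_vectors_span: "span {v. \<exists>k. A v = scale (of_int k) v} = UNIV"
proof -
  have "UNIV \<subseteq> span {v \<in> UNIV. \<forall>T\<in>{A}. \<exists>\<mu>. T v = scale \<mu> v}"
  proof (rule common_eigenvectors_span)
    show "T x = scale \<mu> x" if "T \<in> {A}" "T (T x - scale \<mu> x) = scale \<mu> (T x - scale \<mu> x)" for T x \<mu>
      using that A_semisimple[of x \<mu>] by simp
  qed (simp_all add: A)
  also have "\<dots> \<subseteq> span {v. \<exists>k. A v = scale (of_int k) v}"
  proof (rule span_mono, rule subsetI)
    fix v assume "v \<in> {v \<in> UNIV. \<forall>T\<in>{A}. \<exists>\<mu>. T v = scale \<mu> v}"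
    then obtain \<mu> where \<mu>: "A v = scale \<mu> v" by auto
    show "v \<in> {v. \<exists>k. A v = scale (of_int k) v}"
    proof (cases "v = 0")
      case True
      then show ?thesis by (simp add: op_simps)
    next
      case False
      then show ?thesis using weight_integer[OF \<mu>] \<mu> by auto
    qed
  qed
  finally show ?thesis by blast
qed

text \<open>A weight vector is lowered through distinct weights and must reach 0; weight vectors
  span, and local nilpotency is inherited by sums.\<close>

lemma Y_nilpotent: "\<exists>k. (Y ^^ k) v = 0"
proof -
  have Yl: "lin (Y ^^ i)" for i by (rule lin_funpow[OF Y])
  have Yge: "(Y ^^ j) x = 0" if "(Y ^^ i) x = 0" "i \<le> j" for i j x
    using that(2,1) by (induction j rule: dec_induct) (simp_all add: op_simps)
  have "subspace {v. \<exists>k. (Y ^^ k) v = 0}"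
  proof (rule subspaceI)
    show "0 \<in> {v. \<exists>k. (Y ^^ k) v = 0}" by (auto intro: exI[of _ 0])
  next
    fix x y assume "x \<in> {v. \<exists>k. (Y ^^ k) v = 0}" "y \<in> {v. \<exists>k. (Y ^^ k) v = 0}"
    then obtain i j where "(Y ^^ i) x = 0" "(Y ^^ j) y = 0" by blast
    then have "(Y ^^ (max i j)) (x + y) = 0" using Yge by (simp add: lin_add[OF Yl])
    then show "x + y \<in> {v. \<exists>k. (Y ^^ k) v = 0}" by blast
  qed (auto simp: lin_scale[OF Yl])
  moreover have "{v. \<exists>k. A v = scale (of_int k) v} \<subseteq> {v. \<exists>k. (Y ^^ k) v = 0}"
  proof safe
    fix v k assume v: "A v = scale (of_int k) v"
    have "A ((Y ^^ j) v) = scale (of_int k - 2 * of_nat j) ((Y ^^ j) v)" for j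
      unfolding A_Y_pow v by (simp add: lin_scale[OF Yl] scale_left_diff_distrib)
    then show "\<exists>k. (Y ^^ k) v = 0" using Y_weight_vanish[of 0] by blast
  qed
  ultimately show ?thesis using weight_vectors_span span_minimal by blast
qed

lemma opposite: "sl2_operators scale Basis Y X (\<lambda>v. - A v)"
proof -
  have "lin (\<lambda>v. - A v)" using lin_smult[OF A, of "-1"] by simp
  then show ?thesis
    by unfold_locales (use X Y Y_nilpotent in \<open>simp_all add: AX AY XY op_simps lin_minus[OF X] lin_minus[OF Y]\<close>)
qed

end

context complex_vector_space
begin

lemma dim_kernel_image:
  assumes T: "lin T" and V: "subspace V"
  shows "dim V \<le> dim {x \<in> V. T x = 0} + dim (T ` V)"
proof -
  interpret vp: finite_dimensional_vector_space_pair_1 scale Basis scale ..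
  let ?K = "{x \<in> V. T x = 0}"
  have K: "subspace ?K"
    using V by (auto simp: subspace_def lin_add[OF T] lin_scale[OF T] lin_0[OF T])
  obtain p where p: "lin p" "\<And>x. p x \<in> ?K" "\<And>x. x \<in> ?K \<Longrightarrow> p x = x"
    using linear_projection[OF K] by blast
  define W where "W = (\<lambda>x. x - p x) ` V"
  have l: "lin (\<lambda>x. x - p x)" by (intro lin_minus' lin_ident p(1))
  have W: "subspace W" unfolding W_def by (rule image_subspace[OF l V])
  have WV: "W \<subseteq> V" using p(2) V by (auto simp: W_def subspace_diff)
  have pW: "p w = 0" if "w \<in> W" for w
    using that p(3)[OF p(2)] by (auto simp: W_def lin_diff[OF p(1)])
  have "inj_on T (span W)"
  proof (rule inj_onI)
    fix x y assume xy: "x \<in> span W" "y \<in> span W" "T x = T y"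
    have W': "span W = W" using W by (simp only: span_eq_iff)
    have w: "x - y \<in> W" using xy W W' by (simp add: subspace_diff)
    moreover have "T (x - y) = 0" using xy by (simp add: lin_diff[OF T])
    ultimately have "x - y \<in> ?K" using WV by auto
    then have "p (x - y) = x - y" by (rule p(3))
    then show "x = y" using pW[OF w] by simp
  qed
  then have "dim W = dim (T ` W)" using vp.dim_image_eq[OF T] by simp
  also have "\<dots> \<le> dim (T ` V)" using WV by (intro dim_subset image_mono)
  finally have dW: "dim W \<le> dim (T ` V)" .
  obtain BK where BK: "BK \<subseteq> ?K" "independent BK" "?K \<subseteq> span BK" "card BK = dim ?K"
    using basis_exists[of ?K] by blast
  obtain BW where BW: "BW \<subseteq> W" "independent BW" "W \<subseteq> span BW" "card BW = dim W"
    using basis_exists[of W] by blast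
  have fin: "finite BK" "finite BW" using BK BW finiteI_independent by auto
  have "V \<subseteq> span (BK \<union> BW)"
  proof
    fix x assume x: "x \<in> V"
    have "p x \<in> span (BK \<union> BW)" using p(2)[of x] BK(3) span_mono[of BK "BK \<union> BW"] by blast
    moreover have "x - p x \<in> span (BK \<union> BW)"
      using x BW(3) span_mono[of BW "BK \<union> BW"] unfolding W_def by blast
    ultimately have "p x + (x - p x) \<in> span (BK \<union> BW)" by (rule span_add)
    then show "x \<in> span (BK \<union> BW)" by simp
  qed
  then have "dim V \<le> card (BK \<union> BW)" using fin by (intro dim_le_card) auto
  also have "\<dots> \<le> dim ?K + dim W" using card_Un_le[of BK BW] BK(4) BW(4) by simp
  finally show ?thesis using dW by simp
qed

lemma finite_eigenvalues:
  assumes T: "lin T"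
  shows "finite {\<mu>. \<exists>v. v \<noteq> 0 \<and> T v = scale \<mu> v}"
proof (rule ccontr)
  assume "infinite {\<mu>. \<exists>v. v \<noteq> 0 \<and> T v = scale \<mu> v}"
  from infinite_countable_subset[OF this] obtain \<mu> :: "nat \<Rightarrow> complex"
    where \<mu>: "inj \<mu>" "range \<mu> \<subseteq> {\<mu>. \<exists>v. v \<noteq> 0 \<and> T v = scale \<mu> v}" by auto
  then have "\<forall>j. \<exists>v. v \<noteq> 0 \<and> T v = scale (\<mu> j) v" by blast
  then obtain v where "\<And>j. v j \<noteq> 0 \<and> T (v j) = scale (\<mu> j) (v j)" by metis
  then show False using eigenvectors_vanish[OF T \<mu>(1), of v] by blast
qed

end

section \<open>The grading by a principal sl(2)-triple\<close>

context complex_lie_algebra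
begin

lemma bracket_0 [simp]: "bracket 0 x = 0" "bracket x 0 = 0"
  using bracket_scale_left[of 0 0 x] bracket_scale_right[of x 0 0] by simp_all

lemma bracket_minus_left: "bracket (- x) y = - bracket x y"
  using bracket_scale_left[of "-1" x y] by simp

lemma bracket_minus_right: "bracket x (- y) = - bracket x y"
  using bracket_scale_right[of x "-1" y] by simp

lemma bracket_diff_left: "bracket (x - y) z = bracket x z - bracket y z"
  using bracket_add_left[of x "- y" z] by (simp add: bracket_minus_left)

lemma bracket_diff_right: "bracket z (x - y) = bracket z x - bracket z y"
  using bracket_add_right[of z x "- y"] by (simp add: bracket_minus_right)

lemma bracket_sum_left: "bracket (sum g S) y = (\<Sum>s\<in>S. bracket (g s) y)"
  by (induction S rule: infinite_finite_induct) (simp_all add: bracket_add_left)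

lemma bracket_sum_right: "bracket y (sum g S) = (\<Sum>s\<in>S. bracket y (g s))"
  by (induction S rule: infinite_finite_induct) (simp_all add: bracket_add_right)

lemma bracket_anti: "bracket x y = - bracket y x"
proof -
  have "bracket (x + y) (x + y) = bracket x x + bracket y x + (bracket x y + bracket y y)"
    by (simp only: bracket_add_left bracket_add_right)
  then have "bracket x y + bracket y x = 0" by (simp add: bracket_self add.commute)
  then show ?thesis by (simp only: eq_neg_iff_add_eq_0)
qed

lemma bracket_bracket: "bracket x (bracket y z) = bracket (bracket x y) z + bracket y (bracket x z)"
proof -
  have "bracket y (bracket z x) = - bracket y (bracket x z)"
    by (subst bracket_anti[of z x]) (rule bracket_minus_right)
  moreover have "bracket z (bracket x y) = - bracket (bracket x y) z" by (rule bracket_anti)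
  ultimately show ?thesis using jacobi[of x y z] by (simp add: algebra_simps)
qed

lemmas bracket_linear = bracket_add_left bracket_add_right bracket_diff_left bracket_diff_right
  bracket_minus_left bracket_minus_right bracket_scale_left bracket_scale_right

lemma lie_subspaceI:
  assumes "0 \<in> S" "\<And>x y. x \<in> S \<Longrightarrow> y \<in> S \<Longrightarrow> x + y \<in> S" "\<And>c x. x \<in> S \<Longrightarrow> scale c x \<in> S"
  shows "subspace S"
  using assms by (auto simp: subspace_def)

definition gr :: "'g \<Rightarrow> int \<Rightarrow> 'g set" where
  "gr h k = {x. bracket h x = scale (of_int k) x}"

lemma gr_bracket: "x \<in> gr h j \<Longrightarrow> y \<in> gr h k \<Longrightarrow> bracket x y \<in> gr h (j + k)"
  by (simp add: gr_def bracket_bracket[of h x y] bracket_linear scale_left_distrib)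

lemma gr_subspace: "subspace (gr h k)"
  by (rule lie_subspaceI) (auto simp: gr_def bracket_linear scale_right_distrib mult.commute)

lemma gr_0: "gr h 0 = centralizer h"
  by (simp add: gr_def centralizer_def)

text \<open>By the Leibniz rule one \<open>bracket u\<close> falls on \<open>x\<close> or on
  \<open>y\<close>, lowering \<open>a\<close> or \<open>b\<close>. Hence the vectors killed by some
  power of \<open>bracket u\<close> are closed under brackets, and it suffices to test
  generators.\<close>

lemma locally_nilpotent_bracket:
  assumes "(bracket u ^^ a) x = 0" "(bracket u ^^ b) y = 0"
  shows "(bracket u ^^ (a + b)) (bracket x y) = 0"
  using assms
proof (induction "a + b" arbitrary: a b x y)
  case 0
  then show ?case by simp
next
  case (Suc n)
  have add: "(bracket u ^^ k) (v + w) = (bracket u ^^ k) v + (bracket u ^^ k) w" for k v w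
    by (induction k) (simp_all add: bracket_linear)
  have zero: "(bracket u ^^ k) 0 = 0" for k by (induction k) simp_all
  have 1: "(bracket u ^^ n) (bracket (bracket u x) y) = 0"
  proof (cases a)
    case 0
    then show ?thesis using Suc.prems zero by simp
  next
    case (Suc a')
    then show ?thesis using Suc.hyps(1)[of a' b "bracket u x" y] Suc.hyps(2) Suc.prems
      by (simp add: funpow_swap1)
  qed
  have 2: "(bracket u ^^ n) (bracket x (bracket u y)) = 0"
  proof (cases b)
    case 0
    then show ?thesis using Suc.prems zero by simp
  next
    case (Suc b')
    then show ?thesis using Suc.hyps(1)[of a b' x "bracket u y"] Suc.hyps(2) Suc.prems
      by (simp add: funpow_swap1)
  qed
  have "(bracket u ^^ (a + b)) (bracket x y) = (bracket u ^^ n) (bracket u (bracket x y))"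
    by (simp add: funpow_swap1 flip: Suc.hyps(2))
  also have "\<dots> = 0" by (subst bracket_bracket) (simp add: add 1 2)
  finally show ?case .
qed

end

locale principal_sl2 = simple_complex_lie_algebra scale bracket
  for scale :: "complex \<Rightarrow> 'g::ab_group_add \<Rightarrow> 'g" and bracket :: "'g \<Rightarrow> 'g \<Rightarrow> 'g" +
  fixes e f h :: 'g
  assumes principal: "principal_sl2_triple e f h"
begin

lemma e_neq_0: "e \<noteq> 0" and ef: "bracket e f = h" and he: "bracket h e = scale 2 e"
  and hf: "bracket h f = scale (- 2) f" and e_nilpotent: "ad_nilpotent e" and e_regular: "regular e"
  using principal by (auto simp: principal_sl2_triple_def sl2_triple_def)

lemma sl2_operators_ad:
  assumes "finite B" "independent B" "span B = UNIV"
  shows "sl2_operators scale B (bracket e) (bracket f) (bracket h)"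
proof -
  interpret complex_vector_space scale B
    by unfold_locales (use assms in auto)
  show ?thesis
  proof (unfold_locales)
    show "bracket h (bracket e v) = bracket e (bracket h v) + scale 2 (bracket e v)" for v
      using bracket_bracket[of h e v] by (simp add: he bracket_linear)
    show "bracket h (bracket f v) = bracket f (bracket h v) - scale 2 (bracket f v)" for v
      using bracket_bracket[of h f v] by (simp add: hf bracket_linear)
    show "bracket e (bracket f v) = bracket f (bracket e v) + bracket h v" for v
      using bracket_bracket[of e f v] by (simp add: ef)
    show "\<exists>k. (bracket e ^^ k) v = 0" for v
      using e_nilpotent by (auto simp: ad_nilpotent_def)
  qed (simp_all add: bracket_linear scale_right_distrib)
qed

text \<open>An arbitrary basis is enough to run the theory of sl(2) operators, which supplies
  spanning weight vectors; from these a second basis is drawn, so that projections and traces become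
  sums over basis vectors sorted by weight.\<close>

lemma weight_basis:
  obtains B :: "'g set" and wt :: "'g \<Rightarrow> int" where "finite B" "independent B" "span B = UNIV"
    "\<And>b. b \<in> B \<Longrightarrow> bracket h b = scale (of_int (wt b)) b"
proof -
  obtain B0 where B0: "finite B0" "span B0 = UNIV" using finite_dim by blast
  obtain B1 where B1: "B1 \<subseteq> B0" "independent B1" "B0 \<subseteq> span B1"
    using maximal_independent_subset by blast
  have "span B0 \<subseteq> span B1" by (rule span_minimal[OF B1(3) subspace_span])
  then have "span B1 = UNIV" unfolding B0(2) by blast
  then interpret sl2_operators scale B1 "bracket e" "bracket f" "bracket h"
    using B0 B1 by (intro sl2_operators_ad) (auto intro: finite_subset)
  let ?S = "{v. \<exists>k. bracket h v = scale (of_int k) v}"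
  obtain B where B: "B \<subseteq> ?S" "independent B" "?S \<subseteq> span B"
    using maximal_independent_subset[of ?S] by blast
  have "span ?S \<subseteq> span B" by (rule span_minimal[OF B(3) subspace_span])
  then have "span B = UNIV" unfolding weight_vectors_span by blast
  moreover have "finite B" using B(2) by (rule finiteI_independent)
  moreover have "\<forall>b\<in>B. \<exists>k::int. bracket h b = scale (of_int k) b" using B(1) by blast
  then obtain wt :: "'g \<Rightarrow> int" where "\<forall>b\<in>B. bracket h b = scale (of_int (wt b)) b"
    unfolding bchoice_iff ..
  ultimately show ?thesis using that B(2) by blast
qed

end

locale graded_principal_sl2 = principal_sl2 scale bracket e f h
  for scale :: "complex \<Rightarrow> 'g::ab_group_add \<Rightarrow> 'g" and bracket :: "'g \<Rightarrow> 'g \<Rightarrow> 'g" and e f h +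
  fixes Basis :: "'g set" and wt :: "'g \<Rightarrow> int"
  assumes Basis: "finite Basis" "independent Basis" "span Basis = UNIV"
    and wt: "b \<in> Basis \<Longrightarrow> bracket h b = scale (of_int (wt b)) b"
begin

sublocale pos: sl2_operators scale Basis "bracket e" "bracket f" "bracket h"
  by (rule sl2_operators_ad[OF Basis])

sublocale neg: sl2_operators scale Basis "bracket f" "bracket e" "\<lambda>v. - bracket h v"
  by (rule pos.opposite)

abbreviation g :: "int \<Rightarrow> 'g set" where "g \<equiv> gr h"

lemma lin_bracket: "pos.lin (bracket x)"
  by (rule pos.linI) (simp_all add: bracket_linear)

lemma lin_bracket_bracket: "pos.lin (\<lambda>z. bracket x (bracket y z))"
  by (rule pos.lin_comp[OF lin_bracket lin_bracket])

lemma e_g: "e \<in> g 2" and f_g: "f \<in> g (- 2)" and h_g: "h \<in> g 0"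
  using he hf bracket_self[of h] by (simp_all add: gr_def)

lemma e_bracket_g: "x \<in> g k \<Longrightarrow> bracket e x \<in> g (k + 2)"
  using gr_bracket[OF e_g, of x k] by (simp add: add.commute)

lemma f_bracket_g: "x \<in> g k \<Longrightarrow> bracket f x \<in> g (k - 2)"
  using gr_bracket[OF f_g, of x k] by simp

lemma g0_bracket_g: "t \<in> g 0 \<Longrightarrow> x \<in> g k \<Longrightarrow> bracket t x \<in> g k"
  using gr_bracket[of t h 0 x k] by simp

lemma coord_h: "b \<in> Basis \<Longrightarrow> pos.coord b (bracket h x) = of_int (wt b) * pos.coord b x"
proof -
  assume b: "b \<in> Basis"
  have "pos.coord b (bracket h x) = (\<Sum>a\<in>Basis. pos.coord a x * of_int (wt a) * pos.coord b a)"
    by (subst pos.coord_expand[symmetric, of x])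
      (simp add: bracket_sum_right bracket_linear pos.coord_sum wt pos.coord_scale)
  also have "\<dots> = (\<Sum>a\<in>{b}. pos.coord a x * of_int (wt a) * pos.coord b a)"
    using b Basis(1) by (intro sum.mono_neutral_right) (auto simp: pos.coord_basis)
  finally show ?thesis using b by (simp add: pos.coord_basis)
qed

lemma coord_g: "x \<in> g k \<Longrightarrow> b \<in> Basis \<Longrightarrow> wt b \<noteq> k \<Longrightarrow> pos.coord b x = 0"
  using coord_h[of b x] by (simp add: gr_def pos.coord_scale)

definition comp :: "int \<Rightarrow> 'g \<Rightarrow> 'g" where
  "comp k x = (\<Sum>b | b \<in> Basis \<and> wt b = k. scale (pos.coord b x) b)"

lemma comp_lin: "pos.lin (comp k)"
  unfolding comp_def
  by (rule pos.linI) (simp_all add: pos.coord_add pos.coord_scale scale_left_distrib sum.distrib scale_sum_right)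

lemma basis_g: "b \<in> Basis \<Longrightarrow> b \<in> g (wt b)"
  by (simp add: gr_def wt)

lemma comp_g: "comp k x \<in> g k"
  unfolding comp_def using basis_g by (intro subspace_sum[OF gr_subspace] subspace_scale[OF gr_subspace]) auto

lemma comp_sum: "(\<Sum>k\<in>wt ` Basis. comp k x) = x"
proof -
  have "(\<Sum>k\<in>wt ` Basis. comp k x) = (\<Sum>b\<in>Basis. scale (pos.coord b x) b)"
    unfolding comp_def using sum.image_gen[OF Basis(1), of "\<lambda>b. scale (pos.coord b x) b" wt] by simp
  then show ?thesis by (simp add: pos.coord_expand)
qed

lemma comp_on_g: "x \<in> g k \<Longrightarrow> comp j x = (if j = k then x else 0)"
proof -
  assume x: "x \<in> g k"
  have 0: "comp j x = 0" if "j \<noteq> k" for j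
    unfolding comp_def using coord_g[OF x] that by (intro sum.neutral) auto
  have "comp k x = x"
  proof (cases "k \<in> wt ` Basis")
    case True
    have "(\<Sum>k\<in>wt ` Basis. comp k x) = (\<Sum>k\<in>{k}. comp k x)"
      using 0 True Basis(1) by (intro sum.mono_neutral_right) auto
    then show ?thesis by (simp add: comp_sum)
  next
    case False
    then have "(\<Sum>k\<in>wt ` Basis. comp k x) = 0" using False by (intro sum.neutral ballI 0) auto
    then have "x = 0" by (simp add: comp_sum)
    then show ?thesis by (simp add: pos.lin_0[OF comp_lin])
  qed
  then show ?thesis using 0 by simp
qed

lemma graded_subspace_UNIV:
  assumes "subspace W" "\<And>k. g k \<subseteq> W"
  shows "W = UNIV"
proof -
  have "(\<Sum>k\<in>wt ` Basis. comp k x) \<in> W" for x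
    using comp_g assms by (intro subspace_sum) blast+
  then show ?thesis by (auto simp: comp_sum)
qed

lemma linear_eqI_graded:
  assumes "pos.lin S" "pos.lin T" "\<And>k x. x \<in> g k \<Longrightarrow> S x = T x"
  shows "S x = T x"
proof -
  have "{x. S x = T x} = UNIV"
    by (rule graded_subspace_UNIV)
      (use assms in \<open>auto intro!: lie_subspaceI simp: pos.lin_0 pos.lin_add pos.lin_scale\<close>)
  then show ?thesis by blast
qed

lemma comp_bracket_g0:
  assumes "t \<in> g 0"
  shows "comp k (bracket t x) = bracket t (comp k x)"
proof (rule linear_eqI_graded[where S = "\<lambda>x. comp k (bracket t x)"])
  show "comp k (bracket t x) = bracket t (comp k x)" if "x \<in> g j" for j x
    using comp_on_g[OF that] comp_on_g[OF g0_bracket_g[OF assms that]] by simp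
qed (rule pos.lin_comp[OF comp_lin lin_bracket] pos.lin_comp[OF lin_bracket comp_lin])+

definition D :: "int \<Rightarrow> nat" where
  "D k = card {b \<in> Basis. wt b = k}"

lemma g_span: "g k = span {b \<in> Basis. wt b = k}"
proof
  show "g k \<subseteq> span {b \<in> Basis. wt b = k}"
  proof
    fix x assume "x \<in> g k"
    then have "x = comp k x" by (simp add: comp_on_g)
    also have "\<dots> \<in> span {b \<in> Basis. wt b = k}"
      unfolding comp_def by (intro span_sum span_scale span_base) auto
    finally show "x \<in> span {b \<in> Basis. wt b = k}" .
  qed
  show "span {b \<in> Basis. wt b = k} \<subseteq> g k"
    using basis_g by (intro span_minimal gr_subspace) auto
qed

lemma dim_g: "dim (g k) = D k"
  unfolding g_span D_def
  by (rule dim_span_eq_card_independent) (rule independent_mono[OF Basis(2)], auto)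

lemma e_inj_neg: "x \<in> g k \<Longrightarrow> k < 0 \<Longrightarrow> bracket e x = 0 \<Longrightarrow> x = 0"
  using pos.X_inj_neg[of x k] by (simp add: gr_def)

lemma f_inj_pos: "x \<in> g k \<Longrightarrow> k > 0 \<Longrightarrow> bracket f x = 0 \<Longrightarrow> x = 0"
  using neg.X_inj_neg[of x "- k"] by (simp add: gr_def)

lemma ef_inj_pos: "x \<in> g k \<Longrightarrow> k > 0 \<Longrightarrow> bracket e (bracket f x) = 0 \<Longrightarrow> x = 0"
  using pos.XY_inj_pos[of x k] by (simp add: gr_def)

lemma fe_inj_neg: "x \<in> g k \<Longrightarrow> k < 0 \<Longrightarrow> bracket f (bracket e x) = 0 \<Longrightarrow> x = 0"
  using neg.XY_inj_pos[of x "- k"] by (simp add: gr_def)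

text \<open>Lowering followed by raising is injective on \<open>g k\<close>, hence onto by finite
  dimension; the lowered vector is the preimage.\<close>

lemma e_surj:
  assumes "x \<in> g k" "k > 0"
  obtains y where "y \<in> g (k - 2)" "x = bracket e y"
proof -
  have "(\<lambda>x. bracket e (bracket f x)) ` g k = g k"
  proof (rule pos.inj_endo_surj[OF _ gr_subspace])
    show "bracket e (bracket f x) \<in> g k" if "x \<in> g k" for x
      using e_bracket_g[OF f_bracket_g[OF that]] by simp
  qed (use assms ef_inj_pos in \<open>auto intro: lin_bracket_bracket\<close>)
  then show ?thesis using assms(1) f_bracket_g that by (metis imageE)
qed

lemma f_surj:
  assumes "x \<in> g k" "k < 0"
  obtains y where "y \<in> g (k + 2)" "x = bracket f y"
proof -
  have "(\<lambda>x. bracket f (bracket e x)) ` g k = g k"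
  proof (rule pos.inj_endo_surj[OF _ gr_subspace])
    show "bracket f (bracket e x) \<in> g k" if "x \<in> g k" for x
      using f_bracket_g[OF e_bracket_g[OF that]] by simp
  qed (use assms fe_inj_neg in \<open>auto intro: lin_bracket_bracket\<close>)
  then show ?thesis using assms(1) e_bracket_g that by (metis imageE)
qed

text \<open>\<open>bracket e\<close> sends weights \<ge> 0 into weights \<ge> 2, so its rank is at
  most the number of basis vectors of weight neither 0 nor 1. Regularity of \<open>e\<close>
  provides the opposite comparison, with the centralizer of \<open>h\<close>.\<close>

lemma centralizer_e_dim: "D 0 + D 1 \<le> dim (centralizer e)"
proof -
  let ?N = "{b \<in> Basis. wt b \<le> - 1}" and ?P = "{b \<in> Basis. wt b \<ge> 2}"
  have "range (bracket e) \<subseteq> span (bracket e ` ?N \<union> ?P)"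
  proof
    fix y assume "y \<in> range (bracket e)"
    then obtain x where "y = bracket e x" by blast
    then have y: "y = (\<Sum>b\<in>Basis. scale (pos.coord b x) (bracket e b))"
      by (subst (asm) pos.coord_expand[symmetric]) (simp add: bracket_sum_right bracket_linear)
    have "bracket e b \<in> span (bracket e ` ?N \<union> ?P)" if b: "b \<in> Basis" for b
    proof (cases "wt b \<le> - 1")
      case True
      then show ?thesis using b by (intro span_base) auto
    next
      case False
      have "bracket e b \<in> g (wt b + 2)" using e_bracket_g[OF basis_g[OF b]] .
      then have "bracket e b \<in> span {b' \<in> Basis. wt b' = wt b + 2}" by (simp only: g_span)
      moreover have "{b' \<in> Basis. wt b' = wt b + 2} \<subseteq> bracket e ` ?N \<union> ?P" using False by auto
      ultimately show ?thesis using span_mono by blast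
    qed
    then show "y \<in> span (bracket e ` ?N \<union> ?P)" unfolding y by (intro span_sum span_scale)
  qed
  then have "dim (range (bracket e)) \<le> card (bracket e ` ?N \<union> ?P)"
    using Basis(1) by (intro dim_le_card) auto
  also have "\<dots> \<le> card ?N + card ?P"
    using card_Un_le[of "bracket e ` ?N" ?P] card_image_le[of ?N "bracket e"] Basis(1) by simp
  finally have r: "dim (range (bracket e)) \<le> card ?N + card ?P" .
  have "Basis = (?N \<union> ?P) \<union> ({b \<in> Basis. wt b = 0} \<union> {b \<in> Basis. wt b = 1})" by auto
  then have "card Basis = card ((?N \<union> ?P) \<union> ({b \<in> Basis. wt b = 0} \<union> {b \<in> Basis. wt b = 1}))" by simp
  also have "\<dots> = card (?N \<union> ?P) + card ({b \<in> Basis. wt b = 0} \<union> {b \<in> Basis. wt b = 1})"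
    using Basis(1) by (intro card_Un_disjoint) auto
  also have "card (?N \<union> ?P) = card ?N + card ?P"
    using Basis(1) by (intro card_Un_disjoint) auto
  also have "card ({b \<in> Basis. wt b = 0} \<union> {b \<in> Basis. wt b = 1}) = D 0 + D 1"
    unfolding D_def using Basis(1) by (intro card_Un_disjoint) auto
  finally have "card Basis = card ?N + card ?P + (D 0 + D 1)" .
  moreover have "card Basis \<le> dim {x \<in> UNIV. bracket e x = 0} + dim (range (bracket e))"
    using pos.dim_kernel_image[OF lin_bracket subspace_UNIV, of e] pos.dim_UNIV by simp
  ultimately show ?thesis using r by (simp add: centralizer_def)
qed

lemma D_1: "D 1 = 0"
  using centralizer_e_dim e_regular dim_g[of 0] by (auto simp: regular_def gr_0 dest!: spec[of _ h])

text \<open>Lowering is injective on positive weights and raising on negative ones, so an odd part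
  embeds step by step into \<open>g 1\<close>.\<close>

lemma g_odd:
  assumes "odd k"
  shows "g k = {0}"
proof -
  have "g 1 \<subseteq> {0}" using dim_g[of 1] D_1 pos.dim_eq_0 by simp
  then have g1: "x = 0" if "x \<in> g 1" for x using that by blast
  have 1: "x = 0" if "x \<in> g (2 * int j + 1)" for j x
    using that
  proof (induction j arbitrary: x)
    case (Suc j)
    have "2 * int (Suc j) + 1 - 2 = 2 * int j + 1" by simp
    then have "bracket f x = 0" using Suc f_bracket_g[OF Suc.prems] by metis
    then show ?case using f_inj_pos[OF Suc.prems] by simp
  qed (use g1 in simp)
  have 2: "x = 0" if "x \<in> g (1 - 2 * int j)" for j x
    using that
  proof (induction j arbitrary: x)
    case (Suc j)
    have "1 - 2 * int (Suc j) + 2 = 1 - 2 * int j" by simp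
    then have "bracket e x = 0" using Suc e_bracket_g[OF Suc.prems] by metis
    then show ?case using e_inj_neg[OF Suc.prems] by simp
  qed (use g1 in simp)
  obtain j where j: "k = 2 * j + 1" using assms by (elim oddE)
  have "x = 0" if "x \<in> g k" for x
  proof (cases "j \<ge> 0")
    case True
    then show ?thesis using 1[of x "nat j"] that j by simp
  next
    case False
    then show ?thesis using 2[of x "nat (- j)"] that j by (simp add: add.commute)
  qed
  then show ?thesis using subspace_0[OF gr_subspace] by blast
qed

text \<open>Adding a large multiple of \<open>h\<close> to \<open>x\<close> pushes the centralizer into \<open>g 0\<close>; by regularity
  of \<open>e\<close> it cannot be smaller than \<open>g 0\<close>.\<close>

lemma g0_abelian:
  assumes x: "x \<in> g 0" and y: "y \<in> g 0"
  shows "bracket x y = 0"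
proof -
  let ?E = "{\<mu>. \<exists>v. v \<noteq> 0 \<and> bracket x v = scale \<mu> v}"
  have E: "finite ?E" by (rule pos.finite_eigenvalues[OF lin_bracket])
  \<comment> \<open>For \<open>t\<close> outside this finite set, the bracket with
    \<open>scale (of_nat t) h + x\<close> has no kernel on the parts of nonzero weight.\<close>
  let ?bad = "\<Union>k\<in>wt ` Basis - {0}. (\<lambda>t::nat. - (of_nat t * of_int k)) -` ?E"
  have "finite ?bad"
    using Basis(1) E by (intro finite_UN_I finite_vimageI) (auto intro!: injI)
  then obtain t where t: "t \<notin> ?bad" using ex_new_if_finite infinite_UNIV_nat by blast
  let ?z = "scale (of_nat t) h + x"
  have zg: "?z \<in> g 0" using x h_g by (intro subspace_add subspace_scale gr_subspace) auto
  have sub: "centralizer ?z \<subseteq> {w \<in> g 0. bracket x w = 0}"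
  proof
    fix w assume "w \<in> centralizer ?z"
    then have w: "bracket ?z w = 0" by (simp add: centralizer_def)
    have "comp k w = 0" if k: "k \<in> wt ` Basis" "k \<noteq> 0" for k
    proof (rule ccontr)
      assume n: "comp k w \<noteq> 0"
      have "bracket ?z (comp k w) = 0"
        using comp_bracket_g0[OF zg, of k w] w by (simp add: pos.lin_0[OF comp_lin])
      moreover have "bracket h (comp k w) = scale (of_int k) (comp k w)"
        using comp_g[of k w] by (simp add: gr_def)
      ultimately have "bracket x (comp k w) = scale (- (of_nat t * of_int k)) (comp k w)"
        by (simp add: bracket_linear eq_neg_iff_add_eq_0 add.commute)
      then have "t \<in> ?bad" using n k by auto
      then show False using t by blast
    qed
    then have "(\<Sum>k\<in>wt ` Basis. comp k w) \<in> g 0"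
      using comp_g subspace_0[OF gr_subspace] by (intro subspace_sum[OF gr_subspace]) metis
    then have w0: "w \<in> g 0" by (simp add: comp_sum)
    then have "bracket h w = 0" by (simp add: gr_def)
    then show "w \<in> {w \<in> g 0. bracket x w = 0}" using w w0 by (simp add: bracket_linear)
  qed
  let ?C = "{w \<in> g 0. bracket x w = 0}"
  have C: "subspace ?C"
    using gr_subspace[of h 0] by (auto simp: subspace_def bracket_linear)
  have "dim (g 0) \<le> dim (centralizer e)" using centralizer_e_dim dim_g[of 0] by simp
  also have "\<dots> \<le> dim (centralizer ?z)" using e_regular by (simp add: regular_def)
  also have "\<dots> \<le> dim ?C" by (rule pos.dim_subset[OF sub])
  finally have "?C = g 0" by (intro pos.subspace_dim_equal C gr_subspace) auto
  then show ?thesis using y by blast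
qed

lemma g0_commute:
  assumes "s \<in> g 0" "t \<in> g 0"
  shows "bracket s (bracket t x) = bracket t (bracket s x)"
  using bracket_bracket[of s t x] g0_abelian[OF assms] by simp

text \<open>Positive parts are reached from \<open>g 0\<close> by \<open>bracket e\<close>, negative
  ones by \<open>bracket f\<close>, and odd ones are 0. It serves as an induction principle for
  centralizers, normalizers and similar subspaces.\<close>

lemma generated_UNIV:
  assumes W: "subspace W" and 0: "g 0 \<subseteq> W" and e: "\<And>x. x \<in> W \<Longrightarrow> bracket e x \<in> W"
    and f: "\<And>x. x \<in> W \<Longrightarrow> bracket f x \<in> W"
  shows "W = UNIV"
proof (rule graded_subspace_UNIV[OF W])
  have 1: "g (2 * int j) \<subseteq> W" for j
  proof (induction j)
    case (Suc j)
    show ?case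
    proof
      fix x assume "x \<in> g (2 * int (Suc j))"
      then obtain y where "y \<in> g (2 * int (Suc j) - 2)" "x = bracket e y" by (rule e_surj) simp_all
      moreover have "2 * int (Suc j) - 2 = 2 * int j" by simp
      ultimately show "x \<in> W" using Suc e by auto
    qed
  qed (use 0 in simp)
  have 2: "g (- 2 * int j) \<subseteq> W" for j
  proof (induction j)
    case (Suc j)
    show ?case
    proof
      fix x assume "x \<in> g (- 2 * int (Suc j))"
      then obtain y where "y \<in> g (- 2 * int (Suc j) + 2)" "x = bracket f y" by (rule f_surj) simp_all
      moreover have "- 2 * int (Suc j) + 2 = - 2 * int j" by simp
      ultimately show "x \<in> W" using Suc f by auto
    qed
  qed (use 0 in simp)
  show "g k \<subseteq> W" for k
  proof (cases "even k")
    case True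
    then obtain j where j: "k = 2 * j" by (elim evenE)
    show ?thesis
    proof (cases "j \<ge> 0")
      case True
      then show ?thesis using 1[of "nat j"] j by simp
    next
      case False
      then show ?thesis using 2[of "nat (- j)"] j by simp
    qed
  next
    case False
    then show ?thesis using g_odd subspace_0[OF W] by simp
  qed
qed

section \<open>Consequences of simplicity, and the Killing form\<close>

lemma center_trivial:
  assumes "\<And>y. bracket x y = 0"
  shows "x = 0"
proof -
  let ?Z = "{x. \<forall>y. bracket x y = 0}"
  have "bracket x y = 0" if "y \<in> ?Z" for x y
    using that bracket_anti[of x y] by simp
  moreover have "subspace ?Z" by (auto intro!: lie_subspaceI simp: bracket_linear)
  ultimately have "lie_ideal ?Z" unfolding lie_ideal_def by simp
  then have "?Z = {0} \<or> ?Z = UNIV" by (rule ideals_trivial)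
  moreover have "?Z \<noteq> UNIV" using nonabelian by blast
  ultimately show ?thesis using assms by blast
qed

text \<open>If \<open>t\<close> commutes with \<open>e\<close>, then \<open>bracket e\<close> kills
  \<open>bracket t f\<close>, which has weight -2 and so is 0; now \<open>t\<close> commutes with
  \<open>g 0\<close>, \<open>e\<close> and \<open>f\<close>, hence with everything. With
  \<open>e_surj\<close> this identifies \<open>g 0\<close> with \<open>g 2\<close>: elements of
  \<open>g 0\<close> can be prescribed by their action on \<open>e\<close>.\<close>

lemma e_inj_0:
  assumes t: "t \<in> g 0" and "bracket e t = 0"
  shows "t = 0"
proof (rule center_trivial)
  have te: "bracket t e = 0" using assms(2) bracket_anti[of t e] by simp
  have "bracket e (bracket t f) = 0"
    using bracket_bracket[of e t f] assms(2) g0_abelian[OF t h_g] by (simp add: ef)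
  then have tf: "bracket t f = 0"
    using e_inj_neg[OF g0_bracket_g[OF t f_g]] by simp
  have "{y. bracket t y = 0} = UNIV"
  proof (rule generated_UNIV)
    show "subspace {y. bracket t y = 0}" by (auto intro!: lie_subspaceI simp: bracket_linear)
  qed (use g0_abelian[OF t] te tf in \<open>auto simp: bracket_bracket[of t e] bracket_bracket[of t f]\<close>)
  then show "bracket t y = 0" for y by blast
qed

lemma g2_obtain:
  assumes "x \<in> g 2"
  obtains t where "t \<in> g 0" "bracket t e = x"
proof -
  obtain y where y: "y \<in> g 0" "x = bracket e y" using e_surj[OF assms] by auto
  show ?thesis
    by (rule that[of "- y"]) (use y gr_subspace subspace_neg in \<open>auto simp: bracket_linear bracket_anti[of y e]\<close>)
qed

definition killing :: "'g \<Rightarrow> 'g \<Rightarrow> complex" where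
  "killing x y = pos.tr (\<lambda>z. bracket x (bracket y z))"

lemma killing_invariant: "killing (bracket x y) z = killing x (bracket y z)"
proof -
  have "killing (bracket x y) z = pos.tr (\<lambda>w. bracket x (bracket y (bracket z w))) - pos.tr (\<lambda>w. bracket y (bracket x (bracket z w)))"
    unfolding killing_def by (subst pos.tr_diff[symmetric]) (simp add: bracket_bracket[of x y])
  also have "pos.tr (\<lambda>w. bracket y (bracket x (bracket z w))) = pos.tr (\<lambda>w. bracket x (bracket z (bracket y w)))"
    by (rule pos.tr_comm[of "bracket y" "\<lambda>w. bracket x (bracket z w)"]) (rule lin_bracket lin_bracket_bracket)+
  also have "pos.tr (\<lambda>w. bracket x (bracket y (bracket z w))) - pos.tr (\<lambda>w. bracket x (bracket z (bracket y w))) = killing x (bracket y z)"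
    unfolding killing_def by (subst pos.tr_diff[symmetric]) (simp add: bracket_bracket[of y z] bracket_linear)
  finally show ?thesis .
qed

lemma killing_add: "killing (x + y) z = killing x z + killing y z"
  "killing z (x + y) = killing z x + killing z y"
  unfolding killing_def by (simp_all add: bracket_linear pos.tr_add)

lemma killing_scale: "killing (scale c x) z = c * killing x z" "killing z (scale c x) = c * killing z x"
  unfolding killing_def by (simp_all add: bracket_linear pos.tr_scale)

text \<open>The value is the sum of the squared weights of the basis vectors, and weight 2 occurs
  because of \<open>e\<close>.\<close>

lemma killing_hh: "killing h h \<noteq> 0"
proof
  assume 0: "killing h h = 0"
  have "pos.coord b (bracket h (bracket h b)) = of_int (wt b * wt b)" if "b \<in> Basis" for b
    using that by (simp add: coord_h pos.coord_basis)
  then have "killing h h = of_int (\<Sum>b\<in>Basis. wt b * wt b)"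
    by (simp add: killing_def pos.tr_def)
  then have "(\<Sum>b\<in>Basis. wt b * wt b) = 0" using 0 by (metis of_int_eq_0_iff)
  then have "\<forall>b\<in>Basis. wt b * wt b = 0"
    using Basis(1) by (subst (asm) sum_nonneg_eq_0_iff) auto
  then have "{b \<in> Basis. wt b = 2} = {}" by auto
  then have "g 2 = {0}" using g_span[of 2] by (simp only: span_empty)
  then show False using e_g e_neq_0 by blast
qed

lemma killing_nondegenerate:
  assumes "\<And>y. killing x y = 0"
  shows "x = 0"
proof -
  let ?R = "{x. \<forall>y. killing x y = 0}"
  have "killing (bracket x y) z = 0" if "y \<in> ?R" for x y z
    using that killing_invariant[of y x z] bracket_anti[of x y] killing_scale(1)[of "-1" "bracket y x" z] by simp
  moreover have "subspace ?R"
    using killing_scale(1)[of 0 0] by (auto intro!: lie_subspaceI simp: killing_add killing_scale)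
  ultimately have "lie_ideal ?R" unfolding lie_ideal_def by auto
  then have "?R = {0} \<or> ?R = UNIV" by (rule ideals_trivial)
  moreover have "h \<notin> ?R" using killing_hh by blast
  ultimately show ?thesis using assms by blast
qed

text \<open>The Killing form pairs \<open>u\<close> to 0 with every \<open>y\<close>: for
  \<open>y\<close> in \<open>g 0\<close> the two brackets commute, so their product is nilpotent;
  for \<open>y\<close> of nonzero weight the product shifts the grading and has zero
  diagonal.\<close>

lemma nilpotent_g0:
  assumes u: "u \<in> g 0" and nil: "\<And>x. \<exists>n. (bracket u ^^ n) x = 0"
  shows "u = 0"
proof (rule killing_nondegenerate)
  have ge: "(bracket u ^^ j) x = 0" if "(bracket u ^^ i) x = 0" "i \<le> j" for i j x
    using that(2,1) by (induction j rule: dec_induct) simp_all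
  obtain n where n: "\<And>b. b \<in> Basis \<Longrightarrow> (bracket u ^^ n b) b = 0" using nil by metis
  define N where "N = Max (insert 0 (n ` Basis))"
  have "(bracket u ^^ N) b = 0" if "b \<in> Basis" for b
    by (rule ge[OF n[OF that]]) (use that Basis(1) in \<open>simp add: N_def\<close>)
  then have "(bracket u ^^ N) x = 0" for x
    using pos.coord_expand[of x] pos.lin_sum[OF pos.lin_funpow[OF lin_bracket], of N u "\<lambda>b. scale (pos.coord b x) b" Basis]
    by (simp add: pos.lin_scale[OF pos.lin_funpow[OF lin_bracket]])
  have 0: "killing u y = 0" if y: "y \<in> g 0" for y
    unfolding killing_def
  proof (rule pos.tr_nilpotent)
    show "pos.lin (\<lambda>z. bracket u (bracket y z))" by (rule lin_bracket_bracket)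
    have c: "(bracket y ^^ k) (bracket u x) = bracket u ((bracket y ^^ k) x)" for k x
      by (induction k) (simp_all add: g0_commute[OF y u])
    have "((\<lambda>z. bracket u (bracket y z)) ^^ k) x = (bracket y ^^ k) ((bracket u ^^ k) x)" for k x
      by (induction k) (simp_all add: g0_commute[OF u y] c)
    then show "((\<lambda>z. bracket u (bracket y z)) ^^ N) x = 0" for x
      using \<open>\<And>x. (bracket u ^^ N) x = 0\<close> pos.lin_0[OF pos.lin_funpow[OF lin_bracket]] by simp
  qed
  have 1: "killing u y = 0" if y: "y \<in> g k" "k \<noteq> 0" for y k
    unfolding killing_def pos.tr_def
  proof (rule sum.neutral, rule ballI)
    fix b assume b: "b \<in> Basis"
    have "bracket u (bracket y b) \<in> g (k + wt b)"
      by (intro g0_bracket_g[OF u] gr_bracket y basis_g b)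
    then show "pos.coord b (bracket u (bracket y b)) = 0" using coord_g b y(2) by simp
  qed
  have "{y. killing u y = 0} = UNIV"
  proof (rule graded_subspace_UNIV)
    show "subspace {y. killing u y = 0}"
      using killing_scale(2)[of u 0 0] by (auto intro!: lie_subspaceI simp: killing_add killing_scale)
    show "g k \<subseteq> {y. killing u y = 0}" for k using 0 1 by (cases "k = 0") auto
  qed
  then show "killing u y = 0" for y by blast
qed

text \<open>Writing \<open>w\<close> and \<open>bracket t w\<close> as brackets of \<open>s\<close>
  and \<open>u\<close> in the abelian \<open>g 0\<close> with \<open>e\<close> turns the hypothesis
  into \<open>bracket u (bracket u e) = 0\<close>. Then \<open>bracket u\<close> is nilpotent on
  generators, so \<open>u = 0\<close>.\<close>

lemma ad_g0_semisimple:
  assumes t: "t \<in> g 0" and w: "w \<in> g 2" and tt: "bracket t (bracket t w) = 0"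
  shows "bracket t w = 0"
proof -
  obtain s where s: "s \<in> g 0" "bracket s e = w" using g2_obtain[OF w] .
  obtain u where u: "u \<in> g 0" "bracket u e = bracket t w" using g2_obtain[OF g0_bracket_g[OF t w]] .
  have uue: "bracket u (bracket u e) = 0"
  proof -
    have "bracket u (bracket u e) = bracket u (bracket t (bracket s e))" by (simp only: u(2) s(2))
    also have "\<dots> = bracket t (bracket u (bracket s e))" by (rule g0_commute[OF u(1) t])
    also have "\<dots> = bracket t (bracket s (bracket u e))" by (simp only: g0_commute[OF u(1) s(1)])
    also have "\<dots> = bracket s (bracket t (bracket t w))" unfolding u(2) by (rule g0_commute[OF t s(1)])
    finally show ?thesis by (simp add: tt)
  qed
  have f1: "bracket e (bracket u f) = - bracket (bracket u e) f"
    using bracket_bracket[of u e f] g0_abelian[OF u(1) h_g] by (simp add: ef eq_neg_iff_add_eq_0 add.commute)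
  have f2: "bracket e (bracket u (bracket u f)) = - bracket (bracket u e) (bracket u f)"
  proof -
    have "bracket e (bracket u f) \<in> g 0" using e_bracket_g[OF g0_bracket_g[OF u(1) f_g]] by simp
    then have "bracket u (bracket e (bracket u f)) = 0" using g0_abelian u(1) by blast
    then show ?thesis using bracket_bracket[of u e "bracket u f"] by (simp add: eq_neg_iff_add_eq_0 add.commute)
  qed
  have fg: "bracket u f \<in> g (- 2)" "bracket u (bracket u f) \<in> g (- 2)"
    by (intro g0_bracket_g[OF u(1)] f_g)+
  have f3: "bracket (bracket u e) (bracket u (bracket u f)) = 0"
  proof -
    have "bracket (bracket u e) (bracket u f) \<in> g (2 + - 2)"
      by (intro gr_bracket g0_bracket_g[OF u(1)] e_g f_g)
    then have "bracket u (bracket (bracket u e) (bracket u f)) = 0" using g0_abelian u(1) by simp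
    then show ?thesis using bracket_bracket[of u "bracket u e" "bracket u f"] uue by simp
  qed
  \<comment> \<open>Raising is injective in weight -2, so the third power of
    \<open>bracket u\<close> on \<open>f\<close> is tested after \<open>bracket e\<close>; whatever
    falls into \<open>g 0\<close> is killed by \<open>bracket u\<close>.\<close>
  have "bracket e (bracket u (bracket u (bracket u f))) = 0"
  proof -
    have "bracket e (bracket u (bracket u f)) \<in> g 0" using e_bracket_g[OF fg(2)] by simp
    then have "bracket u (bracket e (bracket u (bracket u f))) = 0" using g0_abelian u(1) by blast
    then show ?thesis using bracket_bracket[of u e "bracket u (bracket u f)"] f3 by simp
  qed
  then have uuuf: "bracket u (bracket u (bracket u f)) = 0"
    using e_inj_neg[OF g0_bracket_g[OF u(1) fg(2)]] by simp
  let ?W = "{x. \<exists>n. (bracket u ^^ n) x = 0}"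
  have ge: "(bracket u ^^ j) x = 0" if "(bracket u ^^ i) x = 0" "i \<le> j" for i j x
    using that(2,1) by (induction j rule: dec_induct) simp_all
  have "?W = UNIV"
  proof (rule generated_UNIV)
    show "subspace ?W"
    proof (rule lie_subspaceI)
      show "0 \<in> ?W" by (auto intro: exI[of _ 0])
      show "x + y \<in> ?W" if xy: "x \<in> ?W" "y \<in> ?W" for x y
      proof -
        obtain i j where "(bracket u ^^ i) x = 0" "(bracket u ^^ j) y = 0" using xy by blast
        then have "(bracket u ^^ (max i j)) (x + y) = 0"
          using ge by (simp add: pos.lin_add[OF pos.lin_funpow[OF lin_bracket]])
        then show ?thesis by blast
      qed
    qed (auto simp: pos.lin_scale[OF pos.lin_funpow[OF lin_bracket]])
    show "g 0 \<subseteq> ?W" using g0_abelian[OF u(1)] by (auto intro: exI[of _ 1])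
    have "(bracket u ^^ 2) e = 0" using uue by (simp add: numeral_2_eq_2)
    then show "bracket e x \<in> ?W" if "x \<in> ?W" for x using that locally_nilpotent_bracket by blast
    have "(bracket u ^^ 3) f = 0" using uuuf by (simp add: numeral_3_eq_3)
    then show "bracket f x \<in> ?W" if "x \<in> ?W" for x using that locally_nilpotent_bracket by blast
  qed
  then have "u = 0" by (intro nilpotent_g0[OF u(1)]) blast
  then show ?thesis using u(2) by simp
qed

end

section \<open>The half trace on the nilradical\<close>

context graded_principal_sl2
begin

definition pplus :: "'g \<Rightarrow> 'g" where
  "pplus x = (\<Sum>b | b \<in> Basis \<and> wt b > 0. scale (pos.coord b x) b)"

text \<open>Composing with \<open>pplus\<close> expresses the trace over the positive part as a
  trace on the whole space, so that cyclicity remains available.\<close>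

definition half_trace :: "'g \<Rightarrow> complex" where
  "half_trace t = pos.tr (\<lambda>x. pplus (bracket t x)) / 2"

lemma pplus_lin: "pos.lin pplus"
  unfolding pplus_def
  by (rule pos.linI) (simp_all add: pos.coord_add pos.coord_scale scale_left_distrib sum.distrib scale_sum_right)

lemma pplus_on_g: "x \<in> g k \<Longrightarrow> pplus x = (if k > 0 then x else 0)"
proof -
  assume x: "x \<in> g k"
  show ?thesis
  proof (cases "k > 0")
    case True
    have "pplus x = (\<Sum>b\<in>Basis. scale (pos.coord b x) b)"
      unfolding pplus_def using True Basis(1) coord_g[OF x] by (intro sum.mono_neutral_left) auto
    then show ?thesis using True by (simp add: pos.coord_expand)
  next
    case False
    then have "pplus x = 0"
      unfolding pplus_def using coord_g[OF x] by (intro sum.neutral) auto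
    then show ?thesis using False by simp
  qed
qed

lemma half_trace_add: "half_trace (s + t) = half_trace s + half_trace t"
  unfolding half_trace_def by (simp add: bracket_linear pos.lin_add[OF pplus_lin] pos.tr_add add_divide_distrib)

lemma half_trace_scale: "half_trace (scale k t) = k * half_trace t"
  unfolding half_trace_def by (simp add: bracket_linear pos.lin_scale[OF pplus_lin] pos.tr_scale)

lemma half_trace_h: "half_trace h = of_int (\<Sum>b | b \<in> Basis \<and> wt b > 0. wt b) / 2"
proof -
  have "pos.coord b (pplus (bracket h b)) = of_int (if wt b > 0 then wt b else 0)" if b: "b \<in> Basis" for b
    unfolding wt[OF b] pos.lin_scale[OF pplus_lin] pplus_on_g[OF basis_g[OF b]]
    by (simp add: pos.coord_scale pos.coord_0 pos.coord_basis[OF b])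
  then have "pos.tr (\<lambda>x. pplus (bracket h x)) = of_int (\<Sum>b\<in>Basis. if wt b > 0 then wt b else 0)"
    by (simp add: pos.tr_def)
  also have "(\<Sum>b\<in>Basis. if wt b > 0 then wt b else 0) = (\<Sum>b | b \<in> Basis \<and> wt b > 0. wt b)"
    using Basis(1) by (simp add: sum.inter_filter)
  finally show ?thesis by (simp add: half_trace_def)
qed

text \<open>The projection \<open>pplus\<close> commutes with \<open>ad x\<close> except on \<open>g 0\<close>, so the trace of a
  commutator only sees \<open>g 0\<close>, where it has rank one.\<close>

lemma half_trace_bracket:
  assumes x: "x \<in> g 2" and y: "y \<in> g (- 2)"
    and \<alpha>: "\<alpha> \<in> dual (g 0)" "\<And>t. t \<in> g 0 \<Longrightarrow> bracket t x = scale (\<alpha> t) x"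
  shows "half_trace (bracket x y) = \<alpha> (bracket x y) / 2"
proof -
  have comm: "pplus (bracket x z) = bracket x (pplus z) + bracket x (comp 0 z)" for z
  proof (rule linear_eqI_graded[where S = "\<lambda>z. pplus (bracket x z)"
        and T = "\<lambda>z. bracket x (pplus z) + bracket x (comp 0 z)"])
    show "pos.lin (\<lambda>z. pplus (bracket x z))" by (rule pos.lin_comp[OF pplus_lin lin_bracket])
    show "pos.lin (\<lambda>z. bracket x (pplus z) + bracket x (comp 0 z))"
      by (rule pos.lin_plus[OF pos.lin_comp[OF lin_bracket pplus_lin] pos.lin_comp[OF lin_bracket comp_lin]])
    fix k z assume z: "z \<in> g k"
    have xz: "bracket x z \<in> g (2 + k)" by (rule gr_bracket[OF x z])
    \<comment> \<open>Only weight -1 could cross into the positive part without starting from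
      \<open>g 0\<close>, and that part is 0.\<close>
    consider "k > 0" | "k = 0" | "k = - 1" | "k \<le> - 2" by linarith
    then show "pplus (bracket x z) = bracket x (pplus z) + bracket x (comp 0 z)"
    proof cases
      case 3
      then have "z = 0" using g_odd[of k] z by simp
      then show ?thesis by (simp add: pos.lin_0[OF pplus_lin] pos.lin_0[OF comp_lin])
    qed (use pplus_on_g[OF xz] pplus_on_g[OF z] comp_on_g[OF z] in auto)
  qed
  have xyg: "bracket x y \<in> g 0" using gr_bracket[OF x y] by simp
  have "pos.tr (\<lambda>z. pplus (bracket (bracket x y) z))
      = pos.tr (\<lambda>z. pplus (bracket x (bracket y z))) - pos.tr (\<lambda>z. pplus (bracket y (bracket x z)))"
    by (subst pos.tr_diff[symmetric]) (simp add: bracket_bracket[of x y] pos.lin_add[OF pplus_lin])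
  also have "pos.tr (\<lambda>z. pplus (bracket x (bracket y z)))
      = pos.tr (\<lambda>z. bracket x (pplus (bracket y z))) + pos.tr (\<lambda>z. bracket x (comp 0 (bracket y z)))"
    unfolding comm by (rule pos.tr_add)
  also have "pos.tr (\<lambda>z. pplus (bracket y (bracket x z))) = pos.tr (\<lambda>z. bracket x (pplus (bracket y z)))"
    by (rule pos.tr_comm[OF pos.lin_comp[OF pplus_lin lin_bracket] lin_bracket])
  also have "pos.tr (\<lambda>z. bracket x (comp 0 (bracket y z))) = pos.tr (\<lambda>z. bracket y (bracket x (comp 0 z)))"
    by (rule pos.tr_comm[OF pos.lin_comp[OF lin_bracket comp_lin] lin_bracket])
  \<comment> \<open>On \<open>g 0\<close> the bracket with \<open>x\<close> is
    \<open>- \<alpha>\<close> times \<open>x\<close>, so the remaining operator takes values in the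
    multiples of \<open>bracket x y\<close>.\<close>
  also have "(\<lambda>z. bracket y (bracket x (comp 0 z))) = (\<lambda>z. scale (\<alpha> (comp 0 z)) (bracket x y))"
  proof
    fix z
    have "bracket x (comp 0 z) = - scale (\<alpha> (comp 0 z)) x"
      using \<alpha>(2)[OF comp_g] bracket_anti[of x "comp 0 z"] by simp
    then show "bracket y (bracket x (comp 0 z)) = scale (\<alpha> (comp 0 z)) (bracket x y)"
      by (simp add: bracket_linear bracket_anti[of y x])
  qed
  also have "pos.tr (\<lambda>z. scale (\<alpha> (comp 0 z)) (bracket x y)) = \<alpha> (comp 0 (bracket x y))"
  proof (rule pos.tr_rank_one)
    show "\<alpha> (comp 0 (v + w)) = \<alpha> (comp 0 v) + \<alpha> (comp 0 w)" for v w
      using \<alpha>(1) comp_g[of 0] by (simp add: dual_def pos.lin_add[OF comp_lin])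
    show "\<alpha> (comp 0 (scale k v)) = k * \<alpha> (comp 0 v)" for k v
      using \<alpha>(1) comp_g[of 0] by (simp add: dual_def pos.lin_scale[OF comp_lin])
  qed
  finally show ?thesis unfolding half_trace_def comp_on_g[OF xyg] by simp
qed

section \<open>Simple root vectors\<close>

text \<open>\<open>h\<close> acts on \<open>g 2\<close> as 2, so subtracting
  \<open>scale (\<mu> / 2) h\<close> moves an eigenvalue \<mu> of \<open>t\<close> to 0, the case
  treated by \<open>ad_g0_semisimple\<close>.\<close>

lemma g2_weight_vectors: "g 2 \<subseteq> span {v \<in> g 2. \<forall>T\<in>bracket ` g 0. \<exists>\<mu>. T v = scale \<mu> v}"
proof (rule pos.common_eigenvectors_span)
  show "S (T x) = T (S x)" if "S \<in> bracket ` g 0" "T \<in> bracket ` g 0" for S T x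
    using that g0_commute by auto
  show "T x = scale \<mu> x"
    if T: "T \<in> bracket ` g 0" and x: "x \<in> g 2" and sq: "T (T x - scale \<mu> x) = scale \<mu> (T x - scale \<mu> x)" for T x \<mu>
  proof -
    obtain t where t: "t \<in> g 0" "T = bracket t" using T by blast
    define t' where "t' = t - scale (\<mu> / 2) h"
    have t': "t' \<in> g 0" unfolding t'_def by (intro subspace_diff subspace_scale gr_subspace t h_g)
    have eq: "bracket t' z = bracket t z - scale \<mu> z" if "z \<in> g 2" for z
      using that by (simp add: t'_def bracket_linear gr_def)
    have "bracket t' (bracket t' x) = 0"
      using eq[OF x] eq[OF g0_bracket_g[OF t' x]] sq t by simp
    then have "bracket t' x = 0" by (rule ad_g0_semisimple[OF t' x])
    then show ?thesis using eq[OF x] t by simp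
  qed
qed (use lin_bracket gr_subspace g0_bracket_g in auto)

text \<open>The members of \<open>E\<close> are the components of \<open>e\<close> in the simple
  root spaces, and the \<open>eps v\<close> are the fundamental coweights. They exist because every
  vector of \<open>g 2\<close> is the bracket of some element of \<open>g 0\<close> with
  \<open>e\<close>.\<close>

lemma simple_root_vectors:
  obtains E eps where "finite E" "independent E" "span E = g 2" "(\<Sum>v\<in>E. v) = e"
    "\<And>v. v \<in> E \<Longrightarrow> eps v \<in> g 0" "\<And>v. v \<in> E \<Longrightarrow> bracket (eps v) e = v"
    "\<And>u v. u \<in> E \<Longrightarrow> v \<in> E \<Longrightarrow> bracket (eps u) v = (if u = v then v else 0)"
proof -
  let ?S = "{v \<in> g 2. \<forall>T\<in>bracket ` g 0. \<exists>\<mu>. T v = scale \<mu> v}"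
  obtain B where B: "B \<subseteq> ?S" "independent B" "?S \<subseteq> span B"
    using maximal_independent_subset[of ?S] by blast
  have fin: "finite B" using B(2) by (rule pos.finiteI_independent)
  have Bg: "B \<subseteq> g 2" using B(1) by blast
  have "span ?S \<subseteq> span B" by (rule span_minimal[OF B(3) subspace_span])
  moreover have "span B \<subseteq> g 2" by (rule span_minimal[OF Bg gr_subspace])
  ultimately have spanB: "span B = g 2" using g2_weight_vectors by blast
  have indep: "\<forall>b\<in>B. c b = 0" if "(\<Sum>b\<in>B. scale (c b) b) = 0" for c
    using independentD[OF B(2) fin subset_refl that] by blast
  obtain r where r: "e = (\<Sum>b\<in>B. scale (r b) b)"
    using e_g spanB span_finite[OF fin] by auto
  have "\<forall>b\<in>B. \<exists>t\<in>g 0. bracket t e = b" using g2_obtain Bg by (metis subsetD)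
  then obtain t where t: "\<And>b. b \<in> B \<Longrightarrow> t b \<in> g 0" "\<And>b. b \<in> B \<Longrightarrow> bracket (t b) e = b" by metis
  have "\<forall>a\<in>B. \<forall>b\<in>B. \<exists>\<mu>. bracket (t a) b = scale \<mu> b" using B(1) t(1) by blast
  then obtain w where w: "\<And>a b. a \<in> B \<Longrightarrow> b \<in> B \<Longrightarrow> bracket (t a) b = scale (w a b) b" by metis
  \<comment> \<open>Comparison of coefficients in \<open>bracket (t a) e = a\<close>. In particular
    each \<open>r b\<close> is nonzero and can be absorbed into the basis vector.\<close>
  have rw: "r b * w a b = (if a = b then 1 else 0)" if ab: "a \<in> B" "b \<in> B" for a b
  proof -
    have "(\<Sum>b\<in>B. scale (r b * w a b - (if a = b then 1 else 0)) b)
        = (\<Sum>b\<in>B. scale (r b) (bracket (t a) b)) - (\<Sum>b\<in>B. scale (if a = b then 1 else 0) b)"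
      using w[OF ab(1)] by (simp add: scale_left_diff_distrib sum_subtractf)
    also have "(\<Sum>b\<in>B. scale (r b) (bracket (t a) b)) = bracket (t a) e"
      by (subst r) (simp add: bracket_sum_right bracket_linear)
    also have "(\<Sum>b\<in>B. scale (if a = b then 1 else 0) b) = (\<Sum>b\<in>{a}. b)"
      using fin ab by (intro sum.mono_neutral_cong_right) auto
    finally have "(\<Sum>b\<in>B. scale (r b * w a b - (if a = b then 1 else 0)) b) = 0"
      using t(2)[OF ab(1)] by simp
    from indep[OF this] show ?thesis using ab(2) by simp
  qed
  have r0: "r b \<noteq> 0" if "b \<in> B" for b using rw[OF that that] by auto
  have inj: "inj_on (\<lambda>b. scale (r b) b) B"
  proof (rule inj_onI)
    fix a b assume ab: "a \<in> B" "b \<in> B" "scale (r a) a = scale (r b) b"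
    have "bracket (t a) (scale (r a) a) = bracket (t a) (scale (r b) b)" using ab by simp
    then have "scale (r a * w a a) a = scale (r b * w a b) b"
      by (simp only: bracket_scale_right w[OF ab(1) ab(1)] w[OF ab(1,2)] scale_scale)
    then have "a = scale (if a = b then 1 else 0) b" unfolding rw[OF ab(1) ab(1)] rw[OF ab(1,2)] by simp
    moreover have "a \<noteq> 0" using ab(1) B(2) dependent_zero by blast
    ultimately show "a = b" by (cases "a = b") auto
  qed
  define E where "E = (\<lambda>b. scale (r b) b) ` B"
  define idx where "idx = inv_into B (\<lambda>b. scale (r b) b)"
  have idx: "idx (scale (r b) b) = b" if "b \<in> B" for b
    unfolding idx_def by (rule inv_into_f_f[OF inj that])
  define eps where "eps v = scale (r (idx v)) (t (idx v))" for v
  show ?thesis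
  proof (rule that)
    show "finite E" by (simp add: E_def fin)
    show "(\<Sum>v\<in>E. v) = e" unfolding E_def r by (simp add: sum.reindex[OF inj])
    show "eps v \<in> g 0" if "v \<in> E" for v
      using that t(1) by (auto simp: E_def eps_def idx intro: subspace_scale[OF gr_subspace])
    show "bracket (eps v) e = v" if "v \<in> E" for v
      using that t(2) by (auto simp: E_def eps_def idx bracket_linear)
    show *: "bracket (eps u) v = (if u = v then v else 0)" if "u \<in> E" "v \<in> E" for u v
    proof -
      from that obtain a b where ab: "a \<in> B" "u = scale (r a) a" "b \<in> B" "v = scale (r b) b"
        unfolding E_def by blast
      have "bracket (eps u) v = scale (r a * (r b * w a b)) b"
        using ab w by (simp add: eps_def idx bracket_linear mult.commute mult.left_commute)
      moreover have "(u = v) = (a = b)" using ab inj by (auto simp: inj_on_def)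
      ultimately show ?thesis using rw[OF ab(1,3)] ab by auto
    qed
    have E0: "0 \<notin> E" using r0 dependent_zero B(2) by (auto simp: E_def)
    show "independent E"
      unfolding independent_explicit_finite_subsets
    proof (intro allI impI ballI)
      fix A c v assume A: "A \<subseteq> E" "finite A" "(\<Sum>v\<in>A. scale (c v) v) = 0" "v \<in> A"
      have "bracket (eps v) (\<Sum>u\<in>A. scale (c u) u) = (\<Sum>u\<in>A. scale (c u) (bracket (eps v) u))"
        by (simp add: bracket_sum_right bracket_scale_right)
      also have "\<dots> = (\<Sum>u\<in>A. if u = v then scale (c v) v else 0)"
      proof (intro sum.cong refl)
        fix u assume "u \<in> A"
        then have "bracket (eps v) u = (if v = u then u else 0)" using A(1,4) by (intro *) auto
        then show "scale (c u) (bracket (eps v) u) = (if u = v then scale (c v) v else 0)" by auto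
      qed
      also have "\<dots> = scale (c v) v" using A by (simp add: sum.delta)
      finally have "scale (c v) v = 0" unfolding A(3) by simp
      moreover have "v \<noteq> 0" using A E0 by blast
      ultimately show "c v = 0" by simp
    qed
    show "span E = g 2"
    proof
      show "span E \<subseteq> g 2"
        using Bg subspace_scale[OF gr_subspace] by (intro span_minimal gr_subspace) (auto simp: E_def)
      have "b \<in> span E" if "b \<in> B" for b
      proof -
        have "scale (1 / r b) (scale (r b) b) \<in> span E"
          using that by (intro span_scale span_base) (auto simp: E_def)
        then show ?thesis using r0[OF that] by simp
      qed
      then have "span B \<subseteq> span E" by (intro span_minimal) auto
      then show "g 2 \<subseteq> span E" by (simp add: spanB)
    qed
  qed
qed

end

locale simple_root_basis = graded_principal_sl2 scale bracket e f h Basis wt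
  for scale :: "complex \<Rightarrow> 'g::ab_group_add \<Rightarrow> 'g" and bracket :: "'g \<Rightarrow> 'g \<Rightarrow> 'g" and e f h Basis wt +
  fixes E :: "'g set" and eps :: "'g \<Rightarrow> 'g"
  assumes E: "finite E" "independent E" "span E = g 2" "(\<Sum>v\<in>E. v) = e"
    and eps_g: "v \<in> E \<Longrightarrow> eps v \<in> g 0" and eps_e: "v \<in> E \<Longrightarrow> bracket (eps v) e = v"
    and eps_E: "u \<in> E \<Longrightarrow> v \<in> E \<Longrightarrow> bracket (eps u) v = (if u = v then v else 0)"
begin

lemma E_g: "v \<in> E \<Longrightarrow> v \<in> g 2"
  using E(3) span_base by blast

lemma E_nonzero: "v \<in> E \<Longrightarrow> v \<noteq> 0"
  using E(2) dependent_zero by blast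

text \<open>The simple root attached to \<open>v\<close>; the value 0 outside \<open>g 0\<close> is
  what membership in \<open>dual\<close> demands.\<close>

definition w :: "'g \<Rightarrow> 'g \<Rightarrow> complex" where
  "w v t = (if t \<in> g 0 then THE c. bracket t v = scale c v else 0)"

lemma w_eqI: "v \<in> E \<Longrightarrow> t \<in> g 0 \<Longrightarrow> bracket t v = scale c v \<Longrightarrow> w v t = c"
  using E_nonzero[of v] by (auto simp: w_def)

lemma bracket_g0_E:
  assumes "v \<in> E" "t \<in> g 0"
  shows "bracket t v = scale (w v t) v" and "t = (\<Sum>v\<in>E. scale (w v t) (eps v))"
proof -
  have "bracket t e \<in> span E" using g0_bracket_g[OF assms(2) e_g] E(3) by simp
  then obtain c where c: "bracket t e = (\<Sum>v\<in>E. scale (c v) v)" using span_finite[OF E(1)] by auto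
  let ?s = "t - (\<Sum>v\<in>E. scale (c v) (eps v))"
  have "bracket ?s e = 0" by (simp add: bracket_linear bracket_sum_left eps_e c)
  then have es: "bracket e ?s = 0" by (subst bracket_anti) simp
  have "?s \<in> g 0"
    by (rule subspace_diff[OF gr_subspace assms(2) subspace_sum[OF gr_subspace subspace_scale[OF gr_subspace eps_g]]])
  then have "?s = 0" using es by (rule e_inj_0)
  then have t: "t = (\<Sum>v\<in>E. scale (c v) (eps v))" by simp
  have "bracket t v = scale (c v) v" if "v \<in> E" for v
  proof -
    have "bracket t v = (\<Sum>u\<in>E. if u = v then scale (c v) v else 0)"
      unfolding t using that by (auto simp: bracket_sum_left bracket_linear eps_E intro!: sum.cong)
    then show ?thesis using E(1) that by (simp add: sum.delta)
  qed
  moreover from this have "w v t = c v" if "v \<in> E" for v using w_eqI that assms(2) by blast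
  ultimately show "bracket t v = scale (w v t) v" "t = (\<Sum>v\<in>E. scale (w v t) (eps v))"
    using assms t by auto
qed

lemma E_nonempty: "E \<noteq> {}"
  using E(4) e_neq_0 by auto

lemma w_h: "v \<in> E \<Longrightarrow> w v h = 2"
  using E_g[of v] by (intro w_eqI h_g) (simp_all add: gr_def)

lemma w_dual: "v \<in> E \<Longrightarrow> w v \<in> dual (g 0)"
proof -
  assume v: "v \<in> E"
  have "w v (s + t) = w v s + w v t" if "s \<in> g 0" "t \<in> g 0" for s t
    using v that by (intro w_eqI subspace_add gr_subspace)
      (simp_all add: bracket_linear bracket_g0_E(1) scale_left_distrib)
  moreover have "w v (scale k t) = k * w v t" if "t \<in> g 0" for k t
    using v that by (intro w_eqI subspace_scale gr_subspace) (simp_all add: bracket_linear bracket_g0_E(1))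
  ultimately show ?thesis by (simp add: dual_def w_def)
qed

text \<open>The component of \<open>f\<close> in the root space opposite to \<open>v\<close>, on
  which \<open>eps v\<close> acts as -1; this explains the sign. Correspondingly
  \<open>kv v\<close>, which equals \<open>bracket v (fv v)\<close>, is the part of \<open>h\<close>
  along the coroot.\<close>

definition fv :: "'g \<Rightarrow> 'g" where "fv v = - bracket (eps v) f"

definition kv :: "'g \<Rightarrow> 'g" where "kv v = bracket v f"

lemma fv_g: "v \<in> E \<Longrightarrow> fv v \<in> g (- 2)"
  unfolding fv_def by (intro subspace_neg gr_subspace g0_bracket_g eps_g f_g)

lemma kv_g: "v \<in> E \<Longrightarrow> kv v \<in> g 0"
  using gr_bracket[OF E_g f_g] by (simp add: kv_def)

lemma sum_fv: "(\<Sum>v\<in>E. fv v) = f"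
proof -
  obtain v where "v \<in> E" using E_nonempty by blast
  then have "h = (\<Sum>v\<in>E. scale 2 (eps v))" using bracket_g0_E(2)[OF _ h_g] w_h by simp
  then have "bracket h f = scale (- 2) (\<Sum>v\<in>E. fv v)"
    by (simp add: fv_def bracket_sum_left bracket_linear sum_negf scale_sum_right)
  then show ?thesis by (simp only: hf scale_cancel_left) simp
qed

lemma sum_kv: "(\<Sum>v\<in>E. kv v) = h"
  unfolding kv_def by (simp add: E(4) ef flip: bracket_sum_left)

text \<open>\<open>bracket u f\<close> lies in the abelian \<open>g 0\<close>, so
  \<open>eps v\<close> kills it; the Leibniz rule turns this into the vanishing of mixed
  brackets.\<close>

lemma bracket_E_fv:
  assumes "u \<in> E" "v \<in> E"
  shows "bracket u (fv v) = (if u = v then kv v else 0)"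
proof -
  have "bracket (eps v) (bracket u f) = 0"
    using g0_abelian eps_g kv_g assms by (simp add: kv_def)
  then have "bracket (bracket (eps v) u) f + bracket u (bracket (eps v) f) = 0"
    by (simp add: bracket_bracket[of "eps v" u f])
  then show ?thesis
    using assms by (auto simp: eps_E fv_def kv_def bracket_linear add_eq_0_iff)
qed

lemma bracket_fv_E:
  assumes "u \<in> E" "v \<in> E"
  shows "bracket (fv v) u = (if u = v then - kv v else 0)"
  using bracket_E_fv[OF assms] bracket_anti[of "fv v" u] by simp

lemma bracket_e_fv: "v \<in> E \<Longrightarrow> bracket e (fv v) = kv v"
proof -
  assume "v \<in> E"
  then have "bracket e (fv v) = (\<Sum>u\<in>E. if u = v then kv v else 0)"
    unfolding E(4)[symmetric] bracket_sum_left by (auto simp: bracket_E_fv intro!: sum.cong)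
  then show ?thesis using \<open>v \<in> E\<close> E(1) by (simp add: sum.delta)
qed

lemma bracket_eps_fv:
  assumes "u \<in> E" "v \<in> E"
  shows "bracket (eps u) (fv v) = (if u = v then - fv v else 0)"
proof -
  have "bracket (eps u) (bracket e (fv v)) = 0"
    using g0_abelian eps_g kv_g assms by (simp add: bracket_e_fv)
  then have "bracket e (bracket (eps u) (fv v)) = - bracket u (fv v)"
    using bracket_bracket[of "eps u" e "fv v"] eps_e assms by (simp add: minus_unique)
  then have "bracket e (bracket (eps u) (fv v) + (if u = v then fv v else 0)) = 0"
    using assms by (auto simp: bracket_linear bracket_E_fv bracket_e_fv)
  moreover have "bracket (eps u) (fv v) + (if u = v then fv v else 0) \<in> g (- 2)"
    using assms fv_g eps_g g0_bracket_g subspace_0[OF gr_subspace] by (intro subspace_add gr_subspace) auto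
  ultimately have "bracket (eps u) (fv v) + (if u = v then fv v else 0) = 0"
    using e_inj_neg by simp
  then show ?thesis by (auto simp: eq_neg_iff_add_eq_0)
qed

lemma bracket_g0_fv:
  assumes "v \<in> E" "t \<in> g 0"
  shows "bracket t (fv v) = scale (- w v t) (fv v)"
proof -
  have "bracket t (fv v) = (\<Sum>u\<in>E. bracket (scale (w u t) (eps u)) (fv v))"
    by (subst bracket_g0_E(2)[OF assms]) (simp add: bracket_sum_left)
  also have "\<dots> = (\<Sum>u\<in>E. if u = v then scale (- w v t) (fv v) else 0)"
    using assms by (intro sum.cong) (auto simp: bracket_linear bracket_eps_fv)
  finally show ?thesis using assms E(1) by (simp add: sum.delta)
qed

text \<open>Were the weight of a root vector \<open>x\<close> above 2, lowering by \<open>f\<close>,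
  and hence by some \<open>fv v\<close>, would not kill it, and \<alpha> would split as
  \<open>w v\<close> plus another positive root.\<close>

lemma simple_root_h:
  assumes "\<alpha> \<in> simple_roots h"
  shows "\<alpha> h = 2"
proof -
  have \<alpha>: "\<alpha> \<in> roots (g 0)" "\<alpha> h \<in> \<real>" "Re (\<alpha> h) > 0"
    and ind: "\<And>\<beta> \<gamma>. \<beta> \<in> positive_roots h \<Longrightarrow> \<gamma> \<in> positive_roots h \<Longrightarrow> \<alpha> \<noteq> (\<lambda>t. \<beta> t + \<gamma> t)"
    using assms by (auto simp: simple_roots_def positive_roots_def gr_0)
  have "0 \<in> root_space (g 0) \<alpha>" by (simp add: root_space_def)
  then obtain x where x: "x \<noteq> 0" "x \<in> root_space (g 0) \<alpha>" using \<alpha>(1) by (auto simp: roots_def)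
  have xt: "bracket t x = scale (\<alpha> t) x" if "t \<in> g 0" for t using x that by (simp add: root_space_def)
  obtain k where k: "\<alpha> h = of_int k" using pos.weight_integer[OF xt[OF h_g] x(1)] by blast
  have xg: "x \<in> g k" using xt[OF h_g] k by (simp add: gr_def)
  have "even k" using g_odd[of k] xg x(1) by auto
  have "k > 0" using \<alpha>(3) k by simp
  have "k = 2"
  proof (rule ccontr)
    assume "k \<noteq> 2"
    then have k4: "k > 2" using \<open>even k\<close> \<open>k > 0\<close> by presburger
    have "bracket f x \<noteq> 0" using f_inj_pos[OF xg \<open>k > 0\<close>] x(1) by blast
    then have "(\<Sum>v\<in>E. bracket (fv v) x) \<noteq> 0" by (simp add: sum_fv flip: bracket_sum_left)
    then obtain v where v: "v \<in> E" "bracket (fv v) x \<noteq> 0" by (meson sum.neutral)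
    define \<gamma> where "\<gamma> t = \<alpha> t - w v t" for t
    have "bracket t (bracket (fv v) x) = scale (\<gamma> t) (bracket (fv v) x)" if "t \<in> g 0" for t
      using v(1) that by (simp add: bracket_bracket[of t "fv v"] bracket_g0_fv xt bracket_linear \<gamma>_def scale_left_diff_distrib)
    then have "bracket (fv v) x \<in> root_space (g 0) \<gamma>" by (simp add: root_space_def)
    moreover have "\<gamma> \<in> dual (g 0)"
      using \<alpha>(1) w_dual[OF v(1)] by (auto simp: roots_def dual_def \<gamma>_def algebra_simps)
    moreover have \<gamma>h: "\<gamma> h = of_int (k - 2)" using k w_h[OF v(1)] by (simp add: \<gamma>_def)
    then have "\<gamma> h \<noteq> 0" using k4 by (simp only: of_int_eq_0_iff)
    ultimately have "\<gamma> \<in> roots (g 0)" using v(2) by (auto simp: roots_def)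
    then have "\<gamma> \<in> positive_roots h" using \<gamma>h k4 by (simp add: positive_roots_def gr_0)
    moreover have "w v \<in> positive_roots h"
    proof -
      have "v \<in> root_space (g 0) (w v)" using bracket_g0_E(1)[OF v(1)] by (simp add: root_space_def)
      then have "w v \<in> roots (g 0)"
        using w_dual[OF v(1)] E_nonzero[OF v(1)] w_h[OF v(1)] by (auto simp: roots_def)
      then show ?thesis using w_h[OF v(1)] by (simp add: positive_roots_def gr_0)
    qed
    ultimately show False using ind[of \<gamma> "w v"] by (simp add: \<gamma>_def fun_eq_iff)
  qed
  then show ?thesis using k by simp
qed

text \<open>The coroot is a combination of brackets of opposite root vectors of weights 2 and -2; on
  each of them \<open>half_trace\<close> is half of \<alpha>.\<close>

lemma half_trace_coroot:
  assumes \<alpha>: "\<alpha> \<in> simple_roots h" and c: "is_coroot (centralizer h) \<alpha> c"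
  shows "c \<in> centralizer h" "half_trace c = 1"
proof -
  have dual: "\<alpha> \<in> dual (g 0)" using \<alpha> by (simp add: simple_roots_def positive_roots_def roots_def gr_0)
  have \<alpha>_add: "\<alpha> (s + t) = \<alpha> s + \<alpha> t" if "s \<in> g 0" "t \<in> g 0" for s t
    using dual that by (simp add: dual_def)
  have \<alpha>_scale: "\<alpha> (scale k t) = k * \<alpha> t" if "t \<in> g 0" for k t
    using dual that by (simp add: dual_def)
  have z: "0 \<in> g 0" by (rule subspace_0[OF gr_subspace])
  have c2: "\<alpha> c = 2" using c by (simp add: is_coroot_def)
  have "c \<in> span {bracket x y | x y. x \<in> root_space (g 0) \<alpha> \<and> y \<in> root_space (g 0) (\<lambda>t. - \<alpha> t)}"
    using c by (simp add: is_coroot_def gr_0)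
  then have "c \<in> g 0 \<and> half_trace c = \<alpha> c / 2"
  proof (induction c rule: span_induct_alt)
    case base
    show ?case using z \<alpha>_scale[OF z, of 0] half_trace_scale[of 0 0] by simp
  next
    case (step k z y)
    then obtain x y' where z: "z = bracket x y'" "x \<in> root_space (g 0) \<alpha>" "y' \<in> root_space (g 0) (\<lambda>t. - \<alpha> t)"
      by blast
    have xy: "x \<in> g 2" "y' \<in> g (- 2)"
      using z h_g simple_root_h[OF \<alpha>] by (simp_all add: root_space_def gr_def)
    have zg: "z \<in> g 0" using gr_bracket[OF xy] z by simp
    have hz: "half_trace z = \<alpha> z / 2"
      unfolding z(1) by (rule half_trace_bracket[OF xy dual]) (use z in \<open>simp add: root_space_def\<close>)
    have y: "y \<in> g 0" "half_trace y = \<alpha> y / 2" using step.IH by simp_all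
    have kz: "scale k z \<in> g 0" by (rule subspace_scale[OF gr_subspace zg])
    have "half_trace (scale k z + y) = k * (\<alpha> z / 2) + \<alpha> y / 2"
      by (simp only: half_trace_add half_trace_scale hz y(2))
    also have "\<dots> = \<alpha> (scale k z + y) / 2"
      by (simp add: \<alpha>_add[OF kz y(1)] \<alpha>_scale[OF zg] add_divide_distrib)
    finally show ?case using subspace_add[OF gr_subspace kz y(1)] by blast
  qed
  then show "c \<in> centralizer h" "half_trace c = 1" using c2 by (simp_all add: gr_0)
qed

section \<open>Connectedness of the Dynkin diagram and dimensions\<close>

text \<open>If \<open>p\<close> and \<open>q\<close> commute, \<open>kv p\<close> acts as 0 on
  \<open>q\<close> and vice versa; then \<open>bracket e\<close> kills the bracket in question,
  which has negative weight.\<close>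

lemma fv_commute:
  assumes pq: "p \<in> E" "q \<in> E" "p \<noteq> q" and 0: "bracket p q = 0"
  shows "bracket (fv p) (fv q) = 0"
proof -
  have w0: "w q (kv p) = 0" if "p \<in> E" "q \<in> E" "p \<noteq> q" "bracket p q = 0" for p q
  proof (rule w_eqI[OF that(2) kv_g[OF that(1)]])
    have "bracket p (bracket (fv p) q) = bracket (bracket p (fv p)) q + bracket (fv p) (bracket p q)"
      by (rule bracket_bracket)
    then show "bracket (kv p) q = scale 0 q" using that by (simp add: bracket_fv_E bracket_E_fv)
  qed
  have "bracket q p = 0" using 0 bracket_anti[of q p] by simp
  then have "bracket (kv p) (fv q) = 0" "bracket (kv q) (fv p) = 0"
    using bracket_g0_fv kv_g pq w0[OF pq 0] w0[OF pq(2,1)] by auto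
  then have "bracket e (bracket (fv p) (fv q)) = 0"
    using pq bracket_anti[of "fv p" "kv q"] by (simp add: bracket_bracket[of e] bracket_e_fv)
  moreover have "bracket (fv p) (fv q) \<in> g (- 2 + - 2)" by (intro gr_bracket fv_g pq)
  ultimately show ?thesis using e_inj_neg by simp
qed

text \<open>The centralizer of one part of a disconnected diagram would be a proper nonzero ideal.\<close>

lemma kernel_e_g2:
  assumes t: "t \<in> g 0" and ee: "bracket e (bracket t e) = 0"
  obtains k where "t = scale k h"
proof -
  \<comment> \<open>Applying \<open>eps q\<close> and then \<open>eps p\<close> to the hypothesis
    extracts its component of weight \<open>w p + w q\<close>, which is \<open>w q t - w p t\<close>
    times \<open>bracket p q\<close>.\<close>
  have pq: "bracket p q = 0" if "p \<in> E" "q \<in> E" "w p t \<noteq> w q t" for p q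
  proof -
    have neq: "p \<noteq> q" using that by auto
    have "bracket (eps q) (bracket e (bracket t e)) = bracket q (bracket t e) + bracket e (bracket t q)"
      using that by (simp add: bracket_bracket[of "eps q" e] g0_commute[OF eps_g t] eps_e)
    then have "bracket q (bracket t e) + scale (w q t) (bracket e q) = 0"
      using ee bracket_g0_E(1)[OF that(2) t] by (simp add: bracket_linear)
    then have "bracket (eps p) (bracket q (bracket t e)) + scale (w q t) (bracket (eps p) (bracket e q)) = 0"
      by (metis bracket_0(2) bracket_add_right bracket_scale_right)
    moreover have "bracket (eps p) (bracket q (bracket t e)) = scale (w p t) (bracket q p)"
      using that neq bracket_g0_E(1)[OF that(1) t]
      by (simp add: bracket_bracket[of "eps p" q] g0_commute[OF eps_g t] eps_e eps_E bracket_linear)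
    moreover have "bracket (eps p) (bracket e q) = bracket p q"
      using that neq by (simp add: bracket_bracket[of "eps p" e] eps_e eps_E)
    ultimately have "scale (w q t - w p t) (bracket p q) = 0"
      using bracket_anti[of q p] by (simp add: scale_left_diff_distrib)
    then show ?thesis using that(3) by simp
  qed
  obtain u0 where u0: "u0 \<in> E" using E_nonempty by blast
  have "w v t = w u0 t" if v0: "v \<in> E" for v
  proof (rule ccontr)
    assume vu: "w v t \<noteq> w u0 t"
    define J where "J = {v \<in> E. w v t \<noteq> w u0 t}"
    define C where "C = {x. \<forall>v\<in>J. bracket v x = 0 \<and> bracket (fv v) x = 0}"
    have J: "J \<subseteq> E" by (auto simp: J_def)
    have Cin: "u \<in> C \<and> fv u \<in> C" if u: "u \<in> E - J" for u
    proof -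
      have "bracket v u = 0 \<and> bracket (fv v) u = 0 \<and> bracket v (fv u) = 0 \<and> bracket (fv v) (fv u) = 0" if "v \<in> J" for v
      proof -
        have "v \<in> E" "u \<in> E" "u \<noteq> v" "w v t \<noteq> w u t" using u that by (auto simp: J_def)
        then show ?thesis using pq[of v u] fv_commute[of v u] by (simp add: bracket_fv_E bracket_E_fv)
      qed
      then show ?thesis by (simp add: C_def)
    qed
    have Csub: "subspace C" by (auto intro!: lie_subspaceI simp: C_def bracket_linear)
    have Calg: "bracket x y \<in> C" if "x \<in> C" "y \<in> C" for x y
      using that by (auto simp: C_def bracket_bracket[of _ x y])
    \<comment> \<open>That \<open>C\<close> is an ideal is shown through its normalizer
      \<open>N\<close>. It contains every \<open>v\<close> and \<open>fv v\<close>: those with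
      \<open>v\<close> in \<open>J\<close> annihilate \<open>C\<close>, and the others lie in the
      subalgebra \<open>C\<close>.\<close>
    define N where "N = {x. \<forall>y\<in>C. bracket x y \<in> C}"
    have Nsub: "subspace N"
      using Csub by (auto intro!: lie_subspaceI simp: N_def bracket_linear subspace_0 subspace_add subspace_scale)
    have NN: "bracket x y \<in> N" if "x \<in> N" "y \<in> N" for x y
    proof -
      have "bracket (bracket x y) z \<in> C" if "z \<in> C" for z
      proof -
        have "bracket (bracket x y) z = bracket x (bracket y z) - bracket y (bracket x z)"
          using bracket_bracket[of x y z] by simp
        then show ?thesis using that \<open>x \<in> N\<close> \<open>y \<in> N\<close> subspace_diff[OF Csub] by (simp add: N_def)
      qed
      then show ?thesis by (simp add: N_def)
    qed
    have "v \<in> N \<and> fv v \<in> N" if "v \<in> E" for v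
    proof (cases "v \<in> J")
      case True
      then show ?thesis using subspace_0[OF Csub] by (auto simp: N_def C_def)
    next
      case False
      then show ?thesis using Cin[of v] Calg that by (simp add: N_def)
    qed
    then have "(\<Sum>v\<in>E. v) \<in> N" "(\<Sum>v\<in>E. fv v) \<in> N" by (auto intro: subspace_sum[OF Nsub])
    then have efN: "e \<in> N" "f \<in> N" by (simp_all only: E(4) sum_fv)
    have "N = UNIV"
    proof (rule generated_UNIV[OF Nsub])
      show "g 0 \<subseteq> N"
      proof
        fix s assume s: "s \<in> g 0"
        have "bracket s y \<in> C" if y: "y \<in> C" for y
        proof -
          have "bracket v (bracket s y) = 0 \<and> bracket (fv v) (bracket s y) = 0" if v: "v \<in> J" for v
          proof -
            have "bracket v s = scale (- w v s) v" "bracket (fv v) s = scale (w v s) (fv v)"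
              using bracket_g0_E(1)[of v s] bracket_g0_fv[of v s] s v J bracket_anti[of v s] bracket_anti[of "fv v" s] by auto
            then show ?thesis
              using y v by (simp add: bracket_bracket[of _ s y] C_def bracket_linear)
          qed
          then show ?thesis by (simp add: C_def)
        qed
        then show "s \<in> N" by (simp add: N_def)
      qed
    qed (use efN NN in blast)+
    then have "lie_ideal C" using Csub by (auto simp: lie_ideal_def N_def)
    then have "C = {0} \<or> C = UNIV" by (rule ideals_trivial)
    moreover have "u0 \<in> C" using Cin[of u0] u0 by (simp add: J_def)
    ultimately have "C = UNIV" using E_nonzero[OF u0] by auto
    moreover have "v \<in> J" using v0 vu by (simp add: J_def)
    ultimately have "bracket v h = 0" by (auto simp: C_def)
    then show False using E_g[OF v0] E_nonzero[OF v0] bracket_anti[of v h] by (simp add: gr_def)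
  qed
  then have "t = (\<Sum>v\<in>E. scale (w u0 t / 2) (scale (w v h) (eps v)))"
    using bracket_g0_E(2)[OF u0 t] w_h by simp
  also have "\<dots> = scale (w u0 t / 2) h"
    using bracket_g0_E(2)[OF u0 h_g] by (simp only: scale_sum_right[symmetric])
  finally show ?thesis by (rule that)
qed

section \<open>Inequalities for the dimensions of the graded parts\<close>

lemma D_antimono: "k > 0 \<Longrightarrow> D k \<le> D (k - 2)"
proof -
  assume k: "k > 0"
  interpret vp: finite_dimensional_vector_space_pair_1 scale Basis scale ..
  have "g k \<subseteq> bracket e ` g (k - 2)" using e_surj[OF _ k] by blast
  then have "dim (g k) \<le> dim (bracket e ` g (k - 2))" by (rule pos.dim_subset)
  also have "\<dots> \<le> dim (g (k - 2))" by (rule vp.dim_image_le[OF lin_bracket])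
  finally show ?thesis by (simp add: dim_g)
qed

text \<open>By \<open>kernel_e_g2\<close> the kernel of \<open>bracket e\<close> on
  \<open>g 2\<close> is spanned by \<open>e\<close>; connectedness of the diagram enters
  here.\<close>

lemma D_2_4: "D 2 \<le> D 4 + 1"
proof -
  have "D 2 \<le> dim {x \<in> g 2. bracket e x = 0} + dim (bracket e ` g 2)"
    using pos.dim_kernel_image[OF lin_bracket gr_subspace, of h 2 e] dim_g[of 2] by simp
  also have "dim (bracket e ` g 2) \<le> dim (g 4)"
    using e_bracket_g[of _ 2] by (intro pos.dim_subset) auto
  also have "{x \<in> g 2. bracket e x = 0} \<subseteq> span {e}"
  proof
    fix x assume x: "x \<in> {x \<in> g 2. bracket e x = 0}"
    obtain t where t: "t \<in> g 0" "bracket t e = x" using g2_obtain x by blast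
    then obtain k where "t = scale k h" using kernel_e_g2 x by blast
    then have "x = scale (k * 2) e" using t(2) by (simp add: bracket_linear he)
    then show "x \<in> span {e}" by (simp add: span_base span_scale)
  qed
  then have "dim {x \<in> g 2. bracket e x = 0} \<le> 1" using dim_le_card[of _ "{e}"] by simp
  finally show ?thesis by (simp add: dim_g add.commute)
qed

lemma D_2_card: "D 2 = card E"
  using dim_span_eq_card_independent[OF E(2)] E(3) dim_g[of 2] by simp

lemma D_0_iff: "D k = 0 \<longleftrightarrow> g k = {0}"
  using dim_g[of k] pos.dim_eq_0[of "g k"] subspace_0[OF gr_subspace] by auto

lemma D_2_pos: "D 2 \<ge> 1"
  using D_0_iff[of 2] e_g e_neq_0 by (auto simp: Suc_le_eq)

lemma weight_sum_ge: "(\<Sum>j=1..n. 2 * int j * int (D (2 * int j))) \<le> (\<Sum>b | b \<in> Basis \<and> wt b > 0. wt b)"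
proof -
  let ?B = "\<lambda>j. {b \<in> Basis. wt b = 2 * int j}"
  have "(\<Sum>j=1..n. 2 * int j * int (D (2 * int j))) = (\<Sum>j=1..n. \<Sum>b\<in>?B j. wt b)"
    by (simp add: D_def mult.commute)
  also have "\<dots> = (\<Sum>b\<in>(\<Union>j\<in>{1..n}. ?B j). wt b)"
    using Basis(1) by (intro sum.UNION_disjoint[symmetric]) auto
  also have "\<dots> \<le> (\<Sum>b | b \<in> Basis \<and> wt b > 0. wt b)"
    using Basis(1) by (intro sum_mono2) auto
  finally show ?thesis .
qed

lemma D_zero_above:
  assumes "D (2 * int i) = 0" "i \<le> j"
  shows "D (2 * int j) = 0"
  using assms(2,1)
proof (induction j rule: dec_induct)
  case (step n)
  then show ?case using D_antimono[of "2 * int (Suc n)"] by simp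
qed simp

text \<open>Every \<open>D (2 * j)\<close> with \<open>j \<le> M\<close> is positive, which settles \<open>M \<ge> 4\<close>. The first three
  alternatives are the dimension patterns of sl(2), sl(3) and sp(4).\<close>

lemma weight_sum_cases:
  assumes M: "D (2 * int M) \<noteq> 0"
  shows "D 2 = 1 \<or> (D 2 = 2 \<and> D 4 = 1 \<and> D 6 = 0) \<or>
    (D 2 = 2 \<and> D 4 = 1 \<and> D 6 = 1 \<and> D 8 = 0 \<and>
      (\<Sum>b | b \<in> Basis \<and> wt b > 0. wt b) \<ge> 2 * (1 + 2 * int M)) \<or>
    (\<Sum>b | b \<in> Basis \<and> wt b > 0. wt b) > 2 * (1 + 2 * int M)"
proof -
  let ?S = "\<Sum>b | b \<in> Basis \<and> wt b > 0. wt b"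
  have bound: "(\<Sum>j=1..n. 2 * int j * int (D (2 * int j))) \<le> ?S" for n by (rule weight_sum_ge)
  show ?thesis
  proof (cases "M \<ge> 4")
    case True
    have "2 * int j \<le> 2 * int j * int (D (2 * int j))" if "j \<le> M" for j
    proof -
      have "D (2 * int j) \<noteq> 0" using D_zero_above[OF _ that] M by blast
      then have "1 \<le> int (D (2 * int j))" by linarith
      then show ?thesis using mult_left_mono[of 1 "int (D (2 * int j))" "2 * int j"] by simp
    qed
    then have "(\<Sum>j=1..M. 2 * int j) \<le> (\<Sum>j=1..M. 2 * int j * int (D (2 * int j)))"
      by (intro sum_mono) auto
    moreover have "(\<Sum>j=1..M. 2 * int j) = int M * (int M + 1)"
      by (induction M) (simp_all add: algebra_simps)
    ultimately have "int M * (int M + 1) \<le> ?S" using bound[of M] by linarith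
    \<comment> \<open>Here \<open>M \<ge> 4\<close> matters: \<open>M * (M + 1)\<close> exceeds
      \<open>4 * M + 2\<close> from 4 on, but not at 3.\<close>
    moreover have "4 * (int M + 1) \<le> int M * (int M + 1)" using True by (intro mult_right_mono) auto
    moreover have "2 * (1 + 2 * int M) < 4 * (int M + 1)" by simp
    ultimately have "2 * (1 + 2 * int M) < ?S" by (meson less_le_trans)
    then show ?thesis by blast
  next
    case False
    have "(\<Sum>j=1..4. 2 * int j * int (D (2 * int j))) = 2 * int (D 2) + 4 * int (D 4) + 6 * int (D 6) + 8 * int (D 8)"
      by (simp add: numeral_eq_Suc)
    then have S: "2 * int (D 2) + 4 * int (D 4) + 6 * int (D 6) + 8 * int (D 8) \<le> ?S" using bound[of 4] by simp
    have mono: "D 4 \<le> D 2" "D 6 \<le> D 4" "D 8 \<le> D 6"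
      using D_antimono[of 4] D_antimono[of 6] D_antimono[of 8] by simp_all
    have M3: "M \<le> 2 \<or> M = 3 \<and> 1 \<le> D 6" using M False by (cases "M = 3") auto
    have D24: "int (D 2) \<le> int (D 4) + 1" "0 \<le> int (D 6)" "0 \<le> int (D 8)" using D_2_4 by simp_all
    have arith: "2 + 4 * k < s"
      if "2 * a + 4 * b + 6 * c + 8 * d \<le> s" "a \<le> b + 1" "0 \<le> c" "0 \<le> d" "k \<le> 2 \<or> k = 3 \<and> 1 \<le> c"
        "3 \<le> a \<or> (a = 2 \<and> b = 2) \<or> (1 \<le> d \<and> 2 \<le> a \<and> d \<le> c)"
      for a b c d s k :: int
      using that by (elim disjE conjE) linarith+
    have "int M \<le> 2 \<or> int M = 3 \<and> 1 \<le> int (D 6)" using M3 by auto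
    from arith[OF S D24 this]
    have strict: "2 * (1 + 2 * int M) < ?S"
      if "3 \<le> D 2 \<or> (D 2 = 2 \<and> D 4 = 2) \<or> (1 \<le> D 8 \<and> 2 \<le> D 2 \<and> D 8 \<le> D 6)"
      using that by auto
    consider "D 2 = 1" | "D 2 = 2 \<and> D 4 = 1 \<and> D 6 = 0" | "D 2 = 2 \<and> D 4 = 1 \<and> D 6 = 1 \<and> D 8 = 0"
      | "3 \<le> D 2" | "D 2 = 2 \<and> D 4 = 2" | "1 \<le> D 8 \<and> 2 \<le> D 2"
      using mono D_2_4 D_2_pos by linarith
    then show ?thesis
    proof cases
      case 3
      \<comment> \<open>\<open>2 * 2 + 4 * 1 + 6 * 1 = 14\<close> is exactly the threshold
        \<open>2 * (1 + 2 * 3)\<close>.\<close>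
      then have "14 \<le> ?S" using S by simp
      moreover have "int M \<le> 3" using False by simp
      ultimately show ?thesis using 3 by simp
    next
      case 4
      then show ?thesis using strict by simp
    next
      case 5
      then show ?thesis using strict by simp
    next
      case 6
      then show ?thesis using strict mono by simp
    qed blast+
  qed
qed

end

section \<open>The exceptional cases\<close>

lemma matrix_mult_linear:
  fixes X Y Z :: "complex^'n^'n"
  shows "X ** (Y + Z) = X ** Y + X ** Z" "(Y + Z) ** X = Y ** X + Z ** X"
    "X ** (Y - Z) = X ** Y - X ** Z" "(Y - Z) ** X = Y ** X - Z ** X"
  by (simp_all add: matrix_matrix_mult_def vec_eq_iff algebra_simps sum.distrib sum_subtractf)

context graded_principal_sl2
begin

text \<open>The elements on which \<open>\<psi>\<close> respects brackets form a subalgebra by the Jacobi identity,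
  so it suffices to check generators.\<close>

lemma lie_isomorphic_matricesI:
  fixes \<psi> :: "complex^'n^'n \<Rightarrow> 'g" and S G :: "(complex^'n^'n) set"
  assumes \<psi>_add: "\<And>X Y. \<psi> (X + Y) = \<psi> X + \<psi> Y"
    and \<psi>_scale: "\<And>k X. \<psi> (\<chi> i j. k * X $ i $ j) = scale k (\<psi> X)"
    and S_add: "\<And>X Y. X \<in> S \<Longrightarrow> Y \<in> S \<Longrightarrow> X + Y \<in> S"
    and S_scale: "\<And>k X. X \<in> S \<Longrightarrow> (\<chi> i j. k * X $ i $ j) \<in> S"
    and S_bracket: "\<And>X Y. X \<in> S \<Longrightarrow> Y \<in> S \<Longrightarrow> X ** Y - Y ** X \<in> S"
    and G: "G \<subseteq> S" "\<And>X Y. X \<in> G \<Longrightarrow> Y \<in> S \<Longrightarrow> \<psi> (X ** Y - Y ** X) = bracket (\<psi> X) (\<psi> Y)"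
    and inj: "\<And>X. X \<in> S \<Longrightarrow> \<psi> X = 0 \<Longrightarrow> X = 0"
    and gen: "\<And>W. subspace W \<Longrightarrow> \<psi> ` G \<subseteq> W \<Longrightarrow> (\<And>x y. x \<in> W \<Longrightarrow> y \<in> W \<Longrightarrow> bracket x y \<in> W) \<Longrightarrow>
      g 0 \<subseteq> W \<and> e \<in> W \<and> f \<in> W"
    and ne: "S \<noteq> {}"
  shows "lie_isomorphic_matrices S"
proof -
  have minus: "(\<chi> i j. - X $ i $ j) = - X" for X :: "complex^'n^'n"
    by (simp add: vec_eq_iff)
  have \<psi>_minus: "\<psi> (- X) = - \<psi> X" for X using \<psi>_scale[of "- 1" X] by (simp add: minus)
  have \<psi>_diff: "\<psi> (X - Y) = \<psi> X - \<psi> Y" for X Y using \<psi>_add[of X "- Y"] by (simp add: \<psi>_minus)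
  have S_minus: "- X \<in> S" if "X \<in> S" for X using S_scale[OF that, of "- 1"] by (simp add: minus)
  have S_diff: "X - Y \<in> S" if "X \<in> S" "Y \<in> S" for X Y using S_add[OF that(1) S_minus[OF that(2)]] by simp
  have mult_scale: "(\<chi> i j. k * X $ i $ j) ** Y - Y ** (\<chi> i j. k * X $ i $ j) = (\<chi> i j. k * (X ** Y - Y ** X) $ i $ j)"
    for k and X Y :: "complex^'n^'n"
    by (simp add: matrix_matrix_mult_def vec_eq_iff sum_distrib_left algebra_simps)
  \<comment> \<open>\<open>Y\<close> ranges over all of \<open>S\<close>, not just over
    \<open>T\<close>; this is what lets the Jacobi identity show that \<open>T\<close> is closed
    under commutators.\<close>
  define T where "T = {X \<in> S. \<forall>Y\<in>S. \<psi> (X ** Y - Y ** X) = bracket (\<psi> X) (\<psi> Y)}"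
  have TS: "T \<subseteq> S" by (auto simp: T_def)
  have T_hom: "\<psi> (X ** Y - Y ** X) = bracket (\<psi> X) (\<psi> Y)" if "X \<in> T" "Y \<in> S" for X Y
    using that by (simp add: T_def)
  have T_add: "X + X' \<in> T" if X: "X \<in> T" "X' \<in> T" for X X'
  proof -
    have "\<psi> ((X + X') ** Y - Y ** (X + X')) = bracket (\<psi> (X + X')) (\<psi> Y)" if "Y \<in> S" for Y
    proof -
      have "(X + X') ** Y - Y ** (X + X') = (X ** Y - Y ** X) + (X' ** Y - Y ** X')"
        by (simp add: matrix_mult_linear)
      then show ?thesis using X that by (simp add: \<psi>_add T_hom bracket_linear)
    qed
    then show ?thesis using X TS S_add by (auto simp: T_def)
  qed
  have T_scale: "(\<chi> i j. k * X $ i $ j) \<in> T" if X: "X \<in> T" for k X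
  proof -
    have "\<psi> ((\<chi> i j. k * X $ i $ j) ** Y - Y ** (\<chi> i j. k * X $ i $ j)) = bracket (\<psi> (\<chi> i j. k * X $ i $ j)) (\<psi> Y)"
      if "Y \<in> S" for Y
      unfolding mult_scale \<psi>_scale using X that by (simp add: T_hom bracket_linear)
    then show ?thesis using X TS S_scale by (auto simp: T_def)
  qed
  have T_bracket: "X ** X' - X' ** X \<in> T" if X: "X \<in> T" "X' \<in> T" for X X'
  proof -
    have SX: "X \<in> S" "X' \<in> S" using X TS by auto
    have "\<psi> ((X ** X' - X' ** X) ** Y - Y ** (X ** X' - X' ** X)) = bracket (\<psi> (X ** X' - X' ** X)) (\<psi> Y)"
      if Y: "Y \<in> S" for Y
    proof -
      have "(X ** X' - X' ** X) ** Y - Y ** (X ** X' - X' ** X)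
          = (X ** (X' ** Y - Y ** X') - (X' ** Y - Y ** X') ** X) - (X' ** (X ** Y - Y ** X) - (X ** Y - Y ** X) ** X')"
        by (simp add: matrix_mult_linear matrix_mul_assoc)
      then have "\<psi> ((X ** X' - X' ** X) ** Y - Y ** (X ** X' - X' ** X))
          = bracket (\<psi> X) (bracket (\<psi> X') (\<psi> Y)) - bracket (\<psi> X') (bracket (\<psi> X) (\<psi> Y))"
        using X SX Y by (simp only: \<psi>_diff[of "X ** (X' ** Y - Y ** X') - (X' ** Y - Y ** X') ** X"] T_hom S_bracket)
      also have "\<dots> = bracket (bracket (\<psi> X) (\<psi> X')) (\<psi> Y)"
        using bracket_bracket[of "\<psi> X" "\<psi> X'" "\<psi> Y"] by simp
      finally show ?thesis using X SX by (simp only: T_hom)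
    qed
    then show ?thesis using S_bracket[OF SX] by (simp add: T_def)
  qed
  have GT: "G \<subseteq> T" using G by (auto simp: T_def)
  obtain X0 where "X0 \<in> S" using ne by blast
  then have "0 \<in> S" using S_diff[of X0 X0] by simp
  then have T0: "0 \<in> T" using \<psi>_diff[of 0 0] by (auto simp: T_def matrix_matrix_mult_def vec_eq_iff zero_vec_def)
  have W: "subspace (\<psi> ` T)"
  proof (rule lie_subspaceI)
    show "0 \<in> \<psi> ` T" using T0 \<psi>_diff[of 0 0] by (auto intro!: image_eqI[of _ _ 0])
    show "x + y \<in> \<psi> ` T" if "x \<in> \<psi> ` T" "y \<in> \<psi> ` T" for x y
      using that T_add by (auto simp flip: \<psi>_add)
    show "scale k x \<in> \<psi> ` T" if "x \<in> \<psi> ` T" for k x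
      using that T_scale by (auto simp flip: \<psi>_scale)
  qed
  have Walg: "bracket x y \<in> \<psi> ` T" if xy: "x \<in> \<psi> ` T" "y \<in> \<psi> ` T" for x y
  proof -
    obtain X Y where "X \<in> T" "Y \<in> T" "x = \<psi> X" "y = \<psi> Y" using xy by blast
    then show ?thesis using T_bracket[of X Y] T_hom[of X Y] TS by (auto intro!: image_eqI[of _ _ "X ** Y - Y ** X"])
  qed
  have "g 0 \<subseteq> \<psi> ` T \<and> e \<in> \<psi> ` T \<and> f \<in> \<psi> ` T"
    using GT by (intro gen W Walg) auto
  then have surj: "\<psi> ` T = UNIV"
    using Walg by (intro generated_UNIV[OF W]) auto
  have inj_S: "inj_on \<psi> S"
  proof (rule inj_onI)
    fix X Y assume "X \<in> S" "Y \<in> S" "\<psi> X = \<psi> Y"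
    then show "X = Y" using inj[OF S_diff, of X Y] by (simp add: \<psi>_diff)
  qed
  \<comment> \<open>\<open>T\<close> already maps onto the whole algebra, and \<open>\<psi>\<close>
    is injective on the larger set \<open>S\<close>.\<close>
  have "T = S"
  proof
    show "S \<subseteq> T"
    proof
      fix X assume X: "X \<in> S"
      then obtain Y where "Y \<in> T" "\<psi> X = \<psi> Y" using surj by (metis UNIV_I imageE)
      then show "X \<in> T" using X TS inj_S by (metis inj_onD subsetD)
    qed
  qed (rule TS)
  then have bij: "bij_betw \<psi> S UNIV" using inj_S surj by (simp add: bij_betw_def)
  define \<phi> where "\<phi> = inv_into S \<psi>"
  have \<phi>_bij: "bij_betw \<phi> UNIV S" unfolding \<phi>_def by (rule bij_betw_inv_into[OF bij])
  have \<phi>S: "\<phi> x \<in> S" for x using \<phi>_bij by (auto simp: bij_betw_def)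
  have \<psi>\<phi>: "\<psi> (\<phi> x) = x" for x unfolding \<phi>_def using bij by (simp add: bij_betw_inv_into_right)
  have eqI: "\<phi> x = X" if "X \<in> S" "\<psi> X = x" for x X
    using that \<psi>\<phi>[of x] \<phi>S[of x] inj_S by (metis inj_onD)
  have "\<phi> (x + y) = \<phi> x + \<phi> y" for x y
    by (rule eqI) (simp_all add: S_add \<phi>S \<psi>_add \<psi>\<phi>)
  moreover have "\<phi> (scale k x) = (\<chi> i j. k * \<phi> x $ i $ j)" for k x
    by (rule eqI) (simp_all add: S_scale \<phi>S \<psi>_scale \<psi>\<phi>)
  moreover have "\<phi> (bracket x y) = \<phi> x ** \<phi> y - \<phi> y ** \<phi> x" for x y
    using T_hom \<open>T = S\<close> by (intro eqI) (simp_all add: S_bracket \<phi>S \<psi>\<phi>)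
  ultimately show ?thesis using \<phi>_bij by (auto simp: lie_isomorphic_matrices_def)
qed

end

lemma trace_commutator: "trace (X ** Y - Y ** X) = (0 :: complex)" for X Y :: "complex^'n^'n"
  using trace_mul_sym[of X Y] by (simp add: trace_sub)

lemma sl_closed:
  fixes X Y :: "complex^'n^'n"
  shows "X \<in> sl \<Longrightarrow> Y \<in> sl \<Longrightarrow> X + Y \<in> sl"
    and "X \<in> sl \<Longrightarrow> (\<chi> i j. k * X $ i $ j) \<in> sl"
    and "X ** Y - Y ** X \<in> sl"
  by (simp_all add: sl_def trace_add trace_commutator) (simp add: trace_def flip: sum_distrib_left)

lemma sl_nonempty: "(sl :: (complex^'n^'n) set) \<noteq> {}"
  unfolding sl_def by (auto intro!: exI[of _ 0] simp: trace_def)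

context simple_root_basis
begin

lemmas comp_simps = pos.lin_add[OF comp_lin] pos.lin_diff[OF comp_lin] pos.lin_scale[OF comp_lin]

definition unit_mat :: "'n \<Rightarrow> 'n \<Rightarrow> complex^'n^'n" where
  "unit_mat a b = (\<chi> i j. if i = a \<and> j = b then 1 else 0)"

lemma sl2_case:
  assumes "D 2 = 1"
  shows "lie_isomorphic_matrices (sl :: (complex^2^2) set)"
proof -
  have "card E = 1" using assms D_2_card by simp
  then obtain u where "E = {u}" by (auto simp: card_1_singleton_iff)
  then have Ee: "E = {e}" using E(4) by simp
  have g0: "t = scale (w e t / 2) h" if "t \<in> g 0" for t
  proof -
    have "t = scale (w e t) (eps e)" "h = scale (w e h) (eps e)"
      using bracket_g0_E(2)[of e, OF _ that] bracket_g0_E(2)[of e, OF _ h_g] Ee by simp_all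
    then show ?thesis using w_h[of e] Ee by (metis insertI1 nonzero_eq_divide_eq scale_scale zero_neq_numeral)
  qed
  have eh: "bracket e h = - scale 2 e" and fh: "bracket f h = scale 2 f" and fe: "bracket f e = - h"
    using he hf ef bracket_anti[of e h] bracket_anti[of f h] bracket_anti[of f e] by simp_all
  have f0: "f \<noteq> 0" and h0: "h \<noteq> 0"
    using he ef e_neq_0 by auto
  let ?\<psi> = "\<lambda>X :: complex^2^2. scale (X $ 1 $ 2) e + scale (X $ 2 $ 1) f + scale (X $ 1 $ 1) h"
  show ?thesis
  proof (rule lie_isomorphic_matricesI[where \<psi> = ?\<psi> and G = "{unit_mat 1 2, unit_mat 2 1}"])
    show "{unit_mat 1 2, unit_mat 2 1} \<subseteq> (sl :: (complex^2^2) set)"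
      by (simp add: sl_def trace_def unit_mat_def sum_2)
    show "?\<psi> (X ** Y - Y ** X) = bracket (?\<psi> X) (?\<psi> Y)"
      if "X \<in> {unit_mat 1 2, unit_mat 2 1}" "Y \<in> sl" for X Y :: "complex^2^2"
    proof -
      have Y22: "Y $ 2 $ 2 = - Y $ 1 $ 1"
        using that(2) by (simp add: sl_def trace_def sum_2 eq_neg_iff_add_eq_0 add.commute)
      show ?thesis using that(1)
        by (auto simp: matrix_matrix_mult_def unit_mat_def sum_2 Y22 bracket_linear bracket_self ef fe eh fh)
    qed
    show "X = 0" if X: "X \<in> sl" "?\<psi> X = 0" for X :: "complex^2^2"
    proof -
      have "comp k (?\<psi> X) = 0" for k by (simp only: X(2) pos.lin_0[OF comp_lin])
      from this[of 2] this[of "- 2"] this[of 0]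
      have "X $ 1 $ 2 = 0" "X $ 2 $ 1 = 0" "X $ 1 $ 1 = 0"
        using e_neq_0 f0 h0
        by (simp_all add: comp_simps comp_on_g[OF e_g] comp_on_g[OF f_g] comp_on_g[OF h_g])
      moreover have "X $ 2 $ 2 = - X $ 1 $ 1"
        using X(1) by (simp add: sl_def trace_def sum_2 eq_neg_iff_add_eq_0 add.commute)
      ultimately show ?thesis by (simp add: vec_eq_iff forall_2)
    qed
    show "g 0 \<subseteq> W \<and> e \<in> W \<and> f \<in> W"
      if W: "subspace W" "?\<psi> ` {unit_mat 1 2, unit_mat 2 1} \<subseteq> W" "\<And>x y. x \<in> W \<Longrightarrow> y \<in> W \<Longrightarrow> bracket x y \<in> W" for W
    proof -
      have ef_W: "e \<in> W" "f \<in> W" using W(2) by (simp_all add: unit_mat_def)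
      then have "h \<in> W" using W(3)[of e f] ef by simp
      then show ?thesis using g0 subspace_scale[OF W(1)] ef_W by (metis subsetI)
    qed
  qed (simp_all add: sl_closed sl_nonempty scale_left_distrib scale_right_distrib)
qed

section \<open>Root strings and Lie algebras of rank two\<close>

lemma bracket_kv:
  assumes "u \<in> E" "v \<in> E"
  shows "bracket (kv u) v = scale (w v (kv u)) v" "bracket (kv u) (fv v) = scale (- w v (kv u)) (fv v)"
  using assms kv_g bracket_g0_E(1) bracket_g0_fv by blast+

text \<open>\<open>kv u\<close> is an unnormalized coroot, so \<open>w u (kv u)\<close> stands where
  the usual string formulas have 2. Where a string ends, the coefficient must vanish, and this
  becomes a linear relation for the Cartan numbers.\<close>

lemma fv_string:
  assumes uv: "u \<in> E" "v \<in> E" "u \<noteq> v"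
  shows "bracket (fv u) (bracket u v) = scale (- w v (kv u)) v"
    and "bracket (fv u) (bracket u (bracket u v)) = scale (- (w u (kv u) + 2 * w v (kv u))) (bracket u v)"
    and "bracket (fv u) (bracket u (bracket u (bracket u v)))
      = scale (- 3 * (w u (kv u) + w v (kv u))) (bracket u (bracket u v))"
proof -
  have fu: "bracket (fv u) (bracket u x) = - bracket (kv u) x + bracket u (bracket (fv u) x)" for x
    using uv by (simp add: bracket_bracket[of "fv u" u x] bracket_fv_E bracket_linear)
  have ku: "bracket (kv u) (bracket u x) = scale (w u (kv u)) (bracket u x) + bracket u (bracket (kv u) x)" for x
    using uv by (simp add: bracket_bracket[of "kv u" u x] bracket_kv bracket_linear)
  show 1: "bracket (fv u) (bracket u v) = scale (- w v (kv u)) v"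
    unfolding fu using uv by (simp add: bracket_fv_E bracket_kv)
  show 2: "bracket (fv u) (bracket u (bracket u v)) = scale (- (w u (kv u) + 2 * w v (kv u))) (bracket u v)"
    unfolding fu[of "bracket u v"] 1 ku using uv
    by (simp add: bracket_kv bracket_linear flip: scale_left_distrib scale_minus_left scale_left_diff_distrib)
  show "bracket (fv u) (bracket u (bracket u (bracket u v)))
      = scale (- 3 * (w u (kv u) + w v (kv u))) (bracket u (bracket u v))"
    unfolding fu[of "bracket u (bracket u v)"] 2 ku using uv
    by (simp add: bracket_kv bracket_linear algebra_simps flip: scale_left_distrib scale_minus_left scale_left_diff_distrib)
qed

text \<open>The mirror computation. The relations found from the positive strings make the relevant
  coefficients vanish here, which gives the negative Serre relations by injectivity of
  \<open>bracket e\<close>.\<close>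

lemma E_string:
  assumes uv: "u \<in> E" "v \<in> E" "u \<noteq> v"
  shows "bracket u (bracket (fv u) (fv v)) = scale (- w v (kv u)) (fv v)"
    and "bracket v (bracket (fv u) (fv v)) = scale (w u (kv v)) (fv u)"
    and "bracket u (bracket (fv u) (bracket (fv u) (fv v))) = scale (- (w u (kv u) + 2 * w v (kv u))) (bracket (fv u) (fv v))"
    and "bracket v (bracket (fv u) (bracket (fv u) (fv v))) = 0"
    and "bracket u (bracket (fv u) (bracket (fv u) (bracket (fv u) (fv v))))
      = scale (- 3 * (w u (kv u) + w v (kv u))) (bracket (fv u) (bracket (fv u) (fv v)))"
    and "bracket v (bracket (fv u) (bracket (fv u) (bracket (fv u) (fv v)))) = 0"
proof -
  have fu: "bracket u (bracket (fv u) x) = bracket (kv u) x + bracket (fv u) (bracket u x)" for x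
    using uv by (simp add: bracket_bracket[of u "fv u" x] bracket_E_fv)
  have ku: "bracket (kv u) (bracket (fv u) x) = - scale (w u (kv u)) (bracket (fv u) x) + bracket (fv u) (bracket (kv u) x)" for x
    using uv by (simp add: bracket_bracket[of "kv u" "fv u" x] bracket_kv bracket_linear)
  have vu: "bracket v (bracket (fv u) x) = bracket (fv u) (bracket v x)" for x
    using uv by (simp add: bracket_bracket[of v "fv u" x] bracket_E_fv)
  show 1: "bracket u (bracket (fv u) (fv v)) = scale (- w v (kv u)) (fv v)"
    unfolding fu using uv by (simp add: bracket_E_fv bracket_kv)
  show v1: "bracket v (bracket (fv u) (fv v)) = scale (w u (kv v)) (fv u)"
    unfolding vu using uv bracket_anti[of "fv u" "kv v"] by (simp add: bracket_E_fv bracket_kv)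
  show 2: "bracket u (bracket (fv u) (bracket (fv u) (fv v))) = scale (- (w u (kv u) + 2 * w v (kv u))) (bracket (fv u) (fv v))"
    unfolding fu[of "bracket (fv u) (fv v)"] 1 ku using uv
    by (simp add: bracket_kv bracket_linear flip: scale_left_distrib scale_minus_left scale_left_diff_distrib)
  show v2: "bracket v (bracket (fv u) (bracket (fv u) (fv v))) = 0"
    unfolding vu[of "bracket (fv u) (fv v)"] v1 by (simp add: bracket_linear bracket_self)
  show "bracket u (bracket (fv u) (bracket (fv u) (bracket (fv u) (fv v))))
      = scale (- 3 * (w u (kv u) + w v (kv u))) (bracket (fv u) (bracket (fv u) (fv v)))"
    unfolding fu[of "bracket (fv u) (bracket (fv u) (fv v))"] 2 ku using uv
    by (simp add: bracket_kv bracket_linear algebra_simps flip: scale_left_distrib scale_minus_left scale_left_diff_distrib)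
  show "bracket v (bracket (fv u) (bracket (fv u) (bracket (fv u) (fv v)))) = 0"
    unfolding vu[of "bracket (fv u) (bracket (fv u) (fv v))"] v2 by simp
qed

end

locale rank_two = simple_root_basis scale bracket e f h Basis wt E eps
  for scale :: "complex \<Rightarrow> 'g::ab_group_add \<Rightarrow> 'g" and bracket :: "'g \<Rightarrow> 'g \<Rightarrow> 'g" and e f h Basis wt E eps +
  fixes e1 e2 :: 'g
  assumes E_eq: "E = {e1, e2}" and e1_e2: "e1 \<noteq> e2"
begin

lemma in_E [simp]: "e1 \<in> E" "e2 \<in> E"
  by (simp_all add: E_eq)

lemma e_sum: "e = e1 + e2" and f_sum: "f = fv e1 + fv e2"
  using E(4) sum_fv e1_e2 by (simp_all add: E_eq)

lemma cartan_sums: "w v (kv e1) + w v (kv e2) = 2" if "v \<in> E"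
proof -
  have "w v (kv e1 + kv e2) = 2" using sum_kv e1_e2 w_h[OF that] by (simp add: E_eq)
  then show ?thesis using w_dual[OF that] kv_g by (simp add: dual_def)
qed

lemma e_injI: "x \<in> g k \<Longrightarrow> k < 0 \<Longrightarrow> bracket e1 x = 0 \<Longrightarrow> bracket e2 x = 0 \<Longrightarrow> x = 0"
  using e_inj_neg[of x k] by (simp add: e_sum bracket_linear)

lemma bracket_E_g4: "bracket e1 e2 \<in> g 4"
  using gr_bracket[OF E_g E_g, of e1 e2] by simp

text \<open>\<open>g 4\<close> is the image of \<open>g 2\<close> under \<open>bracket e\<close>,
  and \<open>g 2\<close> is spanned by \<open>e1\<close> and \<open>e2\<close>.\<close>

lemma g4_zero:
  assumes "bracket e1 e2 = 0"
  shows "D 4 = 0"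
proof -
  have "x = 0" if "x \<in> g 4" for x
  proof -
    from that obtain y where y: "y \<in> g 2" "x = bracket e y" by (rule e_surj) auto
    then have "y \<in> span {e1, e2}" using E(3) E_eq by simp
    then obtain a b where "y = scale a e1 + scale b e2"
      by (auto simp: span_breakdown_eq span_singleton) (metis diff_add_cancel add.commute)
    then show ?thesis
      using assms bracket_anti[of e2 e1] y by (simp add: e_sum bracket_linear bracket_self)
  qed
  then show ?thesis using D_0_iff subspace_0[OF gr_subspace] by blast
qed

end

text \<open>Here \<open>c1\<close> and \<open>c2\<close> are the coefficients of \<open>h\<close> in the simple coroots, so that \<open>kv e1\<close> is
  \<open>c1\<close> times the coroot, and \<open>- p\<close>, \<open>- q\<close> are the off-diagonal Cartan integers.\<close>

locale chevalley_rank_two = rank_two scale bracket e f h Basis wt E eps e1 e2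
  for scale :: "complex \<Rightarrow> 'g::ab_group_add \<Rightarrow> 'g" and bracket :: "'g \<Rightarrow> 'g \<Rightarrow> 'g"
    and e f h Basis wt E eps e1 e2 +
  fixes c1 c2 p q :: complex
  assumes c: "c1 \<noteq> 0" "c2 \<noteq> 0" "p * q \<noteq> 4"
    and cartan: "w e1 (kv e1) = 2 * c1" "w e2 (kv e1) = - p * c1" "w e1 (kv e2) = - q * c2" "w e2 (kv e2) = 2 * c2"
begin

definition "F1 = scale (1 / c1) (fv e1)"
definition "F2 = scale (1 / c2) (fv e2)"
definition "h1 = scale (1 / c1) (kv e1)"
definition "h2 = scale (1 / c2) (kv e2)"

lemma hg: "h1 \<in> g 0" "h2 \<in> g 0" and Fg: "F1 \<in> g (- 2)" "F2 \<in> g (- 2)"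
  by (simp_all add: h1_def h2_def F1_def F2_def subspace_scale[OF gr_subspace] kv_g fv_g)

lemma F_nonzero: "F1 \<noteq> 0" "F2 \<noteq> 0"
proof -
  have "fv v \<noteq> 0" if "v \<in> E" for v
  proof
    assume "fv v = 0"
    then have "bracket v f = 0" using bracket_e_fv[OF that] by (simp add: kv_def)
    then have "bracket f v = 0" using bracket_anti[of f v] by simp
    then show False using f_inj_pos[OF E_g[OF that]] E_nonzero[OF that] by simp
  qed
  then show "F1 \<noteq> 0" "F2 \<noteq> 0" using c by (simp_all add: F1_def F2_def)
qed

lemma chevalley_e:
  "bracket e1 F1 = h1" "bracket e2 F2 = h2" "bracket e1 F2 = 0" "bracket e2 F1 = 0"
  "bracket F1 e1 = - h1" "bracket F2 e2 = - h2" "bracket F1 e2 = 0" "bracket F2 e1 = 0"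
  using e1_e2 by (simp_all add: F1_def F2_def h1_def h2_def bracket_linear bracket_E_fv bracket_fv_E)

lemma scale_two: "scale 2 x = x + x"
  using scale_left_distrib[of 1 1 x] by simp

lemma chevalley_h:
  "bracket h1 e1 = e1 + e1" "bracket h1 e2 = - scale p e2" "bracket h2 e1 = - scale q e1" "bracket h2 e2 = e2 + e2"
  "bracket h1 F1 = - (F1 + F1)" "bracket h1 F2 = scale p F2" "bracket h2 F1 = scale q F1" "bracket h2 F2 = - (F2 + F2)"
  "bracket e1 h1 = - (e1 + e1)" "bracket e2 h1 = scale p e2" "bracket e1 h2 = scale q e1" "bracket e2 h2 = - (e2 + e2)"
  "bracket F1 h1 = F1 + F1" "bracket F2 h1 = - scale p F2" "bracket F1 h2 = - scale q F1" "bracket F2 h2 = F2 + F2"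
proof -
  show 1: "bracket h1 e1 = e1 + e1" "bracket h1 e2 = - scale p e2" "bracket h2 e1 = - scale q e1" "bracket h2 e2 = e2 + e2"
  "bracket h1 F1 = - (F1 + F1)" "bracket h1 F2 = scale p F2" "bracket h2 F1 = scale q F1" "bracket h2 F2 = - (F2 + F2)"
    using c by (simp_all add: F1_def F2_def h1_def h2_def bracket_linear bracket_kv cartan scale_two
        scale_right_distrib scale_right_diff_distrib)
  show "bracket e1 h1 = - (e1 + e1)" "bracket e2 h1 = scale p e2" "bracket e1 h2 = scale q e1" "bracket e2 h2 = - (e2 + e2)"
  "bracket F1 h1 = F1 + F1" "bracket F2 h1 = - scale p F2" "bracket F1 h2 = - scale q F1" "bracket F2 h2 = F2 + F2"
    using 1 bracket_anti[of _ h1] bracket_anti[of _ h2] by simp_all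
qed

text \<open>The determinant \<open>4 - p * q\<close> of the Cartan matrix is nonzero, so Cramer's
  rule gives a combination of \<open>h1\<close> and \<open>h2\<close> acting on \<open>e\<close> as
  a given \<open>t\<close> in \<open>g 0\<close> does; that action determines
  \<open>t\<close>.\<close>

lemma generates:
  assumes W: "subspace W" "e1 \<in> W" "e2 \<in> W" "F1 \<in> W" "F2 \<in> W"
    and alg: "\<And>x y. x \<in> W \<Longrightarrow> y \<in> W \<Longrightarrow> bracket x y \<in> W"
  shows "g 0 \<subseteq> W \<and> e \<in> W \<and> f \<in> W"
proof -
  have hW: "h1 \<in> W" "h2 \<in> W" using alg W chevalley_e by metis+
  have "fv e1 = scale c1 F1" "fv e2 = scale c2 F2" using c by (simp_all add: F1_def F2_def)
  then have "fv e1 + fv e2 \<in> W" using W by (simp add: subspace_add subspace_scale)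
  then have "f \<in> W" by (simp only: f_sum[symmetric])
  moreover have "e \<in> W" unfolding e_sum by (rule subspace_add[OF W(1-3)])
  moreover have "t \<in> W" if t: "t \<in> g 0" for t
  proof -
    define a b where "a = w e1 t" and "b = w e2 t"
    define x y where "x = (2 * a + q * b) / (4 - p * q)" and "y = (p * a + 2 * b) / (4 - p * q)"
    have det: "4 - p * q \<noteq> 0" using c(3) by simp
    have xy: "2 * x - q * y = a" "2 * y - p * x = b"
      using det unfolding x_def y_def by (simp_all add: divide_simps) (simp_all add: algebra_simps)
    let ?s = "scale x h1 + scale y h2"
    have sg: "?s \<in> g 0" by (intro subspace_add subspace_scale gr_subspace hg)
    have "bracket ?s e = scale (2 * x - q * y) e1 + scale (2 * y - p * x) e2"
      by (simp add: e_sum bracket_linear chevalley_h scale_left_diff_distrib scale_right_distrib mult.commute)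
        (simp add: scale_two algebra_simps flip: scale_scale)
    moreover have "bracket t e = scale a e1 + scale b e2"
      using t by (simp add: e_sum bracket_linear bracket_g0_E(1) a_def b_def)
    ultimately have "bracket (t - ?s) e = 0" by (simp add: xy bracket_diff_left)
    then have "bracket e (t - ?s) = 0" by (subst bracket_anti) simp
    then have "t - ?s = 0" by (rule e_inj_0[OF subspace_diff[OF gr_subspace t sg]])
    then show "t \<in> W" using hW W(1) by (simp add: subspace_add subspace_scale)
  qed
  ultimately show ?thesis by blast
qed

lemma h_independent:
  assumes "scale x h1 + scale y h2 = 0"
  shows "x = 0 \<and> y = 0"
proof -
  have "bracket (scale x h1 + scale y h2) e1 = scale (2 * x - q * y) e1"
    "bracket (scale x h1 + scale y h2) e2 = scale (2 * y - p * x) e2"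
    by (simp_all add: bracket_linear chevalley_h scale_left_diff_distrib scale_right_distrib mult.commute)
      (simp_all add: scale_two scale_right_distrib flip: scale_scale)
  then have "2 * x = q * y" "2 * y = p * x" using assms E_nonzero by simp_all
  then have "(4 - p * q) * x = 0" "(4 - p * q) * y = 0" by algebra+
  then show "x = 0 \<and> y = 0" using c(3) by simp
qed

lemma e_independent: "scale x e1 + scale y e2 = 0 \<Longrightarrow> x = 0 \<and> y = 0"
  and F_independent: "scale x F1 + scale y F2 = 0 \<Longrightarrow> x = 0 \<and> y = 0"
proof -
  assume 0: "scale x e1 + scale y e2 = 0"
  have "bracket (eps e1) (scale x e1 + scale y e2) = scale x e1" "bracket (eps e2) (scale x e1 + scale y e2) = scale y e2"
    using e1_e2 by (simp_all add: bracket_linear eps_E)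
  then show "x = 0 \<and> y = 0" using 0 E_nonzero by simp
next
  assume 0: "scale x F1 + scale y F2 = 0"
  have "bracket (eps e1) (scale x F1 + scale y F2) = - scale x F1" "bracket (eps e2) (scale x F1 + scale y F2) = - scale y F2"
    using e1_e2 by (simp_all add: F1_def F2_def bracket_linear bracket_eps_fv)
  then show "x = 0 \<and> y = 0" using 0 F_nonzero by simp
qed

end

lemma sum_UNIV_2_2: "(\<Sum>i\<in>UNIV. F i) = F (Inl 1) + F (Inl 2) + F (Inr 1) + F (Inr (2 :: 2))"
  for F :: "2 + 2 \<Rightarrow> complex"
proof -
  have "(\<Sum>i\<in>UNIV. F i) = (\<Sum>i\<in>UNIV <+> UNIV. F i)" by simp
  also have "\<dots> = (\<Sum>i\<in>UNIV. F (Inl i)) + (\<Sum>i\<in>UNIV. F (Inr i))"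
    by (subst sum.Plus) (simp_all add: o_def)
  finally show ?thesis by (simp add: sum_2 add.assoc)
qed

lemma all_2_2: "(\<forall>i :: 2 + 2. P i) \<longleftrightarrow> P (Inl 1) \<and> P (Inl 2) \<and> P (Inr 1) \<and> P (Inr 2)"
  by (simp add: split_sum_all forall_2)

text \<open>The block description: the lower right block is minus the transpose of the upper left
  one, and the other two blocks are symmetric.\<close>

lemma sp_iff:
  fixes X :: "complex^(2+2)^(2+2)"
  shows "X \<in> sp \<longleftrightarrow>
    X $ Inr 1 $ Inr 1 = - X $ Inl 1 $ Inl 1 \<and> X $ Inr 1 $ Inr 2 = - X $ Inl 2 $ Inl 1 \<and>
    X $ Inr 2 $ Inr 1 = - X $ Inl 1 $ Inl 2 \<and> X $ Inr 2 $ Inr 2 = - X $ Inl 2 $ Inl 2 \<and>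
    X $ Inl 2 $ Inr 1 = X $ Inl 1 $ Inr 2 \<and> X $ Inr 2 $ Inl 1 = X $ Inr 1 $ Inl 2"
  unfolding sp_def
  by (auto simp: vec_eq_iff all_2_2 matrix_matrix_mult_def sum_UNIV_2_2 transpose_def symplectic_form_def
      eq_neg_iff_add_eq_0 add.commute) (metis add.commute minus_unique)+

lemma sp_closed:
  fixes X Y :: "complex^(2+2)^(2+2)"
  shows "X \<in> sp \<Longrightarrow> Y \<in> sp \<Longrightarrow> X + Y \<in> sp"
    and "X \<in> sp \<Longrightarrow> (\<chi> i j. k * X $ i $ j) \<in> sp"
    and "X \<in> sp \<Longrightarrow> Y \<in> sp \<Longrightarrow> X ** Y - Y ** X \<in> sp"
  by (simp_all add: sp_iff matrix_matrix_mult_def sum_UNIV_2_2 algebra_simps)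

lemma sp_nonempty: "(sp :: (complex^(2+2)^(2+2)) set) \<noteq> {}"
proof -
  have "0 \<in> (sp :: (complex^(2+2)^(2+2)) set)" by (simp add: sp_iff)
  then show ?thesis by blast
qed

lemma (in complex_lie_algebra) scale_double: "scale (2 * x) y = scale x y + scale x y" "scale (x * 2) y = scale x y + scale x y"
  by (simp_all only: mult_2 mult_2_right scale_left_distrib)

section \<open>Reconstruction of sl(3) from its Serre relations\<close>

locale sl3_generators = chevalley_rank_two scale bracket e f h Basis wt E eps e1 e2 c1 c2 1 1
  for scale :: "complex \<Rightarrow> 'g::ab_group_add \<Rightarrow> 'g" and bracket :: "'g \<Rightarrow> 'g \<Rightarrow> 'g"
    and e f h Basis wt E eps e1 e2 c1 c2 +
  assumes e_e: "bracket e1 (bracket e1 e2) = 0" "bracket e2 (bracket e1 e2) = 0"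
    and F_F: "bracket F1 (bracket F2 F1) = 0" "bracket F2 (bracket F2 F1) = 0"
begin

definition "z = bracket e1 e2"
text \<open>The order of the factors makes \<open>z'\<close> correspond to the matrix unit at (3,
  1), the product of those at (3, 2) and (2, 1).\<close>

definition "z' = bracket F2 F1"

lemma table:
  "bracket e1 e1 = 0" "bracket e1 e2 = z" "bracket e1 z = 0" "bracket e1 z' = - F2"
  "bracket e2 e2 = 0" "bracket e2 e1 = - z" "bracket e2 z = 0" "bracket e2 z' = F1"
  "bracket F1 F1 = 0" "bracket F1 F2 = - z'" "bracket F1 z' = 0" "bracket F1 z = e2"
  "bracket F2 F2 = 0" "bracket F2 F1 = z'" "bracket F2 z' = 0" "bracket F2 z = - e1"
  using e_e F_F bracket_anti[of e2 e1] bracket_anti[of F1 F2]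
  by (simp_all add: z_def z'_def bracket_self chevalley_e chevalley_h bracket_linear
      bracket_bracket[of e1 F2] bracket_bracket[of e2 F2] bracket_bracket[of F1 e1] bracket_bracket[of F2 e1])

text \<open>A traceless diagonal matrix is its first entry times the first coroot plus the sum of
  its first two entries times the second, whence the last coefficient.\<close>

definition \<psi> :: "complex^3^3 \<Rightarrow> 'g" where
  "\<psi> X = scale (X $ 1 $ 2) e1 + scale (X $ 2 $ 3) e2 + scale (X $ 1 $ 3) z +
    scale (X $ 2 $ 1) F1 + scale (X $ 3 $ 2) F2 + scale (X $ 3 $ 1) z' +
    scale (X $ 1 $ 1) h1 + scale (X $ 1 $ 1 + X $ 2 $ 2) h2"

lemma z_g: "z \<in> g 4" "z' \<in> g (- 4)"
  using gr_bracket[OF E_g E_g, of e1 e2] gr_bracket[OF Fg(2,1)] by (simp_all add: z_def z'_def)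

lemma z_nonzero: "z \<noteq> 0" "z' \<noteq> 0"
  using table(12,8) E_nonzero[of e2] F_nonzero by auto

lemma \<psi>_inj:
  assumes "X \<in> sl" "\<psi> X = 0"
  shows "X = 0"
proof -
  have 0: "comp k (\<psi> X) = 0" for k by (simp only: assms(2) pos.lin_0[OF comp_lin])
  note c = comp_simps comp_on_g[OF E_g] comp_on_g[OF z_g(1)] comp_on_g[OF z_g(2)] comp_on_g[OF Fg(1)]
    comp_on_g[OF Fg(2)] comp_on_g[OF hg(1)] comp_on_g[OF hg(2)]
  have "scale (X $ 1 $ 2) e1 + scale (X $ 2 $ 3) e2 = 0"
    using 0[of 2] by (simp add: \<psi>_def c)
  moreover have "scale (X $ 2 $ 1) F1 + scale (X $ 3 $ 2) F2 = 0"
    using 0[of "- 2"] by (simp add: \<psi>_def c)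
  moreover have "scale (X $ 1 $ 1) h1 + scale (X $ 1 $ 1 + X $ 2 $ 2) h2 = 0"
    using 0[of 0] by (simp add: \<psi>_def c)
  moreover have "X $ 1 $ 3 = 0" using 0[of 4] z_nonzero by (simp add: \<psi>_def c)
  moreover have "X $ 3 $ 1 = 0" using 0[of "- 4"] z_nonzero by (simp add: \<psi>_def c)
  moreover have "X $ 3 $ 3 = - X $ 1 $ 1 - X $ 2 $ 2"
    using assms(1) by (simp add: sl_def trace_def sum_3 eq_neg_iff_add_eq_0 algebra_simps)
  ultimately show ?thesis
    by (auto simp: vec_eq_iff forall_3 dest!: e_independent F_independent h_independent)
qed

lemma \<psi>_hom:
  assumes "X \<in> {unit_mat 1 2, unit_mat 2 3, unit_mat 2 1, unit_mat 3 2}" "Y \<in> sl"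
  shows "\<psi> (X ** Y - Y ** X) = bracket (\<psi> X) (\<psi> Y)"
proof -
  have Y33: "Y $ 3 $ 3 = - Y $ 1 $ 1 - Y $ 2 $ 2"
    using assms(2) by (simp add: sl_def trace_def sum_3 eq_neg_iff_add_eq_0 algebra_simps)
  show ?thesis using assms(1)
    by (auto simp: \<psi>_def matrix_matrix_mult_def unit_mat_def sum_3 Y33 bracket_linear table chevalley_e chevalley_h
        scale_double scale_left_distrib scale_left_diff_distrib scale_right_distrib algebra_simps)
qed

lemma isomorphic_sl3: "lie_isomorphic_matrices (sl :: (complex^3^3) set)"
proof (rule lie_isomorphic_matricesI[OF _ _ _ _ _ _ \<psi>_hom \<psi>_inj])
  show "{unit_mat 1 2, unit_mat 2 3, unit_mat 2 1, unit_mat 3 2} \<subseteq> (sl :: (complex^3^3) set)"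
    by (simp add: sl_def trace_def unit_mat_def sum_3)
  show "\<psi> (X + Y) = \<psi> X + \<psi> Y" for X Y
    by (simp add: \<psi>_def scale_left_distrib algebra_simps)
  show "\<psi> (\<chi> i j. k * X $ i $ j) = scale k (\<psi> X)" for k X
    by (simp add: \<psi>_def scale_right_distrib flip: distrib_left)
  show "g 0 \<subseteq> W \<and> e \<in> W \<and> f \<in> W"
    if W: "subspace W" "\<psi> ` {unit_mat 1 2, unit_mat 2 3, unit_mat 2 1, unit_mat 3 2} \<subseteq> W"
      "\<And>x y. x \<in> W \<Longrightarrow> y \<in> W \<Longrightarrow> bracket x y \<in> W" for W
    by (rule generates) (use W in \<open>simp_all add: \<psi>_def unit_mat_def\<close>)
qed (simp_all add: sl_closed sl_nonempty)

end

section \<open>Reconstruction of sp(4) from its Serre relations\<close>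

locale sp4_generators = chevalley_rank_two scale bracket e f h Basis wt E eps e1 e2 c1 c2 2 1
  for scale :: "complex \<Rightarrow> 'g::ab_group_add \<Rightarrow> 'g" and bracket :: "'g \<Rightarrow> 'g \<Rightarrow> 'g"
    and e f h Basis wt E eps e1 e2 c1 c2 +
  assumes e_e: "bracket e1 (bracket e1 (bracket e1 e2)) = 0" "bracket e2 (bracket e1 e2) = 0"
    and F_F: "bracket F1 (bracket F1 (bracket F2 F1)) = 0" "bracket F2 (bracket F2 F1) = 0"
begin

definition "z = bracket e1 e2"
definition "z' = bracket F2 F1"
text \<open>The factors 1/2 and the sign of \<open>y'\<close> make \<open>y\<close> and
  \<open>y'\<close> correspond to the matrix units at (\<open>Inl 1\<close>, \<open>Inr 1\<close>)
  and (\<open>Inr 1\<close>, \<open>Inl 1\<close>): for matrices, \<open>bracket e1 z\<close> and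
  \<open>bracket F1 z'\<close> are 2 and -2 times these.\<close>

definition "y = scale (1 / 2) (bracket e1 z)"
definition "y' = - scale (1 / 2) (bracket F1 z')"

lemma half: "scale (1 / 2) (x + x) = x" "scale (1 / 2) x + scale (1 / 2) x = x"
  by (simp_all flip: scale_two scale_left_distrib)

lemma table:
  "bracket e1 e1 = 0" "bracket e1 e2 = z" "bracket e1 z = y + y" "bracket e1 y = 0"
  "bracket e1 z' = - (F2 + F2)" "bracket e1 y' = - z'"
  "bracket e2 e1 = - z" "bracket e2 e2 = 0" "bracket e2 z = 0" "bracket e2 y = 0"
  "bracket e2 z' = F1" "bracket e2 y' = 0"
  "bracket F1 F1 = 0" "bracket F1 F2 = - z'" "bracket F1 z = e2 + e2" "bracket F1 y = z"
  "bracket F1 z' = - (y' + y')" "bracket F1 y' = 0"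
  "bracket F2 F2 = 0" "bracket F2 F1 = z'" "bracket F2 z = - e1" "bracket F2 y = 0"
  "bracket F2 z' = 0" "bracket F2 y' = 0"
proof -
  show 1: "bracket e1 e1 = 0" "bracket e1 e2 = z" "bracket e1 z = y + y"
    "bracket e2 e1 = - z" "bracket e2 e2 = 0" "bracket e2 z = 0" "bracket e1 y = 0"
    "bracket F1 F1 = 0" "bracket F1 F2 = - z'" "bracket F1 z' = - (y' + y')" "bracket F1 y' = 0"
    "bracket F2 F2 = 0" "bracket F2 F1 = z'" "bracket F2 z' = 0"
    using e_e F_F bracket_anti[of e2 e1] bracket_anti[of F1 F2]
    by (simp_all add: z_def z'_def y_def y'_def bracket_self bracket_linear half)
  show 2: "bracket e1 z' = - (F2 + F2)" "bracket e2 z' = F1" "bracket F1 z = e2 + e2" "bracket F2 z = - e1"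
    by (simp_all add: z_def z'_def chevalley_e chevalley_h bracket_linear scale_two
      bracket_bracket[of e1 F2] bracket_bracket[of e2 F2] bracket_bracket[of F1 e1] bracket_bracket[of F2 e1])
  have h1z: "bracket h1 z = 0" "bracket h1 z' = 0"
    by (simp_all add: z_def z'_def chevalley_h bracket_linear scale_two bracket_bracket[of h1])
  have "bracket e2 (bracket e1 z) = 0"
    by (subst bracket_bracket) (simp add: bracket_linear bracket_self 1)
  moreover have "bracket F2 (bracket e1 z) = 0"
    by (subst bracket_bracket) (simp add: bracket_linear bracket_self 2 chevalley_e)
  ultimately show "bracket e2 y = 0" "bracket F2 y = 0"
    by (simp_all only: y_def bracket_scale_right scale_zero_right)
  have "bracket e2 (bracket F1 z') = 0"
    by (subst bracket_bracket) (simp add: bracket_linear bracket_self 2 chevalley_e)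
  moreover have "bracket F2 (bracket F1 z') = 0"
    by (subst bracket_bracket) (simp add: bracket_linear bracket_self 1)
  ultimately show "bracket e2 y' = 0" "bracket F2 y' = 0"
    by (simp_all only: y'_def bracket_scale_right bracket_minus_right scale_zero_right minus_zero)
  have "bracket F1 (bracket e1 z) = z + z"
    by (subst bracket_bracket) (simp add: chevalley_e bracket_linear h1z 2 1)
  then show "bracket F1 y = z"
    by (simp only: y_def bracket_scale_right half)
  have "bracket e1 (bracket F1 z') = z' + z'"
    by (subst bracket_bracket) (simp add: chevalley_e bracket_linear h1z 2 1)
  then show "bracket e1 y' = - z'"
    by (simp only: y'_def bracket_scale_right bracket_minus_right half)
qed

definition \<psi> :: "complex^(2+2)^(2+2) \<Rightarrow> 'g" where
  "\<psi> X = scale (X $ Inl 1 $ Inl 2) e1 + scale (X $ Inl 2 $ Inr 2) e2 + scale (X $ Inl 1 $ Inr 2) z +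
    scale (X $ Inl 1 $ Inr 1) y +
    scale (X $ Inl 2 $ Inl 1) F1 + scale (X $ Inr 2 $ Inl 2) F2 + scale (X $ Inr 1 $ Inl 2) z' +
    scale (X $ Inr 1 $ Inl 1) y' +
    scale (X $ Inl 1 $ Inl 1) h1 + scale (X $ Inl 1 $ Inl 1 + X $ Inl 2 $ Inl 2) h2"

lemma z_g: "z \<in> g 4" "z' \<in> g (- 4)" "y \<in> g 6" "y' \<in> g (- 6)"
proof -
  show z: "z \<in> g 4" "z' \<in> g (- 4)"
    using gr_bracket[OF E_g E_g, of e1 e2] gr_bracket[OF Fg(2,1)] by (simp_all add: z_def z'_def)
  have "bracket e1 z \<in> g 6" "bracket F1 z' \<in> g (- 6)"
    using gr_bracket[OF E_g z(1), of e1] gr_bracket[OF Fg(1) z(2)] by simp_all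
  then show "y \<in> g 6" "y' \<in> g (- 6)"
    by (simp_all add: y_def y'_def subspace_neg[OF gr_subspace] subspace_scale[OF gr_subspace])
qed

lemma z_nonzero: "z \<noteq> 0" "z' \<noteq> 0" "y \<noteq> 0" "y' \<noteq> 0"
proof -
  show z: "z \<noteq> 0" "z' \<noteq> 0" using table(21,11) E_nonzero[of e1] F_nonzero by auto
  show "y \<noteq> 0" "y' \<noteq> 0" using table(16,6) z by auto
qed

lemma \<psi>_inj:
  assumes "X \<in> sp" "\<psi> X = 0"
  shows "X = 0"
proof -
  have 0: "comp k (\<psi> X) = 0" for k by (simp only: assms(2) pos.lin_0[OF comp_lin])
  note c = comp_simps comp_on_g[OF E_g] comp_on_g[OF z_g(1)] comp_on_g[OF z_g(2)] comp_on_g[OF z_g(3)]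
    comp_on_g[OF z_g(4)] comp_on_g[OF Fg(1)] comp_on_g[OF Fg(2)] comp_on_g[OF hg(1)] comp_on_g[OF hg(2)]
  have "scale (X $ Inl 1 $ Inl 2) e1 + scale (X $ Inl 2 $ Inr 2) e2 = 0"
    using 0[of 2] by (simp add: \<psi>_def c)
  moreover have "scale (X $ Inl 2 $ Inl 1) F1 + scale (X $ Inr 2 $ Inl 2) F2 = 0"
    using 0[of "- 2"] by (simp add: \<psi>_def c)
  moreover have "scale (X $ Inl 1 $ Inl 1) h1 + scale (X $ Inl 1 $ Inl 1 + X $ Inl 2 $ Inl 2) h2 = 0"
    using 0[of 0] by (simp add: \<psi>_def c)
  moreover have "X $ Inl 1 $ Inr 2 = 0" using 0[of 4] z_nonzero by (simp add: \<psi>_def c)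
  moreover have "X $ Inr 1 $ Inl 2 = 0" using 0[of "- 4"] z_nonzero by (simp add: \<psi>_def c)
  moreover have "X $ Inl 1 $ Inr 1 = 0" using 0[of 6] z_nonzero by (simp add: \<psi>_def c)
  moreover have "X $ Inr 1 $ Inl 1 = 0" using 0[of "- 6"] z_nonzero by (simp add: \<psi>_def c)
  ultimately show ?thesis using assms(1)
    by (auto simp: sp_iff vec_eq_iff all_2_2 dest!: e_independent F_independent h_independent)
qed

text \<open>\<open>e1\<close> belongs to the short simple root, for which the symplectic condition
  forces a second matrix entry; \<open>e2\<close> belongs to the long one.\<close>

abbreviation generators :: "(complex^(2+2)^(2+2)) set" where
  "generators \<equiv> {unit_mat (Inl 1) (Inl 2) - unit_mat (Inr 2) (Inr 1), unit_mat (Inl 2) (Inr 2),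
    unit_mat (Inl 2) (Inl 1) - unit_mat (Inr 1) (Inr 2), unit_mat (Inr 2) (Inl 2)}"

lemma \<psi>_hom:
  assumes "X \<in> generators" "Y \<in> sp"
  shows "\<psi> (X ** Y - Y ** X) = bracket (\<psi> X) (\<psi> Y)"
proof -
  note Y = assms(2)[unfolded sp_iff]
  show ?thesis using assms(1)
    by (elim insertE emptyE; hypsubst; simp add: \<psi>_def matrix_matrix_mult_def unit_mat_def sum_UNIV_2_2 Y
        bracket_linear table chevalley_e chevalley_h scale_two scale_double scale_left_distrib scale_left_diff_distrib scale_right_distrib algebra_simps)
qed

lemma isomorphic_sp4: "lie_isomorphic_matrices (sp :: (complex^(2+2)^(2+2)) set)"
proof (rule lie_isomorphic_matricesI[OF _ _ _ _ _ _ \<psi>_hom \<psi>_inj])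
  show "generators \<subseteq> sp"
    by (simp add: sp_iff unit_mat_def)
  show "\<psi> (X + Y) = \<psi> X + \<psi> Y" for X Y
    by (simp add: \<psi>_def scale_left_distrib algebra_simps)
  show "\<psi> (\<chi> i j. k * X $ i $ j) = scale k (\<psi> X)" for k X
    by (simp add: \<psi>_def scale_right_distrib flip: distrib_left)
  show "g 0 \<subseteq> W \<and> e \<in> W \<and> f \<in> W"
    if W: "subspace W" "\<psi> ` generators \<subseteq> W" "\<And>x y. x \<in> W \<Longrightarrow> y \<in> W \<Longrightarrow> bracket x y \<in> W" for W
    by (rule generates) (use W in \<open>simp_all add: \<psi>_def unit_mat_def\<close>)
qed (simp_all add: sp_closed sp_nonempty)

end

section \<open>From dimension patterns to isomorphisms\<close>

context simple_root_basis
begin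

lemma g_one_dimensional:
  assumes "D k = 1" "z \<in> g k" "z \<noteq> 0" "x \<in> g k"
  obtains a where "x = scale a z"
proof -
  have "span {z} = g k"
    using assms by (intro pos.subspace_dim_equal subspace_span gr_subspace span_minimal) (simp_all add: dim_g)
  then have "x \<in> range (\<lambda>a. scale a z)" using assms(4) by (simp only: span_singleton)
  then show ?thesis using that by blast
qed

lemma sl3_case:
  assumes D: "D 2 = 2" "D 4 = 1" "D 6 = 0"
  shows "lie_isomorphic_matrices (sl :: (complex^3^3) set)"
proof -
  have "card E = 2" using D(1) D_2_card by simp
  then obtain u v where uv: "E = {u, v}" "u \<noteq> v" by (auto simp: card_2_iff)
  interpret rank_two scale bracket e f h Basis wt E eps u v
    by unfold_locales (use uv in auto)
  have z: "bracket u v \<noteq> 0" "bracket v u \<noteq> 0"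
    using g4_zero D(2) bracket_anti[of v u] by auto
  have "g 6 = {0}" using D(3) D_0_iff by simp
  then have 0: "bracket u (bracket u v) = 0" "bracket v (bracket v u) = 0"
    using gr_bracket[OF E_g gr_bracket[OF E_g E_g], of u u v] gr_bracket[OF E_g gr_bracket[OF E_g E_g], of v v u] by simp_all
  have ab: "w u (kv u) + 2 * w v (kv u) = 0" and dc: "w v (kv v) + 2 * w u (kv v) = 0"
    using fv_string(2)[of u v] fv_string(2)[of v u] uv(2) 0 z by (simp_all add: add_eq_0_iff)
  have "w u (kv u) + w u (kv v) = 2" "w v (kv u) + w v (kv v) = 2" by (simp_all add: cartan_sums)
  \<comment> \<open>Four linear equations in four unknowns: two from the ends of the strings, two
    from the value 2 of simple roots at \<open>h\<close>. The solution makes \<open>h\<close> twice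
    the sum of the two coroots.\<close>
  with ab dc have cartan: "w u (kv u) = 4" "w v (kv u) = - 2" "w u (kv v) = - 2" "w v (kv v) = 4" by algebra+
  interpret chevalley_rank_two scale bracket e f h Basis wt E eps u v 2 2 1 1
    by unfold_locales (simp_all add: cartan)
  have "bracket (fv u) (bracket (fv u) (fv v)) = 0"
    by (rule e_injI[OF gr_bracket[OF fv_g gr_bracket[OF fv_g fv_g]]])
      (use uv(2) ab in \<open>simp_all add: E_string\<close>)
  moreover have "bracket (fv v) (bracket (fv v) (fv u)) = 0"
    by (rule e_injI[OF gr_bracket[OF fv_g gr_bracket[OF fv_g fv_g]]])
      (use uv(2) dc in \<open>simp_all add: E_string\<close>)
  ultimately interpret sl3_generators scale bracket e f h Basis wt E eps u v 2 2
    by unfold_locales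
      (use 0 bracket_anti[of u v] bracket_anti[of "fv v" "fv u"] in \<open>simp_all add: F1_def F2_def bracket_linear\<close>)
  show ?thesis by (rule isomorphic_sl3)
qed

lemma sp4_case_short_long:
  assumes D: "D 4 = 1" "D 6 = 1" "D 8 = 0" and uv: "E = {u, v}" "u \<noteq> v"
    and y: "bracket u (bracket u v) \<noteq> 0"
  shows "lie_isomorphic_matrices (sp :: (complex^(2+2)^(2+2)) set)"
proof -
  interpret rank_two scale bracket e f h Basis wt E eps u v
    by unfold_locales (use uv in auto)
  have z: "bracket u v \<noteq> 0" "bracket v u \<noteq> 0"
    using g4_zero D(1) bracket_anti[of v u] by auto
  have g6: "bracket u (bracket u v) \<in> g 6" "bracket v (bracket u v) \<in> g 6"
    using gr_bracket[OF E_g gr_bracket[OF E_g E_g], of u u v] gr_bracket[OF E_g gr_bracket[OF E_g E_g], of v u v] by simp_all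
  obtain k where k: "bracket v (bracket u v) = scale k (bracket u (bracket u v))"
    using g_one_dimensional[OF D(2) g6(1) y g6(2)] .
  have "bracket (eps u) (bracket v (bracket u v)) = bracket v (bracket u v)"
    "bracket (eps u) (bracket u (bracket u v)) = bracket u (bracket u v) + bracket u (bracket u v)"
    using uv(2) by (simp_all add: bracket_bracket[of "eps u" u] bracket_bracket[of "eps u" v] eps_E)
  then have "bracket v (bracket u v) = bracket v (bracket u v) + bracket v (bracket u v)"
    by (metis k bracket_scale_right scale_right_distrib)
  then have vz: "bracket v (bracket u v) = 0" by simp
  then have vz': "bracket v (bracket v u) = 0" using bracket_anti[of v u] by (simp add: bracket_linear)
  have "g 8 = {0}" using D(3) D_0_iff by simp
  then have uy: "bracket u (bracket u (bracket u v)) = 0"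
    using gr_bracket[OF E_g g6(1), of u] by simp
  have ab: "w u (kv u) + w v (kv u) = 0" and dc: "w v (kv v) + 2 * w u (kv v) = 0"
    using fv_string(3)[of u v] fv_string(2)[of v u] uv(2) uy vz' y z by (simp_all add: add_eq_0_iff)
  have "w u (kv u) + w u (kv v) = 2" "w v (kv u) + w v (kv v) = 2" by (simp_all add: cartan_sums)
  \<comment> \<open>Here \<open>h\<close> becomes 3 times the coroot of \<open>u\<close> plus 4
    times that of \<open>v\<close>.\<close>
  with ab dc have cartan: "w u (kv u) = 6" "w v (kv u) = - 6" "w u (kv v) = - 4" "w v (kv v) = 8" by algebra+
  interpret chevalley_rank_two scale bracket e f h Basis wt E eps u v 3 4 2 1
    by unfold_locales (simp_all add: cartan)
  have "bracket (fv u) (bracket (fv u) (bracket (fv u) (fv v))) = 0"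
    by (rule e_injI[OF gr_bracket[OF fv_g gr_bracket[OF fv_g gr_bracket[OF fv_g fv_g]]]])
      (use uv(2) ab in \<open>simp_all add: E_string\<close>)
  moreover have "bracket (fv v) (bracket (fv v) (fv u)) = 0"
    by (rule e_injI[OF gr_bracket[OF fv_g gr_bracket[OF fv_g fv_g]]])
      (use uv(2) dc in \<open>simp_all add: E_string\<close>)
  ultimately interpret sp4_generators scale bracket e f h Basis wt E eps u v 3 4
    by unfold_locales
      (use uy vz bracket_anti[of "fv v" "fv u"] in \<open>simp_all add: F1_def F2_def bracket_linear\<close>)
  show ?thesis by (rule isomorphic_sp4)
qed

text \<open>If both double brackets vanished, \<open>bracket e\<close> would kill the
  one-dimensional \<open>g 4\<close>, whose image is \<open>g 6\<close>. The one that survives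
  decides which simple root is short.\<close>

lemma sp4_case:
  assumes D: "D 2 = 2" "D 4 = 1" "D 6 = 1" "D 8 = 0"
  shows "lie_isomorphic_matrices (sp :: (complex^(2+2)^(2+2)) set)"
proof -
  have "card E = 2" using D(1) D_2_card by simp
  then obtain u v where uv: "E = {u, v}" "u \<noteq> v" by (auto simp: card_2_iff)
  interpret rank_two scale bracket e f h Basis wt E eps u v
    by unfold_locales (use uv in auto)
  have z: "bracket u v \<noteq> 0" using g4_zero D(2) by auto
  have "bracket u (bracket u v) \<noteq> 0 \<or> bracket v (bracket v u) \<noteq> 0"
  proof (rule ccontr)
    assume "\<not> (bracket u (bracket u v) \<noteq> 0 \<or> bracket v (bracket v u) \<noteq> 0)"
    then have ez: "bracket e (bracket u v) = 0"
      using bracket_anti[of u v] by (simp add: e_sum bracket_linear)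
    have "x = 0" if x: "x \<in> g 6" for x
    proof -
      from x obtain t where t: "t \<in> g 4" "x = bracket e t" by (rule e_surj) auto
      obtain a where "t = scale a (bracket u v)" using g_one_dimensional[OF D(2) bracket_E_g4 z t(1)] .
      then show ?thesis using t(2) ez by (simp add: bracket_linear)
    qed
    then have "D 6 = 0" using D_0_iff subspace_0[OF gr_subspace] by blast
    then show False using D(3) by simp
  qed
  then show ?thesis
  proof
    assume "bracket u (bracket u v) \<noteq> 0"
    then show ?thesis by (rule sp4_case_short_long[OF D(2-4) uv])
  next
    assume "bracket v (bracket v u) \<noteq> 0"
    then show ?thesis using uv by (intro sp4_case_short_long[OF D(2-4), of v u]) auto
  qed
qed

section \<open>Multiples of \<rho> in \<Sigma>\<close>

lemma highest_root_degree:
  assumes \<alpha>: "bij_betw \<alpha> {1..r} (simple_roots h)"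
    and hr: "highest_root h (\<lambda>t. \<Sum>i=1..r. of_nat (m i) * \<alpha> i t)"
  shows "D (2 * int (\<Sum>i=1..r. m i)) \<noteq> 0"
proof -
  let ?\<beta> = "\<lambda>t. \<Sum>i=1..r. of_nat (m i) * \<alpha> i t"
  have "?\<beta> \<in> roots (g 0)" using hr by (simp add: highest_root_def gr_0)
  moreover have "0 \<in> root_space (g 0) ?\<beta>" by (simp add: root_space_def)
  ultimately obtain x where x: "x \<noteq> 0" "x \<in> root_space (g 0) ?\<beta>" by (auto simp: roots_def)
  have "\<alpha> i h = 2" if "i \<in> {1..r}" for i
    using \<alpha> that by (intro simple_root_h) (auto simp: bij_betw_def)
  then have "?\<beta> h = of_int (2 * int (\<Sum>i=1..r. m i))"
    by (simp add: sum_distrib_left mult.commute)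
  moreover have "bracket h x = scale (?\<beta> h) x" using x(2) h_g by (simp add: root_space_def)
  ultimately have "x \<in> g (2 * int (\<Sum>i=1..r. m i))" by (simp only: gr_def mem_Collect_eq)
  then show ?thesis using x(1) D_0_iff by blast
qed

text \<open>\<open>s\<close> times \<rho> has the value \<open>s\<close> on each simple coroot, and
  by the expansion of \<open>h\<close> its weighted sum is \<open>s\<close> times
  \<open>half_trace h\<close>. The function is cut off outside \<open>g 0\<close> to lie in
  \<open>dual\<close>.\<close>

lemma Sigma_weights_half_trace:
  assumes data: "principal_sl2_data scale bracket e f h r \<alpha> c m n"
    and s: "s \<le> 1" "1 + 2 * (\<Sum>i=1..r. real (m i)) \<le> s * Re (half_trace h)"
  shows "(\<lambda>t. if t \<in> g 0 then of_real s * half_trace t else 0) \<in> Sigma_weights h r c m n"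
proof -
  interpret data: principal_sl2_data scale bracket e f h r \<alpha> c m n by (rule data)
  have c: "c i \<in> g 0" "half_trace (c i) = 1" if i: "i \<in> {1..r}" for i
  proof -
    have "\<alpha> i \<in> simple_roots h" using data.simple_roots_enum i by (auto simp: bij_betw_def)
    from half_trace_coroot[OF this data.coroots[OF i]] show "c i \<in> g 0" "half_trace (c i) = 1"
      by (simp_all add: gr_0)
  qed
  have ht_sum: "half_trace (sum x A) = (\<Sum>a\<in>A. half_trace (x a))" for x :: "nat \<Rightarrow> 'g" and A
    using half_trace_scale[of 0 0] by (induction A rule: infinite_finite_induct) (simp_all add: half_trace_add)
  have "half_trace h = (\<Sum>i=1..r. of_nat (n i))"
    by (subst data.h_expansion) (simp add: ht_sum half_trace_scale c)
  then have "Re (half_trace h) = (\<Sum>i=1..r. real (n i))" by simp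
  then have "1 + 2 * (\<Sum>i=1..r. real (m i)) \<le> (\<Sum>i=1..r. real (n i) * s)"
    using s(2) by (simp add: mult.commute flip: sum_distrib_left)
  moreover have "(\<Sum>i=1..r. real (n i) * Re (if c i \<in> g 0 then of_real s * half_trace (c i) else 0)) = (\<Sum>i=1..r. real (n i) * s)"
    by (intro sum.cong) (simp_all add: c)
  moreover have "(\<lambda>t. if t \<in> g 0 then of_real s * half_trace t else 0) \<in> dual (g 0)"
    by (auto simp: dual_def half_trace_add half_trace_scale distrib_left subspace_add[OF gr_subspace] subspace_scale[OF gr_subspace])
  ultimately show ?thesis
    using s(1) c unfolding Sigma_weights_def gr_0[symmetric] by simp
qed

lemma Sigma_weights_dichotomy:
  assumes data: "principal_sl2_data scale bracket e f h r \<alpha> c m n"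
    and sl2: "\<not> lie_isomorphic_matrices (sl :: (complex^2^2) set)"
    and sl3: "\<not> lie_isomorphic_matrices (sl :: (complex^3^3) set)"
  shows "Sigma_weights h r c m n \<noteq> {} \<and>
    (\<not> lie_isomorphic_matrices (sp :: (complex^(2 + 2)^(2 + 2)) set) \<longrightarrow> infinite (Sigma_weights h r c m n))"
proof -
  interpret data: principal_sl2_data scale bracket e f h r \<alpha> c m n by (rule data)
  define M where "M = (\<Sum>i=1..r. m i)"
  define S where "S = (\<Sum>b | b \<in> Basis \<and> wt b > 0. wt b)"
  define \<gamma> where "\<gamma> s t = (if t \<in> g 0 then of_real s * half_trace t else 0)" for s :: real and t
  have ht: "Re (half_trace h) = of_int S / 2" unfolding half_trace_h S_def[symmetric] by simp
  have M: "(\<Sum>i=1..r. real (m i)) = real M" by (simp add: M_def)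
  have in_Sigma: "\<gamma> s \<in> Sigma_weights h r c m n" if "s \<le> 1" "1 + 2 * real M \<le> s * (of_int S / 2)" for s
    unfolding \<gamma>_def using that by (intro Sigma_weights_half_trace[OF data]) (simp_all only: M ht)
  have "D (2 * int M) \<noteq> 0"
    unfolding M_def by (rule highest_root_degree[OF data.simple_roots_enum data.highest])
  \<comment> \<open>The patterns of sl(2) and sl(3) are excluded by hypothesis; without strict
    inequality only that of sp(4) remains.\<close>
  from weight_sum_cases[OF this] have cases: "2 * (1 + 2 * int M) \<le> S \<and> lie_isomorphic_matrices (sp :: (complex^(2 + 2)^(2 + 2)) set)
      \<or> 2 * (1 + 2 * int M) < S"
    using sl2 sl3 sl2_case sl3_case sp4_case unfolding S_def by blast
  have real_le: "1 + 2 * real M \<le> of_int S / 2" if "2 * (1 + 2 * int M) \<le> S"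
  proof -
    have "real_of_int (2 * (1 + 2 * int M)) \<le> of_int S" using that by (simp only: of_int_le_iff)
    then show ?thesis by simp
  qed
  have "2 * (1 + 2 * int M) \<le> S" using cases by linarith
  then have "\<gamma> 1 \<in> Sigma_weights h r c m n" using in_Sigma real_le by simp
  moreover have "infinite (Sigma_weights h r c m n)" if lt: "2 * (1 + 2 * int M) < S"
  proof
    assume fin: "finite (Sigma_weights h r c m n)"
    \<comment> \<open>The multiple at which the inequality becomes an equality; strictness puts it
      below 1, so a whole interval of multiples works.\<close>
    define s0 where "s0 = (1 + 2 * real M) / (of_int S / 2)"
    have "real_of_int (2 * (1 + 2 * int M)) < of_int S" using lt by (simp only: of_int_less_iff)
    then have pos: "0 < 1 + 2 * real M" "1 + 2 * real M < of_int S / 2" by simp_all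
    then have s0: "s0 < 1" by (simp add: s0_def)
    have "\<gamma> ` {s0..1} \<subseteq> Sigma_weights h r c m n"
    proof
      fix x assume "x \<in> \<gamma> ` {s0..1}"
      then obtain s where s: "s0 \<le> s" "s \<le> 1" "x = \<gamma> s" by auto
      have "s0 * (of_int S / 2) \<le> s * (of_int S / 2)" using s pos by (intro mult_right_mono) simp_all
      then show "x \<in> Sigma_weights h r c m n" using in_Sigma[of s] s pos by (simp add: s0_def)
    qed
    then have "finite (\<gamma> ` {s0..1})" using fin finite_subset by blast
    \<comment> \<open>Different multiples differ at \<open>h\<close>, where
      \<open>half_trace\<close> is nonzero.\<close>
    moreover have "inj_on \<gamma> {s0..1}"
    proof (rule inj_onI)
      fix s t assume "\<gamma> s = \<gamma> t"
      then have "\<gamma> s h = \<gamma> t h" by simp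
      then have "of_real s * half_trace h = of_real t * half_trace h" using h_g by (simp add: \<gamma>_def)
      moreover have "half_trace h \<noteq> 0" using ht pos by auto
      ultimately show "s = t" by simp
    qed
    ultimately have "finite {s0..1}" using finite_imageD by blast
    then show False using s0 by (simp add: infinite_Icc)
  qed
  ultimately show ?thesis using cases by blast
qed

end

theorem proposition39:
  fixes scale :: "complex \<Rightarrow> 'g::ab_group_add \<Rightarrow> 'g" and bracket :: "'g \<Rightarrow> 'g \<Rightarrow> 'g"
    and e f h :: 'g and r :: nat and \<alpha> :: "nat \<Rightarrow> 'g \<Rightarrow> complex" and c :: "nat \<Rightarrow> 'g"
    and m n :: "nat \<Rightarrow> nat"
  assumes "principal_sl2_data scale bracket e f h r \<alpha> c m n"
    and "\<not> complex_lie_algebra.lie_isomorphic_matrices scale bracket (sl :: (complex^2^2) set)"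
    and "\<not> complex_lie_algebra.lie_isomorphic_matrices scale bracket (sl :: (complex^3^3) set)"
  shows "complex_lie_algebra.Sigma_weights scale bracket h r c m n \<noteq> {} \<and>
    (\<not> complex_lie_algebra.lie_isomorphic_matrices scale bracket
         (sp :: (complex^(2 + 2)^(2 + 2)) set) \<longrightarrow>
       infinite (complex_lie_algebra.Sigma_weights scale bracket h r c m n))"
proof -
  interpret data: principal_sl2_data scale bracket e f h r \<alpha> c m n by (rule assms(1))
  interpret sl2: principal_sl2 scale bracket e f h
    by unfold_locales (rule data.principal)
  obtain B wt where "finite B" "data.independent B" "data.span B = UNIV"
    "\<And>b. b \<in> B \<Longrightarrow> bracket h b = scale (of_int (wt b)) b"
    by (rule sl2.weight_basis) blast
  then interpret graded: graded_principal_sl2 scale bracket e f h B wt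
    by unfold_locales
  obtain E eps where "finite E" "data.independent E" "data.span E = graded.g 2" "(\<Sum>v\<in>E. v) = e"
    "\<And>v. v \<in> E \<Longrightarrow> eps v \<in> graded.g 0" "\<And>v. v \<in> E \<Longrightarrow> bracket (eps v) e = v"
    "\<And>u v. u \<in> E \<Longrightarrow> v \<in> E \<Longrightarrow> bracket (eps u) v = (if u = v then v else 0)"
    by (rule graded.simple_root_vectors) blast
  then interpret roots: simple_root_basis scale bracket e f h B wt E eps
    by unfold_locales
  show ?thesis by (rule roots.Sigma_weights_dichotomy[OF assms])
qed

end
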